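(* Let $X$ be a symmetric transient Borel right process with state space $\mathbb N$ and strictly positive potential density $U=\{U_{j,k}\}_{j,k\in\mathbb N}$, let $f=\{f_k\}_{k\in\mathbb N}$ be a finite excessive function for $X$, let $\alpha>0$, and let $\widetilde X_\alpha=\{\widetilde X_{\alpha,j}\}_{j\in\mathbb N}$ be an $\alpha$-permanental sequence with kernel $\widetilde U_{j,k}=U_{j,k}+f_k$, $j,k\in\mathbb N$. If $$\inf_jU_{j,j}>0,\qquad \sup_j\sum_{k=1}^\infty U_{j,k}<\infty,\qquad\text{and}\qquad f\in c_0^+,$$ then $$\limsup_{n\to\infty}\frac{\widetilde X_{\alpha,n}}{U_{n,n}\log n}=1\quad\text{a.s.}$$
   Context: $\mathbb N=\{1,2,\dots\}$; $c_0^+$ is the set of non-negative sequences converging to $0$. Permanental sequences: for $\alpha>0$ and a matrix $K=\{K_{j,k}\}_{j,k\in\mathbb N}$, an $\alpha$-permanental sequence with kernel $K$ is a sequence $\{Z_j\}_{j\in\mathbb N}$ of non-negative random variables such that for all $n$, all distinct $i_1,\dots,i_n\in\mathbb N$ and all $s_1,\dots,s_n>0$, $E\exp(-\sum_{m=1}^n s_mZ_{i_m})=\det(I+K'S)^{-\alpha}$, where $K'=\{K_{i_p,i_q}\}_{p,q=1}^n$ and $S=\mathrm{diag}(s_1,\dots,s_n)$. Processes: a Borel right process $X$ on the countable discrete space $\mathbb N$ is a continuous-time right-continuous strong Markov process (possibly sent to a cemetery state at a finite lifetime) with transition functions $p_t(j,k)$ and semigroup $P_t$. Its potential density (with respect to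 counting measure) is $U_{j,k}=\int_0^\infty p_t(j,k)\,dt$; $X$ is transient if these are finite and symmetric if $p_t(j,k)=p_t(k,j)$. A non-negative function $f$ on $\mathbb N$ is excessive for $X$ if $P_tf(j)\uparrow f(j)$ as $t\downarrow 0$ for all $j$. It is a known fact that for such $X$ and finite excessive $f$, $\{U_{j,k}+f_k\}$ is the kernel of an $\alpha$-permanental sequence for every $\alpha>0$. *)

theory Defs
  imports
    "HOL-Probability.Probability"
    "Jordan_Normal_Form.Determinant"
begin

text \<open>
  The state space is a countable discrete set \<open>E\<close>; the cemetery is \<open>None\<close> and a live state \<open>j\<close> is
  \<open>Some j\<close>. Time runs through \<open>[0,\<infinity>]\<close>, so that stopping times may be infinite, with the usual
  convention that the path sits in the cemetery at time \<open>\<infinity>\<close>. The measure \<open>P j\<close> is the law of the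
  process started at \<open>j\<close>.
\<close>

definition transition_function ::
    "('a \<Rightarrow> 'w measure) \<Rightarrow> (ennreal \<Rightarrow> 'w \<Rightarrow> 'a option) \<Rightarrow> ennreal \<Rightarrow> 'a \<Rightarrow> 'a \<Rightarrow> real"
  where "transition_function P X t j k = measure (P j) {\<omega> \<in> space (P j). X t \<omega> = Some k}"

text \<open>
  On a discrete space, right continuity of a path means that it is constant on a right
  neighbourhood of every time; as \<open>None\<close> is absorbing, it makes no difference whether \<open>None\<close> is
  regarded as isolated or as the point at infinity. Since the filtration is right continuous,
  optional times and stopping times agree. The assumption \<open>strong_Markov\<close> reads
  \<open>P\<^sup>j(X\<^bsub>T+t\<^esub> = k | F\<^sub>T) = p\<^sub>t(X\<^sub>T, k)\<close>; both sides vanish on \<open>{T = \<infinity>}\<close>.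
\<close>

locale borel_right_process = filtration "space M" F
  for M :: "'w measure" and F :: "ennreal \<Rightarrow> 'w measure" +
  fixes E :: "'a set"
    and X :: "ennreal \<Rightarrow> 'w \<Rightarrow> 'a option"
    and P :: "'a \<Rightarrow> 'w measure"
  assumes countable_E: "countable E"
    and subalgebra_F: "\<And>t. subalgebra M (F t)"
    and right_continuous_F: "\<And>t. t < \<top> \<Longrightarrow> sets (F t) = (\<Inter>s\<in>{t<..}. sets (F s))"
    and prob_space_P: "\<And>j. j \<in> E \<Longrightarrow> prob_space (P j)"
    and sets_P: "\<And>j. j \<in> E \<Longrightarrow> sets (P j) = sets M"
    and adapted: "\<And>t. X t \<in> measurable (F t) (count_space (insert None (Some ` E)))"
    and right_continuous_X:
      "\<And>t \<omega>. \<omega> \<in> space M \<Longrightarrow> t < \<top> \<Longrightarrow> \<forall>\<^sub>F s in at_right t. X s \<omega> = X t \<omega>"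
    and cemetery_absorbing:
      "\<And>s t \<omega>. \<omega> \<in> space M \<Longrightarrow> s \<le> t \<Longrightarrow> X s \<omega> = None \<Longrightarrow> X t \<omega> = None"
    and X_infinity: "\<And>\<omega>. \<omega> \<in> space M \<Longrightarrow> X \<top> \<omega> = None"
    and initial: "\<And>j. j \<in> E \<Longrightarrow> AE \<omega> in P j. X 0 \<omega> = Some j"
    and strong_Markov:
      "\<And>T t j k. stopping_time F T \<Longrightarrow> t < \<top> \<Longrightarrow> j \<in> E \<Longrightarrow> k \<in> E \<Longrightarrow>
        AE \<omega> in P j.
          real_cond_exp (P j) (pre_sigma T) (\<lambda>\<omega>. if X (T \<omega> + t) \<omega> = Some k then 1 else 0) \<omega>
          = (case X (T \<omega>) \<omega> of None \<Rightarrow> 0 | Some i \<Rightarrow> transition_function P X t i k)"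

definition symmetric_process ::
    "'a set \<Rightarrow> (ennreal \<Rightarrow> 'w \<Rightarrow> 'a option) \<Rightarrow> ('a \<Rightarrow> 'w measure) \<Rightarrow> bool"
  where "symmetric_process E X P \<longleftrightarrow>
    (\<forall>t<\<top>. \<forall>j\<in>E. \<forall>k\<in>E. transition_function P X t j k = transition_function P X t k j)"

definition potential_density ::
    "(ennreal \<Rightarrow> 'w \<Rightarrow> 'a option) \<Rightarrow> ('a \<Rightarrow> 'w measure) \<Rightarrow> 'a \<Rightarrow> 'a \<Rightarrow> ennreal"
  where "potential_density X P j k =
    (\<integral>\<^sup>+t\<in>{0..}. ennreal (transition_function P X (ennreal t) j k) \<partial>lborel)"

definition transient_process ::
    "'a set \<Rightarrow> (ennreal \<Rightarrow> 'w \<Rightarrow> 'a option) \<Rightarrow> ('a \<Rightarrow> 'w measure) \<Rightarrow> bool"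
  where "transient_process E X P \<longleftrightarrow> (\<forall>j\<in>E. \<forall>k\<in>E. potential_density X P j k < \<top>)"

definition semigroup_op ::
    "'a set \<Rightarrow> (ennreal \<Rightarrow> 'w \<Rightarrow> 'a option) \<Rightarrow> ('a \<Rightarrow> 'w measure) \<Rightarrow> ennreal \<Rightarrow> ('a \<Rightarrow> real) \<Rightarrow> 'a \<Rightarrow> ennreal"
  where "semigroup_op E X P t f j = (\<Sum>\<^sub>\<infinity>k\<in>E. ennreal (transition_function P X t j k * f k))"

text \<open>Only finite excessive functions are considered, hence \<open>f\<close> is real-valued.\<close>

definition excessive ::
    "'a set \<Rightarrow> (ennreal \<Rightarrow> 'w \<Rightarrow> 'a option) \<Rightarrow> ('a \<Rightarrow> 'w measure) \<Rightarrow> ('a \<Rightarrow> real) \<Rightarrow> bool"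
  where "excessive E X P f \<longleftrightarrow>
    (\<forall>j\<in>E. 0 \<le> f j) \<and>
    (\<forall>j\<in>E. antimono_on {0<..<\<top>} (\<lambda>t. semigroup_op E X P t f j) \<and>
      ((\<lambda>t. semigroup_op E X P t f j) \<longlongrightarrow> ennreal (f j)) (at_right 0))"

text \<open>
  The base of the power is automatically positive: the expectation is positive, whereas \<open>0 powr a = 0\<close>,
  so the determinant does not vanish, and it tends to 1 as all \<open>s m\<close> tend to 0.
\<close>

definition permanental_sequence ::
    "'b measure \<Rightarrow> real \<Rightarrow> 'i set \<Rightarrow> ('i \<Rightarrow> 'i \<Rightarrow> real) \<Rightarrow> ('i \<Rightarrow> 'b \<Rightarrow> real) \<Rightarrow> bool"
  where "permanental_sequence Q \<alpha> I K Z \<longleftrightarrow>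
    (\<forall>j\<in>I. Z j \<in> borel_measurable Q \<and> (\<forall>\<omega>\<in>space Q. 0 \<le> Z j \<omega>)) \<and>
    (\<forall>(n::nat) (i :: nat \<Rightarrow> 'i) (s :: nat \<Rightarrow> real).
      inj_on i {..<n} \<and> i ` {..<n} \<subseteq> I \<and> (\<forall>m<n. 0 < s m) \<longrightarrow>
      (\<integral>\<omega>. exp (- (\<Sum>m<n. s m * Z (i m) \<omega>)) \<partial>Q) =
        Determinant.det (1\<^sub>m n + Matrix.mat n n (\<lambda>(p, q). K (i p) (i q))
                                * Matrix.mat n n (\<lambda>(p, q). if p = q then s p else 0))
          powr (- \<alpha>))"

definition c0_plus :: "(nat \<Rightarrow> real) set"
  where "c0_plus = {f. (\<forall>k\<ge>1. 0 \<le> f k) \<and> f \<longlonglongrightarrow> 0}"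

end

theory Submission
  imports Defs
begin

text \<open>
  Upper bound: \<open>Z\<^sub>n\<close> is \<open>U\<^sub>n\<^sub>n + f\<^sub>n\<close> times a Gamma(\<open>\<alpha>\<close>) variable, so Chernoff and Borel-Cantelli apply.

  Lower bound: consider the block \<open>B = {N..<2N}\<close>. A domination principle for the potential shows that the
  block of \<open>K = U + 1 f\<^sup>T\<close> is the inverse of an M-matrix \<open>A\<close> with nonnegative row sums. Tilting the law by
  \<open>exp (- \<tau> \<Sum>\<^sub>B Z)\<close> replaces \<open>K\<close> by the resolvent \<open>R = (A + \<tau>)\<^sup>-\<^sup>1\<close>, whose row sums are at most \<open>1 / \<tau>\<close>
  whatever \<open>f\<close> is; with \<open>\<tau>\<close> a small negative power of \<open>N\<close> this makes most pairs of coordinates nearly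
  independent, while the diagonal of \<open>U\<close> survives because the column sums of \<open>U\<close> are bounded. The second
  moment method for the number of indices with \<open>Z\<^sub>n / R\<^sub>n\<^sub>n\<close> just above \<open>(1 - \<epsilon>) log N\<close> then shows that some
  coordinate of the block is large with tilted probability tending to 1. Since the M-matrix property makes the
  tilted vector stochastically smaller than the original one, the same holds for the original law.
\<close>

section \<open>Uniqueness of one-dimensional Laplace transforms\<close>

text \<open>The obstacle to a direct second moment argument is \<open>f\<close> itself: the
  dependence parameter \<open>K i j * K j i / (K i i * K j j)\<close> of the original vector is at
  least a constant times \<open>f i * f j\<close>, which may vanish arbitrarily slowly, whereas near
  level \<open>log N\<close> a joint density is close to the product of the marginals only if this
  parameter times \<open>(log N)^2\<close> tends to 0. The tilt trades this for a condition on
  powers of \<open>N\<close>: \<open>\<tau>\<close> must tend to 0 to spare the diagonal, yet the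
  number of strongly dependent partners of an index, of order \<open>1 / \<tau>^2\<close> here, must
  stay small against the expected number of large coordinates, about \<open>N^\<epsilon>\<close>.
  Blocks of the form \<open>[N, 2N)\<close> are used because \<open>log n\<close> is asymptotically
  constant on them. Failure on all late blocks is a null event as soon as the failure probabilities
  tend to 0, so the dependence between blocks does no harm.\<close>

text \<open>
  \<open>laplace_step\<close> is a decreasing combination of exponentials without constant term that tends to the indicator
  of \<open>[0,\<theta>)\<close> as \<open>m\<close> grows, except for the limit \<open>1 - 1 / e\<close> at \<open>\<theta>\<close> itself.
\<close>

definition laplace_step :: "real \<Rightarrow> nat \<Rightarrow> real \<Rightarrow> real" where
  "laplace_step \<theta> m z = 1 - (1 - exp (- (ln (real m) / \<theta>) * z)) ^ m"

definition weighted_step :: "real \<Rightarrow> real \<Rightarrow> real" where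
  "weighted_step \<theta> z = (if z < \<theta> then 1 else if z = \<theta> then 1 - exp (-1) else 0)"

lemma laplace_step_bounds:
  assumes "0 < \<theta>" "0 \<le> z" "1 \<le> m"
  shows "0 \<le> laplace_step \<theta> m z" "laplace_step \<theta> m z \<le> 1"
proof -
  have "exp (- (ln (real m) / \<theta>) * z) \<le> 1"
    using assms by simp
  then have "0 \<le> 1 - exp (- (ln (real m) / \<theta>) * z)" "1 - exp (- (ln (real m) / \<theta>) * z) \<le> 1"
    by auto
  then show "0 \<le> laplace_step \<theta> m z" "laplace_step \<theta> m z \<le> 1"
    unfolding laplace_step_def using power_le_one[of "1 - exp (- (ln (real m) / \<theta>) * z)"]
    by auto
qed

lemma laplace_step_antimono:
  assumes "0 < \<theta>" "0 \<le> z" "z \<le> z'" "1 \<le> m"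
  shows "laplace_step \<theta> m z' \<le> laplace_step \<theta> m z"
proof -
  have "exp (- (ln (real m) / \<theta>) * z') \<le> exp (- (ln (real m) / \<theta>) * z)"
    using assms by (simp add: divide_right_mono mult_left_mono)
  moreover have "exp (- (ln (real m) / \<theta>) * z) \<le> 1"
    using assms by simp
  ultimately show ?thesis
    unfolding laplace_step_def by (intro diff_left_mono power_mono) auto
qed

text \<open>At rate \<open>ln m / \<theta>\<close> the exponential is
  \<open>m powr (- z / \<theta>)\<close>, so \<open>m\<close> times it is
  \<open>m powr (1 - z / \<theta>)\<close>: it tends to infinity below the threshold, equals 1 at it
  and tends to 0 above it. The bound \<open>1 - x \<le> exp (- x)\<close>, the limit defining
  \<open>exp (-1)\<close> and Bernoulli's inequality settle the three cases.\<close>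

lemma laplace_step_tendsto:
  assumes "0 < \<theta>" "0 \<le> z"
  shows "(\<lambda>m. laplace_step \<theta> m z) \<longlonglongrightarrow> weighted_step \<theta> z"
proof -
  let ?x = "\<lambda>m. exp (- (ln (real m) / \<theta>) * z)"
  have x: "?x m = real m powr (- (z / \<theta>))" if "1 \<le> m" for m
    using that by (simp add: powr_def mult.commute)
  have mx: "real m * ?x m = real m powr (1 - z / \<theta>)" if "1 \<le> m" for m
    unfolding x[OF that] using that by (simp add: powr_diff powr_minus field_simps)
  have x01: "0 \<le> ?x m" "?x m \<le> 1" if "1 \<le> m" for m using assms that by auto
  consider "z < \<theta>" | "z = \<theta>" | "z > \<theta>" by linarith
  then show ?thesis
  proof cases
    case 1
    define e where "e = 1 - z / \<theta>"
    have "0 < e" using 1 assms by (simp add: e_def)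
    then have l: "(\<lambda>m. exp (- (real m powr e))) \<longlonglongrightarrow> 0" by real_asymp
    have b: "(1 - ?x m) ^ m \<le> exp (- (real m powr e))" if "1 \<le> m" for m
    proof -
      have "(1 - ?x m) ^ m \<le> exp (- ?x m) ^ m"
        using x01[OF that] exp_ge_add_one_self[of "- ?x m"] by (intro power_mono) auto
      also have "\<dots> = exp (- (real m * ?x m))"
        unfolding exp_of_nat_mult[symmetric] by simp
      finally show ?thesis unfolding mx[OF that] e_def .
    qed
    have a: "0 \<le> (1 - ?x m) ^ m" if "1 \<le> m" for m using x01[OF that] by simp
    have "(\<lambda>m. (1 - ?x m) ^ m) \<longlonglongrightarrow> 0"
      by (rule tendsto_sandwich[OF _ _ tendsto_const l]; rule eventually_sequentiallyI[of 1]; erule a b)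
    from tendsto_diff[OF tendsto_const this, of 1] show ?thesis
      using 1 unfolding laplace_step_def weighted_step_def by simp
  next
    case 2
    have "1 + (-1) / real m = 1 - ?x m" if "1 \<le> m" for m
      unfolding x[OF that] using 2 assms that by (simp add: powr_minus divide_simps)
    then have "(\<lambda>m. (1 - ?x m) ^ m) \<longlonglongrightarrow> exp (-1)"
      by (intro Lim_transform_eventually[OF tendsto_exp_limit_sequentially[of "-1::real"]]
            eventually_sequentiallyI[of 1]) auto
    from tendsto_diff[OF tendsto_const this, of 1] show ?thesis
      using 2 unfolding laplace_step_def weighted_step_def by simp
  next
    case 3
    define e where "e = 1 - z / \<theta>"
    have "e < 0" using 3 assms by (simp add: e_def)
    then have l: "(\<lambda>m. real m powr e) \<longlonglongrightarrow> 0" by real_asymp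
    have b: "1 - (1 - ?x m) ^ m \<le> real m powr e" if "1 \<le> m" for m
    proof -
      have "1 + real m * (- ?x m) \<le> (1 + (- ?x m)) ^ m"
        using x01[OF that] by (intro Bernoulli_inequality) auto
      then show ?thesis using mx[OF that] e_def by simp
    qed
    have "(\<lambda>m. laplace_step \<theta> m z) \<longlonglongrightarrow> 0"
      by (rule tendsto_sandwich[OF _ _ tendsto_const l]; rule eventually_sequentiallyI[of 1])
        (erule laplace_step_bounds[OF assms] b[folded laplace_step_def])+
    then show ?thesis using 3 unfolding weighted_step_def by simp
  qed
qed

lemma laplace_step_expand:
  "laplace_step \<theta> m z =
    (\<Sum>k\<in>{1..m}. - ((-1) ^ k * real (m choose k)) * exp (- (real k * ln (real m) / \<theta>) * z))"
proof -
  let ?x = "exp (- (ln (real m) / \<theta>) * z)"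
  have "(1 - ?x) ^ m = (- ?x + 1) ^ m" by simp
  also have "\<dots> = (\<Sum>k\<le>m. real (m choose k) * (- ?x) ^ k)"
    unfolding binomial_ring by simp
  also have "{..m} = insert 0 {1..m}" by auto
  finally have 1: "(1 - ?x) ^ m = 1 + (\<Sum>k\<in>{1..m}. real (m choose k) * (- ?x) ^ k)"
    by simp
  have "(- ?x) ^ k = (-1) ^ k * exp (- (real k * ln (real m) / \<theta>) * z)" for k
  proof -
    have "(- ?x) ^ k = (-1) ^ k * ?x ^ k" by (rule power_minus)
    then show ?thesis by (simp add: exp_of_nat_mult[symmetric] mult.assoc)
  qed
  then have "(\<Sum>k\<in>{1..m}. real (m choose k) * (- ?x) ^ k) = 
     (\<Sum>k\<in>{1..m}. ((-1) ^ k * real (m choose k)) * exp (- (real k * ln (real m) / \<theta>) * z))"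
    by (intro sum.cong) (simp_all add: mult_ac)
  then show ?thesis unfolding laplace_step_def 1 by (simp add: sum_negf)
qed

text \<open>Integrals of \<open>laplace_step\<close> are combinations of transforms, so they agree,
  and so do their limits, from which the distribution functions follow. Finite measures are allowed
  because the bivariate case applies this to weighted and restricted laws.\<close>

lemma measure_eqI_laplace:
  fixes \<mu> \<nu> :: "real measure"
  assumes fin: "finite_measure \<mu>" "finite_measure \<nu>"
    and sets: "sets \<mu> = sets borel" "sets \<nu> = sets borel"
    and nonneg: "AE x in \<mu>. 0 \<le> x" "AE x in \<nu>. 0 \<le> x"
    and eq: "\<And>s. 0 < s \<Longrightarrow> (\<integral>\<^sup>+x. ennreal (exp (- s * x)) \<partial>\<mu>) = (\<integral>\<^sup>+x. ennreal (exp (- s * x)) \<partial>\<nu>)"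
  shows "\<mu> = \<nu>"
proof -
  have exp_int: "integrable \<xi> (\<lambda>x. exp (- s * x))"
    if "0 < s" "finite_measure \<xi>" "sets \<xi> = sets borel" "AE x in \<xi>. 0 \<le> x" for s and \<xi> :: "real measure"
  proof (rule finite_measure.integrable_const_bound[OF that(2), of _ 1])
    show "AE x in \<xi>. norm (exp (- s * x)) \<le> 1" using that(4) by eventually_elim (use that in auto)
    show "(\<lambda>x. exp (- s * x)) \<in> borel_measurable \<xi>"
      unfolding measurable_cong_sets[OF that(3) refl] by measurable
  qed
  \<comment> \<open>The index shift by 2 keeps \<open>ln m\<close> positive, so that every exponent
    in the expansion of \<open>laplace_step\<close> is strictly positive.\<close>
  have step_lim: "(\<lambda>n. \<integral>x. laplace_step \<theta> (n + 2) x \<partial>\<xi>) \<longlonglongrightarrow> (\<integral>x. weighted_step \<theta> x \<partial>\<xi>)"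
    if "0 < \<theta>" "finite_measure \<xi>" "sets \<xi> = sets borel" "AE x in \<xi>. 0 \<le> x" for \<theta> and \<xi> :: "real measure"
  proof (rule integral_dominated_convergence[where w = "\<lambda>_. 1"])
    interpret finite_measure \<xi> by fact
    show "weighted_step \<theta> \<in> borel_measurable \<xi>" "laplace_step \<theta> (n + 2) \<in> borel_measurable \<xi>" for n
      unfolding measurable_cong_sets[OF that(3) refl] weighted_step_def[abs_def] laplace_step_def[abs_def]
      by measurable
    show "AE x in \<xi>. (\<lambda>n. laplace_step \<theta> (n + 2) x) \<longlonglongrightarrow> weighted_step \<theta> x"
      using that(4) by eventually_elim (rule LIMSEQ_ignore_initial_segment, rule laplace_step_tendsto[OF that(1)])
    show "AE x in \<xi>. norm (laplace_step \<theta> (n + 2) x) \<le> 1" for n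
      using that(4) by eventually_elim (use laplace_step_bounds that in auto)
    show "integrable \<xi> (\<lambda>_. 1::real)" by simp
  qed
  have ws: "(\<integral>x. weighted_step \<theta> x \<partial>\<mu>) = (\<integral>x. weighted_step \<theta> x \<partial>\<nu>)" if "0 < \<theta>" for \<theta>
  proof -
    have "(\<integral>x. laplace_step \<theta> (n + 2) x \<partial>\<mu>) = (\<integral>x. laplace_step \<theta> (n + 2) x \<partial>\<nu>)" for n
    proof -
      have pos: "0 < real k * ln (real (n + 2)) / \<theta>" if "k \<in> {1..n+2}" for k
        using that \<open>0 < \<theta>\<close> by auto
      have e: "(\<integral>x. exp (- s * x) \<partial>\<mu>) = (\<integral>x. exp (- s * x) \<partial>\<nu>)" if "0 < s" for s
        using eq[OF that] exp_int[OF that fin(1) sets(1) nonneg(1)] exp_int[OF that fin(2) sets(2) nonneg(2)]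
        by (simp add: integral_eq_nn_integral)
      show ?thesis
        unfolding laplace_step_expand
        using exp_int[OF pos fin(1) sets(1) nonneg(1)] exp_int[OF pos fin(2) sets(2) nonneg(2)] e[OF pos]
        by (subst (1 2) Bochner_Integration.integral_sum)
           (auto intro!: sum.cong simp del: of_nat_add)
    qed
    then show ?thesis
      using LIMSEQ_unique[OF step_lim[OF that fin(1) sets(1) nonneg(1)]] step_lim[OF that fin(2) sets(2) nonneg(2)]
      by simp
  qed
  \<comment> \<open>Thresholds slightly above \<open>\<theta>\<close> converge to the closed
    half-line and bypass the boundary weight \<open>1 - 1 / e\<close>.\<close>
  have lim: "(\<lambda>n. \<integral>x. weighted_step (\<theta> + 1 / real (Suc n)) x \<partial>\<xi>) \<longlonglongrightarrow> measure \<xi> {..\<theta>}"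
    if "finite_measure \<xi>" "sets \<xi> = sets borel" for \<theta> and \<xi> :: "real measure"
  proof -
    interpret finite_measure \<xi> by fact
    have "(\<lambda>n. \<integral>x. weighted_step (\<theta> + 1 / real (Suc n)) x \<partial>\<xi>) \<longlonglongrightarrow> (\<integral>x. indicat_real {..\<theta>} x \<partial>\<xi>)"
    proof (rule integral_dominated_convergence[where w = "\<lambda>_. 1"])
      show "indicat_real {..\<theta>} \<in> borel_measurable \<xi>"
        "weighted_step (\<theta> + 1 / real (Suc n)) \<in> borel_measurable \<xi>" for n
        unfolding measurable_cong_sets[OF that(2) refl] weighted_step_def[abs_def] by measurable
      show "AE x in \<xi>. (\<lambda>n. weighted_step (\<theta> + 1 / real (Suc n)) x) \<longlonglongrightarrow> indicat_real {..\<theta>} x"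
      proof (rule AE_I2, rule tendsto_eventually)
        fix x
        show "\<forall>\<^sub>F n in sequentially. weighted_step (\<theta> + 1 / real (Suc n)) x = indicat_real {..\<theta>} x"
        proof (cases "x \<le> \<theta>")
          case True
          then have "x < \<theta> + 1 / real (Suc n)" for n
            by (smt (verit) divide_pos_pos of_nat_0_less_iff zero_less_Suc)
          then show ?thesis using True by (auto simp: weighted_step_def)
        next
          case False
          have "(\<lambda>n. \<theta> + 1 / real (Suc n)) \<longlonglongrightarrow> \<theta>" by real_asymp
          then have "\<forall>\<^sub>F n in sequentially. \<theta> + 1 / real (Suc n) < x"
            using False by (intro order_tendstoD(2)) auto
          then show ?thesis by eventually_elim (use False in \<open>auto simp: weighted_step_def\<close>)
        qed
      qed
      show "AE x in \<xi>. norm (weighted_step (\<theta> + 1 / real (Suc n)) x) \<le> 1" for n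
        by (rule AE_I2) (simp add: weighted_step_def)
    qed simp
    then show ?thesis using sets_eq_imp_space_eq[OF that(2)] that(2) by simp
  qed
  have cdf: "measure \<mu> {..\<theta>} = measure \<nu> {..\<theta>}" if "0 \<le> \<theta>" for \<theta>
  proof -
    have "0 < \<theta> + 1 / real (Suc n)" for n using that by (simp add: add_nonneg_pos)
    then have "(\<lambda>n. \<integral>x. weighted_step (\<theta> + 1 / real (Suc n)) x \<partial>\<mu>) = (\<lambda>n. \<integral>x. weighted_step (\<theta> + 1 / real (Suc n)) x \<partial>\<nu>)"
      using ws by blast
    then show ?thesis using LIMSEQ_unique[OF lim[OF fin(1) sets(1), of \<theta>]] lim[OF fin(2) sets(2), of \<theta>] by metis
  qed
  have neg: "measure \<xi> {..\<theta>} = 0" if "\<theta> < 0" "sets \<xi> = sets borel" "AE x in \<xi>. 0 \<le> x" for \<theta> and \<xi> :: "real measure"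
  proof -
    have "AE x in \<xi>. x \<notin> {..\<theta>}" using that(3) by eventually_elim (use that in auto)
    then have "emeasure \<xi> {..\<theta>} = 0"
      using AE_iff_null_sets[of "{..\<theta>}" \<xi>] that(2) by (simp add: null_setsD1)
    then show ?thesis by (simp add: measure_def)
  qed
  have cdf': "measure \<mu> {..\<theta>} = measure \<nu> {..\<theta>}" for \<theta>
    using cdf[of \<theta>] neg[OF _ sets(1) nonneg(1)] neg[OF _ sets(2) nonneg(2)] by (cases "\<theta> < 0") auto
  interpret m: finite_measure \<mu> by fact
  interpret n: finite_measure \<nu> by fact
  \<comment> \<open>The total mass is the transform at \<open>s = 0\<close>, which is not given; it
    is recovered from growing half-lines.\<close>
  have tot: "measure \<mu> UNIV = measure \<nu> UNIV"
  proof -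
    have a: "(\<lambda>n. measure \<xi> {..real n}) \<longlonglongrightarrow> measure \<xi> (\<Union>n. {..real n})" if "finite_measure \<xi>" "sets \<xi> = sets borel" for \<xi> :: "real measure"
      by (rule finite_measure.finite_Lim_measure_incseq[OF that(1)]) (simp_all add: that(2) incseq_def image_subset_iff)
    have U: "(\<Union>n. {..real n}) = UNIV"
      by (intro equalityI subset_UNIV subsetI) (simp add: real_arch_simple)
    have "(\<lambda>n. measure \<mu> {..real n}) \<longlonglongrightarrow> measure \<mu> UNIV"
      using a[OF fin(1) sets(1)] unfolding U .
    moreover have "(\<lambda>n. measure \<mu> {..real n}) \<longlonglongrightarrow> measure \<nu> UNIV"
      using a[OF fin(2) sets(2)] unfolding U cdf' .
    ultimately show ?thesis by (rule LIMSEQ_unique)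
  qed
  show ?thesis
  proof (rule measure_eqI_lessThan)
    fix x :: real
    have c: "{x<..} = UNIV - {..x}" by auto
    have s: "space \<mu> = UNIV" "space \<nu> = UNIV"
      using sets_eq_imp_space_eq[OF sets(1)] sets_eq_imp_space_eq[OF sets(2)] by auto
    have "measure \<mu> {x<..} = measure \<nu> {x<..}"
      unfolding c using m.finite_measure_compl[of "{..x}"] n.finite_measure_compl[of "{..x}"] cdf' tot sets s by simp
    then show "emeasure \<mu> {x<..} = emeasure \<nu> {x<..}"
      by (simp add: m.emeasure_eq_measure n.emeasure_eq_measure)
    show "emeasure \<mu> {x<..} < \<infinity>" by (simp add: m.emeasure_eq_measure)
  qed (use sets in auto)
qed

section \<open>Positivity of multivariate Laplace transforms\<close>

text \<open>
  \<open>laplace_pos B F\<close> says that \<open>F\<close> behaves like the Laplace transform of a positive measure on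
  \<open>[0,\<infinity>)\<^sup>B\<close>, tested against nonnegative exponential polynomials. This dual form makes products and
  limits immediate and avoids constructing the measure.
\<close>

definition laplace_pos :: "'i set \<Rightarrow> (('i \<Rightarrow> real) \<Rightarrow> real) \<Rightarrow> bool" where
  "laplace_pos B F \<longleftrightarrow> (\<forall>(J::nat) a c.
     (\<forall>m<J. \<forall>i\<in>B. 0 \<le> c m i) \<longrightarrow>
     (\<forall>z. (\<forall>i\<in>B. 0 \<le> z i) \<longrightarrow> 0 \<le> (\<Sum>m<J. a m * exp (- (\<Sum>i\<in>B. c m i * z i)))) \<longrightarrow>
     0 \<le> (\<Sum>m<J. a m * F (c m)))"

lemma laplace_posI:
  assumes "\<And>J a c. \<lbrakk>\<And>m i. m < J \<Longrightarrow> i \<in> B \<Longrightarrow> 0 \<le> c m i;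
    \<And>z. (\<And>i. i \<in> B \<Longrightarrow> 0 \<le> z i) \<Longrightarrow> 0 \<le> (\<Sum>m<J. a m * exp (- (\<Sum>i\<in>B. c m i * z i)))\<rbrakk> \<Longrightarrow>
    0 \<le> (\<Sum>m<(J::nat). a m * F (c m))"
  shows "laplace_pos B F"
  unfolding laplace_pos_def using assms by simp

lemma laplace_posD:
  assumes "laplace_pos B F" "\<And>m i. m < J \<Longrightarrow> i \<in> B \<Longrightarrow> 0 \<le> c m i"
    "\<And>z. (\<And>i. i \<in> B \<Longrightarrow> 0 \<le> z i) \<Longrightarrow> 0 \<le> (\<Sum>m<J. a m * exp (- (\<Sum>i\<in>B. c m i * z i)))"
  shows "0 \<le> (\<Sum>m<(J::nat). a m * F (c m))"
  using assms unfolding laplace_pos_def by blast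

lemma laplace_pos_cong:
  assumes "laplace_pos B F" "\<And>c. (\<And>i. i \<in> B \<Longrightarrow> 0 \<le> c i) \<Longrightarrow> F c = G c"
  shows "laplace_pos B G"
proof (rule laplace_posI)
  fix J :: nat and a :: "nat \<Rightarrow> real" and c :: "nat \<Rightarrow> 'a \<Rightarrow> real"
  assume c: "\<And>m i. m < J \<Longrightarrow> i \<in> B \<Longrightarrow> 0 \<le> c m i"
    and p: "\<And>z. (\<And>i. i \<in> B \<Longrightarrow> 0 \<le> z i) \<Longrightarrow> 0 \<le> (\<Sum>m<J. a m * exp (- (\<Sum>i\<in>B. c m i * z i)))"
  have "(\<Sum>m<J. a m * F (c m)) = (\<Sum>m<J. a m * G (c m))"
    using c assms(2) by (intro sum.cong) auto
  then show "0 \<le> (\<Sum>m<J. a m * G (c m))" using laplace_posD[OF assms(1), of J c a] c p by simp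
qed

lemma laplace_pos_const:
  assumes "0 \<le> k"
  shows "laplace_pos B (\<lambda>_. k)"
proof (rule laplace_posI)
  fix J :: nat and a :: "nat \<Rightarrow> real" and c :: "nat \<Rightarrow> 'a \<Rightarrow> real"
  assume "\<And>z. (\<And>i. i \<in> B \<Longrightarrow> 0 \<le> z i) \<Longrightarrow> 0 \<le> (\<Sum>m<J. a m * exp (- (\<Sum>i\<in>B. c m i * z i)))"
  from this[of "\<lambda>_. 0"] have "0 \<le> (\<Sum>m<J. a m)" by simp
  then show "0 \<le> (\<Sum>m<J. a m * k)" using assms by (simp flip: sum_distrib_right)
qed

lemma laplace_pos_add:
  assumes "laplace_pos B F" "laplace_pos B G"
  shows "laplace_pos B (\<lambda>c. F c + G c)"
proof (rule laplace_posI)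
  fix J :: nat and a :: "nat \<Rightarrow> real" and c :: "nat \<Rightarrow> 'a \<Rightarrow> real"
  assume c: "\<And>m i. m < J \<Longrightarrow> i \<in> B \<Longrightarrow> 0 \<le> c m i"
    and p: "\<And>z. (\<And>i. i \<in> B \<Longrightarrow> 0 \<le> z i) \<Longrightarrow> 0 \<le> (\<Sum>m<J. a m * exp (- (\<Sum>i\<in>B. c m i * z i)))"
  show "0 \<le> (\<Sum>m<J. a m * (F (c m) + G (c m)))"
    using laplace_posD[OF assms(1), of J c a] laplace_posD[OF assms(2), of J c a] c p
    by (simp add: distrib_left sum.distrib)
qed

lemma laplace_pos_sum:
  assumes "\<And>i. i \<in> I \<Longrightarrow> laplace_pos B (F i)"
  shows "laplace_pos B (\<lambda>c. \<Sum>i\<in>I. F i c)"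
  using assms by (induction I rule: infinite_finite_induct) (auto intro: laplace_pos_add laplace_pos_const)

text \<open>A nonnegative exponential polynomial evaluated at \<open>y + z\<close> is, for fixed
  \<open>y\<close>, again one in \<open>z\<close>. Hence the weights \<open>a m * F (c m)\<close>
  form a polynomial that is nonnegative at each \<open>y\<close> and can be tested against a second
  transform: this is convolution in dual form.\<close>

lemma laplace_pos_translate:
  fixes y :: "'i \<Rightarrow> real" and J :: nat
  assumes "laplace_pos B F" "finite B" "\<And>i. i \<in> B \<Longrightarrow> 0 \<le> y i"
    and c: "\<And>m i. m < J \<Longrightarrow> i \<in> B \<Longrightarrow> 0 \<le> c m i"
    and p: "\<And>z. (\<And>i. i \<in> B \<Longrightarrow> 0 \<le> z i) \<Longrightarrow> 0 \<le> (\<Sum>m<J. a m * exp (- (\<Sum>i\<in>B. c m i * z i)))"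
  shows "0 \<le> (\<Sum>m<J. a m * F (c m) * exp (- (\<Sum>i\<in>B. c m i * y i)))"
proof -
  have "0 \<le> (\<Sum>m<J. (a m * exp (- (\<Sum>i\<in>B. c m i * y i))) * F (c m))"
  proof (rule laplace_posD[OF assms(1), where c = c and a = "\<lambda>m. a m * exp (- (\<Sum>i\<in>B. c m i * y i))"])
    show "0 \<le> c m i" if "m < J" "i \<in> B" for m i using c that .
    fix z :: "'i \<Rightarrow> real" assume z: "\<And>i. i \<in> B \<Longrightarrow> 0 \<le> z i"
    have "0 \<le> (\<Sum>m<J. a m * exp (- (\<Sum>i\<in>B. c m i * (y i + z i))))"
      using z assms(3) by (intro p) auto
    also have "\<dots> = (\<Sum>m<J. a m * exp (- (\<Sum>i\<in>B. c m i * y i)) * exp (- (\<Sum>i\<in>B. c m i * z i)))"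
      by (intro sum.cong) (simp_all add: distrib_left sum.distrib exp_add exp_diff exp_minus field_simps)
    finally show "0 \<le> \<dots>" .
  qed
  then show ?thesis by (simp add: mult_ac)
qed

lemma laplace_pos_mult:
  assumes "finite B" "laplace_pos B F" "laplace_pos B G"
  shows "laplace_pos B (\<lambda>c. F c * G c)"
proof (rule laplace_posI)
  fix J :: nat and a :: "nat \<Rightarrow> real" and c :: "nat \<Rightarrow> 'a \<Rightarrow> real"
  assume c: "\<And>m i. m < J \<Longrightarrow> i \<in> B \<Longrightarrow> 0 \<le> c m i"
    and p: "\<And>z. (\<And>i. i \<in> B \<Longrightarrow> 0 \<le> z i) \<Longrightarrow> 0 \<le> (\<Sum>m<J. a m * exp (- (\<Sum>i\<in>B. c m i * z i)))"
  have "0 \<le> (\<Sum>m<J. (a m * F (c m)) * G (c m))"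
    by (rule laplace_posD[OF assms(3), where c = c and a = "\<lambda>m. a m * F (c m)"])
       (use c in \<open>auto intro!: laplace_pos_translate[OF assms(2,1) _ c p]\<close>)
  then show "0 \<le> (\<Sum>m<J. a m * (F (c m) * G (c m)))" by (simp add: mult_ac)
qed

lemma laplace_pos_power:
  assumes "finite B" "laplace_pos B F"
  shows "laplace_pos B (\<lambda>c. F c ^ n)"
  by (induction n) (use assms in \<open>auto intro: laplace_pos_const laplace_pos_mult\<close>)

lemma laplace_pos_limit:
  assumes "\<And>n. laplace_pos B (F n)"
    "\<And>c. (\<And>i. i \<in> B \<Longrightarrow> 0 \<le> c i) \<Longrightarrow> (\<lambda>n::nat. F n c) \<longlonglongrightarrow> G c"
  shows "laplace_pos B G"
proof (rule laplace_posI)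
  fix J :: nat and a :: "nat \<Rightarrow> real" and c :: "nat \<Rightarrow> 'a \<Rightarrow> real"
  assume c: "\<And>m i. m < J \<Longrightarrow> i \<in> B \<Longrightarrow> 0 \<le> c m i"
    and p: "\<And>z. (\<And>i. i \<in> B \<Longrightarrow> 0 \<le> z i) \<Longrightarrow> 0 \<le> (\<Sum>m<J. a m * exp (- (\<Sum>i\<in>B. c m i * z i)))"
  have "(\<lambda>n. \<Sum>m<J. a m * F n (c m)) \<longlonglongrightarrow> (\<Sum>m<J. a m * G (c m))"
    using c by (intro tendsto_sum tendsto_mult tendsto_const assms(2)) auto
  then show "0 \<le> (\<Sum>m<J. a m * G (c m))"
    by (rule tendsto_lowerbound) (use laplace_posD[OF assms(1), of J c a] c p in auto)
qed

text \<open>In terms of measures this is weighting by the positive function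
  \<open>exp (- d . z)\<close>.\<close>

lemma laplace_pos_shift:
  assumes "finite B" "laplace_pos B F" "\<And>i. i \<in> B \<Longrightarrow> 0 \<le> d i"
  shows "laplace_pos B (\<lambda>c. F (\<lambda>i. c i + d i))"
proof (rule laplace_posI)
  fix J :: nat and a :: "nat \<Rightarrow> real" and c :: "nat \<Rightarrow> 'a \<Rightarrow> real"
  assume c: "\<And>m i. m < J \<Longrightarrow> i \<in> B \<Longrightarrow> 0 \<le> c m i"
    and p: "\<And>z. (\<And>i. i \<in> B \<Longrightarrow> 0 \<le> z i) \<Longrightarrow> 0 \<le> (\<Sum>m<J. a m * exp (- (\<Sum>i\<in>B. c m i * z i)))"
  show "0 \<le> (\<Sum>m<J. a m * F (\<lambda>i. c m i + d i))"
  proof (rule laplace_posD[OF assms(2), where c = "\<lambda>m i. c m i + d i" and a = a])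
    show "0 \<le> c m i + d i" if "m < J" "i \<in> B" for m i using c[OF that] assms(3)[OF that(2)] by simp
  next
    fix z :: "'a \<Rightarrow> real" assume z: "\<And>i. i \<in> B \<Longrightarrow> 0 \<le> z i"
    have "(\<Sum>m<J. a m * exp (- (\<Sum>i\<in>B. (c m i + d i) * z i))) =
      (\<Sum>m<J. a m * exp (- (\<Sum>i\<in>B. c m i * z i))) * exp (- (\<Sum>i\<in>B. d i * z i))"
      unfolding sum_distrib_right
      by (intro sum.cong) (simp_all add: distrib_right sum.distrib exp_add exp_diff exp_minus field_simps)
    then show "0 \<le> (\<Sum>m<J. a m * exp (- (\<Sum>i\<in>B. (c m i + d i) * z i)))"
      using p[OF z] by simp
  qed
qed

text \<open>This is the transform of \<open>exp (- d * y) dy\<close> carried by the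
  \<open>i\<close>-th coordinate axis, so the test polynomial is integrated along that axis.\<close>

lemma laplace_pos_inverse:
  assumes "finite B" "i \<in> B" "0 < d"
  shows "laplace_pos B (\<lambda>c. 1 / (d + c i))"
proof (rule laplace_posI)
  fix J :: nat and a :: "nat \<Rightarrow> real" and c :: "nat \<Rightarrow> 'a \<Rightarrow> real"
  assume c: "\<And>m i. m < J \<Longrightarrow> i \<in> B \<Longrightarrow> 0 \<le> c m i"
    and p: "\<And>z. (\<And>i. i \<in> B \<Longrightarrow> 0 \<le> z i) \<Longrightarrow> 0 \<le> (\<Sum>m<J. a m * exp (- (\<Sum>i\<in>B. c m i * z i)))"
  have ei: "((\<lambda>y. exp (- (d + c m i) * y)) has_integral 1 / (d + c m i)) {0..}" if "m < J" for m
    using has_integral_exp_minus_to_infinity[of "d + c m i" 0] c[OF that assms(2)] assms(3) by simp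
  have I: "((\<lambda>y. \<Sum>m<J. a m * exp (- (d + c m i) * y)) has_integral (\<Sum>m<J. a m * (1 / (d + c m i)))) {0..}"
    by (intro has_integral_sum has_integral_mult_right) (use ei in auto)
  show "0 \<le> (\<Sum>m<J. a m * (1 / (d + c m i)))"
  proof (rule has_integral_nonneg[OF I])
    fix y :: real assume "y \<in> {0..}"
    then have y: "0 \<le> y" by simp
    let ?z = "\<lambda>j. if j = i then y else 0"
    have "(\<Sum>j\<in>B. c m j * ?z j) = c m i * y" for m
      using assms by (simp add: if_distrib sum.delta cong: if_cong)
    moreover have "0 \<le> (\<Sum>m<J. a m * exp (- (\<Sum>i\<in>B. c m i * ?z i)))" by (rule p) (use y in auto)
    ultimately have "0 \<le> exp (- d * y) * (\<Sum>m<J. a m * exp (- (c m i * y)))" by simp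
    also have "\<dots> = (\<Sum>m<J. a m * exp (- (d + c m i) * y))"
      unfolding sum_distrib_left
      by (intro sum.cong) (simp_all add: distrib_right exp_add exp_diff exp_minus field_simps)
    finally show "0 \<le> (\<Sum>m<J. a m * exp (- (d + c m i) * y))" .
  qed
qed

text \<open>Convolving a decreasing function with a positive measure of total mass \<open>F 0\<close> multiplies it by at most \<open>F 0\<close>.\<close>

lemma laplace_pos_antimono:
  fixes z :: "'i \<Rightarrow> real" and J :: nat
  assumes "finite B" "laplace_pos B F"
    and c: "\<And>m i. m < J \<Longrightarrow> i \<in> B \<Longrightarrow> 0 \<le> c m i" and z: "\<And>i. i \<in> B \<Longrightarrow> 0 \<le> z i"
    and anti: "\<And>y::'i \<Rightarrow> real. (\<And>i. i \<in> B \<Longrightarrow> 0 \<le> y i) \<Longrightarrow>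
      (\<Sum>m<J. a m * exp (- (\<Sum>i\<in>B. c m i * (z i + y i)))) \<le> (\<Sum>m<J. a m * exp (- (\<Sum>i\<in>B. c m i * z i)))"
  shows "(\<Sum>m<(J::nat). a m * F (c m) * exp (- (\<Sum>i\<in>B. c m i * z i)))
    \<le> F (\<lambda>_. 0) * (\<Sum>m<J. a m * exp (- (\<Sum>i\<in>B. c m i * z i)))"
proof -
  let ?e = "\<lambda>m. exp (- (\<Sum>i\<in>B. c m i * z i))"
  \<comment> \<open>The upper bound enters the test polynomial as an extra term of index
    \<open>J\<close> with exponent zero; this is where the total mass \<open>F 0\<close> comes
    from.\<close>
  let ?a = "\<lambda>m. if m < J then - (a m * ?e m) else (\<Sum>m<J. a m * ?e m)"
  let ?c = "\<lambda>m. if m < J then c m else (\<lambda>_. 0)"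
  have "0 \<le> (\<Sum>m<Suc J. ?a m * F (?c m))"
  proof (rule laplace_posD[OF assms(2), where c = ?c and a = ?a])
    show "0 \<le> ?c m i" if "m < Suc J" "i \<in> B" for m i using c that by auto
    fix y :: "'i \<Rightarrow> real" assume y: "\<And>i. i \<in> B \<Longrightarrow> 0 \<le> y i"
    have "(\<Sum>m<J. a m * exp (- (\<Sum>i\<in>B. c m i * (z i + y i)))) = (\<Sum>m<J. a m * ?e m * exp (- (\<Sum>i\<in>B. c m i * y i)))"
      by (intro sum.cong) (simp_all add: distrib_left sum.distrib exp_add exp_diff exp_minus field_simps)
    then show "0 \<le> (\<Sum>m<Suc J. ?a m * exp (- (\<Sum>i\<in>B. ?c m i * y i)))"
      using anti[of y] y by (simp add: sum_negf)
  qed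
  then show ?thesis by (simp add: sum_negf mult_ac)
qed

section \<open>Resolvents of M-matrices\<close>

definition update_at :: "('i \<Rightarrow> real) \<Rightarrow> 'i \<Rightarrow> real \<Rightarrow> 'i \<Rightarrow> real" where
  "update_at s k t = (\<lambda>i. s i + (if i = k then t else 0))"

text \<open>Adding \<open>f j\<close> to column \<open>j\<close> of \<open>U\<close> destroys
  symmetry, whereas the sign pattern of the inverse survives; the locale records just that pattern.
  Nonnegative row sums say that constants are superharmonic, and the row sum bound for resolvents
  rests on them.\<close>

locale inverse_M_matrix =
  fixes n :: nat and K A :: "nat \<Rightarrow> nat \<Rightarrow> real"
  assumes K_nonneg: "\<And>i j. i < n \<Longrightarrow> j < n \<Longrightarrow> 0 \<le> K i j"
    and A_off_diagonal: "\<And>i j. i < n \<Longrightarrow> j < n \<Longrightarrow> i \<noteq> j \<Longrightarrow> A i j \<le> 0"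
    and A_row_sum: "\<And>i. i < n \<Longrightarrow> 0 \<le> (\<Sum>j<n. A i j)"
    and AK: "\<And>i k. i < n \<Longrightarrow> k < n \<Longrightarrow> (\<Sum>j<n. A i j * K j k) = (if i = k then 1 else 0)"
begin

lemma A_row_split:
  assumes "i < n"
  shows "(\<Sum>j<n. A i j * x j) = A i i * x i - (\<Sum>j\<in>{..<n} - {i}. - A i j * x j)"
  using assms by (simp add: sum.remove[of "{..<n}" i] sum_negf)

lemma A_diag_pos:
  assumes "j < n" shows "0 < A j j"
proof -
  have "A j j * K j j = 1 + (\<Sum>l\<in>{..<n} - {j}. - A j l * K l j)"
    using AK[OF assms assms] A_row_split[OF assms, of "\<lambda>l. K l j"] by simp
  moreover have "0 \<le> (\<Sum>l\<in>{..<n} - {j}. - A j l * K l j)"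
    by (intro sum_nonneg mult_nonneg_nonneg) (use assms A_off_diagonal K_nonneg in fastforce)+
  ultimately have "0 < A j j * K j j" by linarith
  then show ?thesis using K_nonneg[OF assms assms] by (simp add: zero_less_mult_iff)
qed

text \<open>
  The Jacobi iteration increases to \<open>(A + diag s)\<^sup>-\<^sup>1\<close> and is a polynomial with nonnegative coefficients in the
  Laplace transforms \<open>1 / (A j j + s j)\<close>.
\<close>

primrec jacobi :: "nat \<Rightarrow> (nat \<Rightarrow> real) \<Rightarrow> nat \<Rightarrow> nat \<Rightarrow> real" where
  "jacobi 0 s j k = 0"
| "jacobi (Suc m) s j k =
    ((if j = k then 1 else 0) + (\<Sum>l\<in>{..<n} - {j}. - A j l * jacobi m s l k)) * (1 / (A j j + s j))"

definition resolvent :: "(nat \<Rightarrow> real) \<Rightarrow> nat \<Rightarrow> nat \<Rightarrow> real" where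
  "resolvent s j k = lim (\<lambda>m. jacobi m s j k)"

definition nonneg :: "(nat \<Rightarrow> real) \<Rightarrow> bool" where
  "nonneg s \<longleftrightarrow> (\<forall>i<n. 0 \<le> s i)"

lemma off_sum_mono:
  assumes "j < n" "\<And>l. l < n \<Longrightarrow> x l \<le> y l"
  shows "(\<Sum>l\<in>{..<n} - {j}. - A j l * x l) \<le> (\<Sum>l\<in>{..<n} - {j}. - A j l * y l)"
  by (intro sum_mono mult_left_mono) (use assms A_off_diagonal in fastforce)+

lemma off_sum_nonneg:
  assumes "j < n" "\<And>l. l < n \<Longrightarrow> 0 \<le> x l"
  shows "0 \<le> (\<Sum>l\<in>{..<n} - {j}. - A j l * x l)"
  using off_sum_mono[OF assms(1), of "\<lambda>_. 0" x] assms(2) by simp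

lemma jacobi_nonneg:
  assumes "nonneg s" "j < n" "k < n"
  shows "0 \<le> jacobi m s j k"
  using assms(2)
proof (induction m arbitrary: j)
  case (Suc m)
  have "0 \<le> 1 / (A j j + s j)" using A_diag_pos[OF Suc.prems] assms(1) Suc.prems by (simp add: nonneg_def)
  moreover have "0 \<le> (\<Sum>l\<in>{..<n} - {j}. - A j l * jacobi m s l k)"
    by (rule off_sum_nonneg[OF Suc.prems Suc.IH])
  ultimately show ?case by (simp only: jacobi.simps) (intro mult_nonneg_nonneg add_nonneg_nonneg, auto)
qed simp

lemma jacobi_mono:
  assumes "nonneg s" "j < n" "k < n"
  shows "jacobi m s j k \<le> jacobi (Suc m) s j k"
  using assms(2)
proof (induction m arbitrary: j)
  case 0
  then show ?case using jacobi_nonneg[OF assms(1) 0 assms(3), of "Suc 0"] by simp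
next
  case (Suc m)
  have "0 \<le> 1 / (A j j + s j)" using A_diag_pos[OF Suc.prems] assms(1) Suc.prems by (simp add: nonneg_def)
  moreover have "(\<Sum>l\<in>{..<n} - {j}. - A j l * jacobi m s l k) \<le> (\<Sum>l\<in>{..<n} - {j}. - A j l * jacobi (Suc m) s l k)"
    by (rule off_sum_mono[OF Suc.prems Suc.IH])
  ultimately show ?case unfolding jacobi.simps(2)[of m s j k] jacobi.simps(2)[of "Suc m" s j k]
    by (intro mult_right_mono add_left_mono)
qed

lemma K_fixpoint:
  assumes "j < n" "k < n"
  shows "K j k = ((if j = k then 1 else 0) + (\<Sum>l\<in>{..<n} - {j}. - A j l * K l k)) * (1 / A j j)"
  using AK[OF assms] A_row_split[OF assms(1), of "\<lambda>l. K l k"] A_diag_pos[OF assms(1)]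
  by (simp add: field_simps)

lemma jacobi_le_K:
  assumes "nonneg s" "j < n" "k < n"
  shows "jacobi m s j k \<le> K j k"
  using assms(2)
proof (induction m arbitrary: j)
  case 0
  then show ?case using K_nonneg assms by simp
next
  case (Suc m)
  have "1 / (A j j + s j) \<le> 1 / A j j" "0 \<le> 1 / (A j j + s j)" "0 \<le> 1 / A j j"
    using A_diag_pos[OF Suc.prems] assms(1) Suc.prems by (auto simp: nonneg_def field_simps)
  moreover have "(\<Sum>l\<in>{..<n} - {j}. - A j l * jacobi m s l k) \<le> (\<Sum>l\<in>{..<n} - {j}. - A j l * K l k)"
    by (rule off_sum_mono[OF Suc.prems Suc.IH])
  moreover have "0 \<le> (\<Sum>l\<in>{..<n} - {j}. - A j l * K l k)"
    by (rule off_sum_nonneg[OF Suc.prems K_nonneg[OF _ assms(3)]])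
  ultimately show ?case unfolding K_fixpoint[OF Suc.prems assms(3)] jacobi.simps(2)
    by (intro mult_mono add_mono) auto
qed

lemma jacobi_tendsto:
  assumes "nonneg s" "j < n" "k < n"
  shows "(\<lambda>m. jacobi m s j k) \<longlonglongrightarrow> resolvent s j k"
proof -
  have "incseq (\<lambda>m. jacobi m s j k)" by (rule incseq_SucI, rule jacobi_mono[OF assms])
  moreover have "\<forall>m. \<bar>jacobi m s j k\<bar> \<le> K j k"
    using jacobi_le_K[OF assms] jacobi_nonneg[OF assms] by simp
  then have "Bseq (\<lambda>m. jacobi m s j k)" by (intro BseqI'[of _ "K j k"]) auto
  ultimately have "convergent (\<lambda>m. jacobi m s j k)"
    by (intro Bseq_monoseq_convergent) (simp_all add: incseq_imp_monoseq)
  then show ?thesis unfolding resolvent_def by (simp add: convergent_LIMSEQ_iff)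
qed

lemma resolvent_nonneg:
  assumes "nonneg s" "j < n" "k < n" shows "0 \<le> resolvent s j k"
  by (rule tendsto_lowerbound[OF jacobi_tendsto[OF assms]]) (use jacobi_nonneg[OF assms] in auto)

lemma resolvent_le_K:
  assumes "nonneg s" "j < n" "k < n" shows "resolvent s j k \<le> K j k"
  by (rule tendsto_upperbound[OF jacobi_tendsto[OF assms]]) (use jacobi_le_K[OF assms] in auto)

lemma resolvent_eq:
  assumes "nonneg s" "j < n" "k < n"
  shows "(\<Sum>l<n. A j l * resolvent s l k) + s j * resolvent s j k = (if j = k then 1 else 0)"
proof -
  have "(\<lambda>m. jacobi (Suc m) s j k) \<longlonglongrightarrow>
    ((if j = k then 1 else 0) + (\<Sum>l\<in>{..<n} - {j}. - A j l * resolvent s l k)) * (1 / (A j j + s j))"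
    unfolding jacobi.simps
    by (intro tendsto_mult tendsto_add tendsto_const tendsto_sum jacobi_tendsto assms) auto
  moreover have "(\<lambda>m. jacobi (Suc m) s j k) \<longlonglongrightarrow> resolvent s j k"
    using jacobi_tendsto[OF assms] by (rule LIMSEQ_Suc)
  ultimately have "resolvent s j k =
    ((if j = k then 1 else 0) + (\<Sum>l\<in>{..<n} - {j}. - A j l * resolvent s l k)) * (1 / (A j j + s j))"
    using LIMSEQ_unique by blast
  moreover have "0 < A j j + s j" using A_diag_pos[OF assms(2)] assms by (simp add: nonneg_def add_pos_nonneg)
  ultimately have "(A j j + s j) * resolvent s j k = (if j = k then 1 else 0) + (\<Sum>l\<in>{..<n} - {j}. - A j l * resolvent s l k)"
    by (simp add: field_simps)
  then show ?thesis using A_row_split[OF assms(2), of "\<lambda>l. resolvent s l k"] by (simp add: algebra_simps)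
qed

lemma laplace_pos_resolvent:
  assumes "j < n" "k < n"
  shows "laplace_pos {..<n} (\<lambda>s. resolvent s j k)"
proof (rule laplace_pos_limit)
  show "laplace_pos {..<n} (\<lambda>s. jacobi m s j k)" for m
    using assms(1)
  proof (induction m arbitrary: j)
    case 0
    show ?case by (simp add: laplace_pos_const)
  next
    case (Suc m)
    have "laplace_pos {..<n} (\<lambda>s. ((if j = k then 1 else 0) + (\<Sum>l\<in>{..<n} - {j}. - A j l * jacobi m s l k)))"
      using Suc A_off_diagonal
      by (intro laplace_pos_add laplace_pos_sum laplace_pos_mult laplace_pos_const) fastforce+
    then show ?case unfolding jacobi.simps using Suc.prems A_diag_pos[OF Suc.prems]
      by (intro laplace_pos_mult laplace_pos_inverse) auto
  qed
  show "(\<lambda>m. jacobi m s j k) \<longlonglongrightarrow> resolvent s j k" if "\<And>i. i \<in> {..<n} \<Longrightarrow> 0 \<le> s i" for s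
    using that assms by (intro jacobi_tendsto) (auto simp: nonneg_def)
qed

text \<open>Since \<open>A 1 \<ge> 0\<close>, one has \<open>(A + s) 1 \<ge> s\<close>, and the
  nonnegative resolvent turns this into \<open>1 \<ge> R s\<close>. The induction carries out this
  argument for the Jacobi iterates.\<close>

lemma resolvent_row_sum:
  assumes "nonneg s" "j < n"
  shows "(\<Sum>k<n. resolvent s j k * s k) \<le> 1"
proof (rule tendsto_upperbound)
  show "(\<lambda>m. \<Sum>k<n. jacobi m s j k * s k) \<longlonglongrightarrow> (\<Sum>k<n. resolvent s j k * s k)"
    by (intro tendsto_sum tendsto_mult tendsto_const jacobi_tendsto assms) auto
  have "(\<Sum>k<n. jacobi m s j k * s k) \<le> 1" for m
    using assms(2)
  proof (induction m arbitrary: j)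
    case (Suc m)
    have d: "0 < A j j + s j" using A_diag_pos[OF Suc.prems] assms(1) Suc.prems by (simp add: nonneg_def add_pos_nonneg)
    have "(\<Sum>k<n. jacobi (Suc m) s j k * s k) =
      (\<Sum>k<n. ((if j = k then s k else 0) + (\<Sum>l\<in>{..<n} - {j}. - A j l * (jacobi m s l k * s k))) * (1 / (A j j + s j)))"
      by (intro sum.cong refl) (simp add: sum_distrib_left sum_distrib_right algebra_simps)
    also have "\<dots> = (s j + (\<Sum>k<n. \<Sum>l\<in>{..<n} - {j}. - A j l * (jacobi m s l k * s k))) * (1 / (A j j + s j))"
      using Suc.prems unfolding sum_distrib_right[symmetric] sum.distrib by simp
    also have "\<dots> \<le> (s j + A j j) * (1 / (A j j + s j))"
    proof (rule mult_right_mono)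
      have "(\<Sum>k<n. \<Sum>l\<in>{..<n} - {j}. - A j l * (jacobi m s l k * s k)) =
        (\<Sum>l\<in>{..<n} - {j}. - A j l * (\<Sum>k<n. jacobi m s l k * s k))"
        by (subst sum.swap) (simp add: sum_distrib_left)
      also have "\<dots> \<le> (\<Sum>l\<in>{..<n} - {j}. - A j l * 1)"
        by (rule off_sum_mono[OF Suc.prems Suc.IH])
      also have "\<dots> \<le> A j j" using A_row_sum[OF Suc.prems] A_row_split[OF Suc.prems, of "\<lambda>_. 1"] by simp
      finally show "s j + (\<Sum>k<n. \<Sum>l\<in>{..<n} - {j}. - A j l * (jacobi m s l k * s k)) \<le> s j + A j j" by simp
    qed (use d in simp)
    also have "\<dots> = 1" using d by (simp add: field_simps)
    finally show ?case .
  qed simp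
  then show "\<forall>\<^sub>F m in sequentially. (\<Sum>k<n. jacobi m s j k * s k) \<le> 1" by simp
qed simp

section \<open>Resolvent identities and rank one updates\<close>

lemma inverse_sums:
  fixes X Y :: "nat \<Rightarrow> nat \<Rightarrow> real"
  assumes "\<And>i k. i < n \<Longrightarrow> k < n \<Longrightarrow> (\<Sum>j<n. X i j * Y j k) = (if i = k then 1 else 0)"
    and "i < n" "k < n"
  shows "(\<Sum>j<n. Y i j * X j k) = (if i = k then 1 else 0)"
proof -
  let ?X = "Matrix.mat n n (\<lambda>(i, j). X i j)" and ?Y = "Matrix.mat n n (\<lambda>(i, j). Y i j)"
  have "?X * ?Y = 1\<^sub>m n"
    by (rule eq_matI) (auto simp: scalar_prod_def atLeast0LessThan assms(1))
  then have "?Y * ?X = 1\<^sub>m n" by (rule mat_mult_left_right_inverse[rotated 2]) simp_all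
  then have "(?Y * ?X) $$ (i, k) = (1\<^sub>m n :: real mat) $$ (i, k)" by simp
  then show ?thesis using assms(2,3) by (simp add: scalar_prod_def atLeast0LessThan)
qed

lemma sum_diag:
  assumes "i < n"
  shows "(\<Sum>j<n. (A i j + (if i = j then c else 0)) * x j) = (\<Sum>j<n. A i j * x j) + c * x i"
    "(\<Sum>j<n. x j * (A j i + (if j = i then s j else 0))) = (\<Sum>j<n. x j * A j i) + x i * s i"
  using assms by (simp_all add: algebra_simps sum.distrib if_distrib[of "\<lambda>y. y * _"] if_distrib[of "\<lambda>y. _ * y"] cong: if_cong)

lemma resolvent_eq_left:
  assumes "nonneg s" "i < n" "k < n"
  shows "(\<Sum>j<n. resolvent s i j * A j k) + resolvent s i k * s k = (if i = k then 1 else 0)"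
proof -
  have "(\<Sum>j<n. (A i j + (if i = j then s i else 0)) * resolvent s j k) = (if i = k then 1 else 0)"
    if "i < n" "k < n" for i k
    unfolding sum_diag[OF that(1)] by (rule resolvent_eq[OF assms(1) that])
  from inverse_sums[OF this assms(2,3)] show ?thesis
    unfolding sum_diag[OF assms(3)] .
qed

text \<open>Associativity of \<open>R (A + s) X\<close>, read from both ends.\<close>

lemma resolvent_unique:
  assumes "nonneg s" "\<And>j k. j < n \<Longrightarrow> k < n \<Longrightarrow> (\<Sum>l<n. A j l * X l k) + s j * X j k = (if j = k then 1 else 0)"
    and "i < n" "k < n"
  shows "X i k = resolvent s i k"
proof -
  have "resolvent s i k = (\<Sum>j<n. resolvent s i j * (if j = k then 1 else 0))"
    using assms(4) by (simp add: if_distrib[of "\<lambda>y. _ * y"] cong: if_cong)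
  also have "\<dots> = (\<Sum>j<n. resolvent s i j * ((\<Sum>l<n. A j l * X l k) + s j * X j k))"
    using assms(2)[OF _ assms(4)] by (intro sum.cong) auto
  also have "\<dots> = (\<Sum>j<n. \<Sum>l<n. resolvent s i j * A j l * X l k) + (\<Sum>j<n. resolvent s i j * s j * X j k)"
    by (simp add: algebra_simps sum.distrib sum_distrib_left)
  also have "(\<Sum>j<n. \<Sum>l<n. resolvent s i j * A j l * X l k) = (\<Sum>l<n. (\<Sum>j<n. resolvent s i j * A j l) * X l k)"
    by (subst sum.swap) (simp add: sum_distrib_right)
  also have "\<dots> + (\<Sum>j<n. resolvent s i j * s j * X j k) =
    (\<Sum>l<n. ((\<Sum>j<n. resolvent s i j * A j l) + resolvent s i l * s l) * X l k)"
    by (simp add: algebra_simps sum.distrib)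
  also have "\<dots> = (\<Sum>l<n. (if i = l then 1 else 0) * X l k)"
    using resolvent_eq_left[OF assms(1,3)] by (intro sum.cong) auto
  also have "\<dots> = X i k" using assms(3) by (simp add: if_distrib[of "\<lambda>y. y * _"] cong: if_cong)
  finally show ?thesis ..
qed

lemma KA:
  assumes "i < n" "k < n"
  shows "(\<Sum>j<n. K i j * A j k) = (if i = k then 1 else 0)"
  using inverse_sums[OF AK assms] .

text \<open>Expansion of \<open>K (A + s) R\<close> with \<open>K A = 1\<close> and
  \<open>(A + s) R = 1\<close>.\<close>

lemma resolvent_identity_left:
  assumes "nonneg s" "i < n" "k < n"
  shows "K i k = resolvent s i k + (\<Sum>j<n. K i j * s j * resolvent s j k)"
proof -
  have "K i k = (\<Sum>j<n. K i j * (if j = k then 1 else 0))"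
    using assms(3) by (simp add: if_distrib[of "\<lambda>y. _ * y"] cong: if_cong)
  also have "\<dots> = (\<Sum>j<n. K i j * ((\<Sum>l<n. A j l * resolvent s l k) + s j * resolvent s j k))"
    using resolvent_eq[OF assms(1) _ assms(3)] by (intro sum.cong) auto
  also have "\<dots> = (\<Sum>j<n. \<Sum>l<n. K i j * A j l * resolvent s l k) + (\<Sum>j<n. K i j * s j * resolvent s j k)"
    by (simp add: algebra_simps sum.distrib sum_distrib_left)
  also have "(\<Sum>j<n. \<Sum>l<n. K i j * A j l * resolvent s l k) = (\<Sum>l<n. (\<Sum>j<n. K i j * A j l) * resolvent s l k)"
    by (subst sum.swap) (simp add: sum_distrib_right)
  also have "\<dots> = (\<Sum>l<n. (if i = l then 1 else 0) * resolvent s l k)"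
    using KA[OF assms(2)] by (intro sum.cong) auto
  also have "\<dots> = resolvent s i k" using assms by (simp add: if_distrib[of "\<lambda>y. y * _"] cong: if_cong)
  finally show ?thesis .
qed

lemma resolvent_identity_right:
  assumes "nonneg s" "i < n" "k < n"
  shows "K i k = resolvent s i k + (\<Sum>j<n. resolvent s i j * s j * K j k)"
proof -
  have "K i k = (\<Sum>j<n. (if i = j then 1 else 0) * K j k)"
    using assms by (simp add: if_distrib[of "\<lambda>y. y * _"] cong: if_cong)
  also have "\<dots> = (\<Sum>j<n. ((\<Sum>l<n. resolvent s i l * A l j) + resolvent s i j * s j) * K j k)"
    using resolvent_eq_left[OF assms(1,2)] by (intro sum.cong) auto
  also have "\<dots> = (\<Sum>j<n. \<Sum>l<n. resolvent s i l * (A l j * K j k)) + (\<Sum>j<n. resolvent s i j * s j * K j k)"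
    by (simp add: algebra_simps sum.distrib sum_distrib_left)
  also have "(\<Sum>j<n. \<Sum>l<n. resolvent s i l * (A l j * K j k)) = (\<Sum>l<n. resolvent s i l * (\<Sum>j<n. A l j * K j k))"
    by (subst sum.swap) (simp add: sum_distrib_left)
  also have "\<dots> = (\<Sum>l<n. resolvent s i l * (if l = k then 1 else 0))"
    using AK[OF _ assms(3)] by (intro sum.cong) auto
  also have "\<dots> = resolvent s i k" using assms by (simp add: if_distrib[of "\<lambda>y. _ * y"] cong: if_cong)
  finally show ?thesis .
qed

lemma nonneg_update_at: "nonneg s \<Longrightarrow> 0 \<le> t \<Longrightarrow> nonneg (update_at s k t)"
  by (simp add: nonneg_def update_at_def)

text \<open>The Sherman-Morrison formula for adding \<open>t\<close> to one diagonal entry of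
  \<open>A + diag s\<close>. The candidate is checked against the linear system, whose solution is
  unique.\<close>

lemma resolvent_update:
  assumes "nonneg s" "0 \<le> t" "i < n" "j < n" "k < n"
  shows "resolvent (update_at s i t) j k =
    resolvent s j k - t * resolvent s j i * resolvent s i k / (1 + t * resolvent s i i)"
proof -
  define X where "X j k = resolvent s j k - t * resolvent s j i * resolvent s i k / (1 + t * resolvent s i i)" for j k
  have pos: "0 < 1 + t * resolvent s i i"
    using resolvent_nonneg[OF assms(1,3,3)] assms(2) by (simp add: add_pos_nonneg)
  have "(\<Sum>l<n. A j l * X l k) + update_at s i t j * X j k = (if j = k then 1 else 0)" if jk: "j < n" "k < n" for j k
  proof -
    define \<beta> where "\<beta> = t * resolvent s i k / (1 + t * resolvent s i i)"
    have X: "X l k = resolvent s l k - \<beta> * resolvent s l i" for l by (simp add: X_def \<beta>_def)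
    have "(\<Sum>l<n. A j l * X l k) + s j * X j k =
       ((\<Sum>l<n. A j l * resolvent s l k) + s j * resolvent s j k) -
       \<beta> * ((\<Sum>l<n. A j l * resolvent s l i) + s j * resolvent s j i)"
      unfolding X by (simp add: algebra_simps sum_subtractf sum_distrib_left)
    also have "\<dots> = (if j = k then 1 else 0) - \<beta> * (if j = i then 1 else 0)"
      using resolvent_eq[OF assms(1) jk] resolvent_eq[OF assms(1) jk(1) assms(3)] by simp
    finally have 1: "(\<Sum>l<n. A j l * X l k) + s j * X j k = (if j = k then 1 else 0) - \<beta> * (if j = i then 1 else 0)" .
    \<comment> \<open>With this value the additional diagonal term in row \<open>i\<close> cancels
      the defect \<open>\<beta>\<close> left by the unperturbed system.\<close>
    have "t * X i k = \<beta>" unfolding X \<beta>_def using pos by (simp add: field_simps)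
    then show ?thesis using 1 by (auto simp: update_at_def algebra_simps)
  qed
  from resolvent_unique[OF nonneg_update_at[OF assms(1,2)] this assms(4,5)]
  show ?thesis unfolding X_def by simp
qed

section \<open>The determinant in the permanental Laplace transform\<close>

definition laplace_det :: "(nat \<Rightarrow> real) \<Rightarrow> real" where
  "laplace_det s = Determinant.det (1\<^sub>m n + Matrix.mat n n (\<lambda>(p, q). K p q)
                                * Matrix.mat n n (\<lambda>(p, q). if p = q then s p else 0))"

lemma laplace_det_alt:
  "laplace_det s = Determinant.det (Matrix.mat n n (\<lambda>(i, j). (if i = j then 1 else 0) + K i j * s j))"
  unfolding laplace_det_def
  by (rule arg_cong[of _ _ Determinant.det], rule eq_matI)
    (auto simp: scalar_prod_def if_distrib[of "\<lambda>y. _ * y"] sum.delta cong: if_cong)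

lemma laplace_det_cong:
  assumes "\<And>i. i < n \<Longrightarrow> s i = s' i"
  shows "laplace_det s = laplace_det s'"
  unfolding laplace_det_alt using assms
  by (intro arg_cong[of _ _ Determinant.det] eq_matI) auto

lemma laplace_det_0: "laplace_det (\<lambda>_. 0) = 1"
proof -
  have "Matrix.mat n n (\<lambda>(i, j). (if i = j then 1 else 0) + K i j * 0) = (1\<^sub>m n :: real mat)"
    by (rule eq_matI) auto
  then show ?thesis unfolding laplace_det_alt by simp
qed

text \<open>Changing \<open>s k\<close> alters only column \<open>k\<close> of
  \<open>1 + K diag s\<close>. By \<open>K = R + K diag s R\<close> the new column is the old matrix
  applied to \<open>e_k + t R e_k\<close>, so Cramer's rule gives the ratio of determinants as the
  \<open>k\<close>-th entry of that vector.\<close>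

lemma laplace_det_update:
  assumes "nonneg s" "k < n"
  shows "laplace_det (update_at s k t) = laplace_det s * (1 + t * resolvent s k k)"
proof -
  let ?M = "\<lambda>s. Matrix.mat n n (\<lambda>(i, j). (if i = j then 1 else 0) + K i j * s j)"
  let ?x = "Matrix.vec n (\<lambda>i. (if i = k then 1 else 0) + t * resolvent s i k)"
  have "replace_col (?M s) (?M s *\<^sub>v ?x) k = ?M (update_at s k t)"
  proof (rule eq_matI)
    fix i j assume "i < dim_row (?M (update_at s k t))" "j < dim_col (?M (update_at s k t))"
    then have ij: "i < n" "j < n" by auto
    have "(\<Sum>l<n. ((if i = l then 1 else 0) + K i l * s l) * ((if l = k then 1 else 0) + t * resolvent s l k)) =
      (if i = k then 1 else 0) + K i k * s k + t * (resolvent s i k + (\<Sum>l<n. K i l * s l * resolvent s l k))"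
      using ij assms(2)
      by (simp add: algebra_simps sum.distrib sum_distrib_left if_distrib[of "\<lambda>y. y * _"] if_distrib[of "\<lambda>y. _ * y"] cong: if_cong)
    also have "\<dots> = (if i = k then 1 else 0) + K i k * (s k + t)"
      using resolvent_identity_left[OF assms(1) ij(1) assms(2)] by (simp add: algebra_simps)
    finally show "replace_col (?M s) (?M s *\<^sub>v ?x) k $$ (i, j) = ?M (update_at s k t) $$ (i, j)"
      using ij by (auto simp: replace_col_def update_at_def scalar_prod_def atLeast0LessThan)
  qed (auto simp: replace_col_def)
  moreover have "Determinant.det (replace_col (?M s) (?M s *\<^sub>v ?x) k) = vec_index ?x k * Determinant.det (?M s)"
    by (rule cramer_lemma_mat) (use assms in auto)
  ultimately show ?thesis unfolding laplace_det_alt using assms(2) by (simp add: mult.commute)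
qed

text \<open>Raises the coordinates from 0 to their values one at a time, which reduces facts about
  \<open>laplace_det\<close> to rank one updates. Beyond index \<open>n\<close> the argument stays
  0, whence the truncated conclusion; \<open>laplace_det_cong\<close> removes the
  truncation.\<close>

lemma coordinate_induct [consumes 1, case_names zero step]:
  assumes "nonneg s"
    and "P (\<lambda>_. 0)"
    and "\<And>s' k. k < n \<Longrightarrow> nonneg s' \<Longrightarrow> P s' \<Longrightarrow> P (update_at s' k (s k))"
  shows "P (\<lambda>i. if i < n then s i else 0)"
proof -
  have "m \<le> n \<Longrightarrow> P (\<lambda>i. if i < m then s i else 0)" for m
  proof (induction m)
    case (Suc m)
    have "update_at (\<lambda>i. if i < m then s i else 0) m (s m) = (\<lambda>i. if i < Suc m then s i else 0)"
      by (auto simp: update_at_def fun_eq_iff)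
    then show ?case using assms(3)[of m "\<lambda>i. if i < m then s i else 0"] Suc assms(1) by (simp add: nonneg_def)
  qed (simp add: assms(2))
  then show ?thesis by simp
qed

lemma laplace_det_ge_1:
  assumes "nonneg s"
  shows "1 \<le> laplace_det s"
proof -
  have "1 \<le> laplace_det (\<lambda>i. if i < n then s i else 0)"
    using assms
  proof (induction rule: coordinate_induct)
    case zero
    then show ?case by (simp add: laplace_det_0)
  next
    case (step s' k)
    then have "1 * 1 \<le> laplace_det s' * (1 + s k * resolvent s' k k)"
      using resolvent_nonneg[of s' k k] assms by (intro mult_mono) (auto simp: nonneg_def)
    then show ?case using laplace_det_update step by simp
  qed
  then show ?thesis using laplace_det_cong[of "\<lambda>i. if i < n then s i else 0" s] by simp
qed

text \<open>The ratio is \<open>(1 + t R)\<^sup>\<alpha> = (1 - t R')\<^sup>-\<^sup>\<alpha>\<close>, where \<open>R'\<close> is the updated resolvent, and the latter is a power series with positive coefficients.\<close>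

lemma laplace_pos_det_ratio_step:
  assumes "k < n" "0 \<le> t" "0 < \<alpha>"
  shows "laplace_pos {..<n} (\<lambda>s. (laplace_det (update_at s k t) / laplace_det s) powr \<alpha>)"
proof (rule laplace_pos_limit)
  let ?R = "\<lambda>s. resolvent (update_at s k t) k k"
  show "laplace_pos {..<n} (\<lambda>s. \<Sum>m<N. (pochhammer \<alpha> m / fact m * t ^ m) * ?R s ^ m)" for N
  proof (rule laplace_pos_sum, rule laplace_pos_mult[OF _ laplace_pos_const laplace_pos_power])
    show "0 \<le> pochhammer \<alpha> m / fact m * t ^ m" for m
      using assms by (simp add: pochhammer_nonneg)
    show "laplace_pos {..<n} ?R"
      unfolding update_at_def by (rule laplace_pos_shift) (use assms laplace_pos_resolvent in auto)
  qed auto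
  fix s :: "nat \<Rightarrow> real" assume "\<And>i. i \<in> {..<n} \<Longrightarrow> 0 \<le> s i"
  then have s: "nonneg s" by (simp add: nonneg_def)
  have pos: "0 < 1 + t * resolvent s k k"
    using resolvent_nonneg[OF s assms(1,1)] assms(2) by (simp add: add_pos_nonneg)
  have R: "t * ?R s = t * resolvent s k k / (1 + t * resolvent s k k)"
    unfolding resolvent_update[OF s assms(2,1,1,1)] using pos by (simp add: field_simps)
  have Rb: "0 \<le> t * ?R s" "t * ?R s < 1" "1 - t * ?R s = 1 / (1 + t * resolvent s k k)"
    unfolding R using pos resolvent_nonneg[OF s assms(1,1)] assms(2) by (auto simp: field_simps)
  have "(\<lambda>m. ((- \<alpha>) gchoose m) * (- (t * ?R s)) ^ m) sums (1 + (- (t * ?R s))) powr (- \<alpha>)"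
    by (rule gen_binomial_real) (use Rb in auto)
  \<comment> \<open>The alternating signs of the binomial coefficient and of the argument cancel, so
    all coefficients are nonnegative.\<close>
  moreover have "((- \<alpha>) gchoose m) * (- (t * ?R s)) ^ m = (pochhammer \<alpha> m / fact m * t ^ m) * ?R s ^ m" for m
    by (simp add: gbinomial_pochhammer power_minus[of "t * ?R s"] power_mult_distrib flip: mult.assoc power_add)
  moreover have "(1 + (- (t * ?R s))) powr (- \<alpha>) = (laplace_det (update_at s k t) / laplace_det s) powr \<alpha>"
    using Rb(3) pos laplace_det_update[OF s assms(1), of t] laplace_det_ge_1[OF s]
    by (simp add: powr_minus powr_divide)
  ultimately show "(\<lambda>N. \<Sum>m<N. (pochhammer \<alpha> m / fact m * t ^ m) * ?R s ^ m) \<longlonglongrightarrow>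
      (laplace_det (update_at s k t) / laplace_det s) powr \<alpha>"
    unfolding sums_def by simp
qed

text \<open>The ratio telescopes over the coordinates: each factor is a one-coordinate ratio at an
  argument shifted by the coordinates raised before, and shifts and products preserve positivity. Up
  to normalisation it is the transform of the measure whose convolution with the tilted law gives
  back the original law.\<close>

lemma laplace_pos_det_ratio:
  assumes "nonneg \<tau>" "0 < \<alpha>"
  shows "laplace_pos {..<n} (\<lambda>s. (laplace_det (\<lambda>i. s i + \<tau> i) / laplace_det s) powr \<alpha>)"
proof -
  have "laplace_pos {..<n} (\<lambda>s. (laplace_det (\<lambda>i. s i + (if i < n then \<tau> i else 0)) / laplace_det s) powr \<alpha>)"
    using assms(1)
  proof (induction rule: coordinate_induct)
    case zero
    show ?case
    proof (rule laplace_pos_cong[OF laplace_pos_const[of 1]])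
      fix s :: "nat \<Rightarrow> real" assume "\<And>i. i \<in> {..<n} \<Longrightarrow> 0 \<le> s i"
      then have "1 \<le> laplace_det s" by (intro laplace_det_ge_1) (simp add: nonneg_def)
      then show "1 = (laplace_det (\<lambda>i. s i + 0) / laplace_det s) powr \<alpha>" by simp
    qed simp
  next
    case (step \<sigma> k)
    let ?u = "\<lambda>s i. s i + \<sigma> i"
    have "laplace_pos {..<n} (\<lambda>s. (laplace_det (update_at (?u s) k (\<tau> k)) / laplace_det (?u s)) powr \<alpha>)"
      using step assms by (intro laplace_pos_shift[OF _ laplace_pos_det_ratio_step]) (auto simp: nonneg_def)
    from laplace_pos_mult[OF _ this step(3)] show ?case
    proof (rule laplace_pos_cong)
      fix s :: "nat \<Rightarrow> real" assume "\<And>i. i \<in> {..<n} \<Longrightarrow> 0 \<le> s i"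
      then have "nonneg s" "nonneg (?u s)" using step by (auto simp: nonneg_def)
      then have D: "1 \<le> laplace_det s" "1 \<le> laplace_det (?u s)" "1 \<le> laplace_det (update_at (?u s) k (\<tau> k))"
        using nonneg_update_at[of "?u s" "\<tau> k" k] assms step laplace_det_ge_1 by (auto simp: nonneg_def)
      moreover have "update_at (?u s) k (\<tau> k) = (\<lambda>i. s i + update_at \<sigma> k (\<tau> k) i)"
        by (auto simp: update_at_def)
      ultimately show "(laplace_det (update_at (?u s) k (\<tau> k)) / laplace_det (?u s)) powr \<alpha> * (laplace_det (?u s) / laplace_det s) powr \<alpha> =
         (laplace_det (\<lambda>i. s i + update_at \<sigma> k (\<tau> k) i) / laplace_det s) powr \<alpha>"
        by (subst powr_mult[symmetric]) auto
    qed simp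
  qed
  moreover have "laplace_det (\<lambda>i. s i + (if i < n then \<tau> i else 0)) = laplace_det (\<lambda>i. s i + \<tau> i)" for s
    by (rule laplace_det_cong) simp
  ultimately show ?thesis by simp
qed

end

section \<open>Stochastic comparison with the tilted law\<close>

text \<open>Prepares the approximation of the indicator of a box. The exponents are strictly
  positive in every coordinate because the binomial sums start at 1 and \<open>ln m > 0\<close>;
  joint transforms are available only for such arguments.\<close>

lemma prod_laplace_step_expand:
  fixes n m :: nat
  assumes "\<And>i. i < n \<Longrightarrow> 0 < \<theta> i" "2 \<le> m"
  shows "\<exists>J a c. (\<forall>k<J. \<forall>i<n. 0 < c k i) \<and>
    (\<forall>z. (\<Prod>i<n. laplace_step (\<theta> i) m (z i)) = (\<Sum>k<(J::nat). a k * exp (- (\<Sum>i<n. c k i * z i))))"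
proof -
  let ?S = "PiE {..<n} (\<lambda>_. {1..m})"
  let ?a = "\<lambda>g. \<Prod>i<n. - ((-1) ^ g i * real (m choose g i))"
  let ?c = "\<lambda>g i. real (g i) * ln (real m) / \<theta> i"
  have fin: "finite ?S" by (intro finite_PiE) auto
  have 1: "(\<Prod>i<n. laplace_step (\<theta> i) m (z i)) = (\<Sum>g\<in>?S. ?a g * exp (- (\<Sum>i<n. ?c g i * z i)))" for z
  proof -
    have e: "exp (- (\<Sum>i<n. ?c g i * z i)) = (\<Prod>i<n. exp (- (real (g i) * ln (real m) / \<theta> i) * z i))" for g
      by (subst exp_sum[symmetric], simp, simp only: sum_negf[symmetric] mult_minus_left)
    have "(\<Prod>i<n. laplace_step (\<theta> i) m (z i)) = (\<Prod>i<n. \<Sum>k\<in>{1..m}.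
        - ((-1) ^ k * real (m choose k)) * exp (- (real k * ln (real m) / \<theta> i) * z i))"
      by (simp only: laplace_step_expand)
    also have "\<dots> = (\<Sum>g\<in>?S. \<Prod>i<n.
        - ((-1) ^ g i * real (m choose g i)) * exp (- (real (g i) * ln (real m) / \<theta> i) * z i))"
      by (rule prod_sum_PiE) simp_all
    also have "\<dots> = (\<Sum>g\<in>?S. ?a g * exp (- (\<Sum>i<n. ?c g i * z i)))"
      unfolding e prod.distrib ..
    finally show ?thesis .
  qed
  obtain h where h: "bij_betw h {..<card ?S} ?S"
    using ex_bij_betw_nat_finite[OF fin] by (auto simp: atLeast0LessThan)
  have "0 < ?c (h k) i" if "k < card ?S" "i < n" for k i
  proof -
    have "h k \<in> ?S" using h that by (auto simp: bij_betw_def)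
    then have "1 \<le> h k i" using that by (auto simp: PiE_def Pi_def)
    then show ?thesis using assms that by auto
  qed
  moreover have "(\<Prod>i<n. laplace_step (\<theta> i) m (z i)) =
      (\<Sum>k<card ?S. ?a (h k) * exp (- (\<Sum>i<n. ?c (h k) i * z i)))" for z
    unfolding 1 by (rule sum.reindex_bij_betw[OF h, symmetric])
  ultimately show ?thesis
    by (intro exI[of _ "card ?S"] exI[of _ "\<lambda>k. ?a (h k)"] exI[of _ "\<lambda>k. ?c (h k)"]) blast
qed

context inverse_M_matrix
begin

text \<open>
  The law of \<open>Z\<close> is the convolution of the law tilted by \<open>exp (- \<tau> \<cdot> Z)\<close> with a positive measure, whence
  tilting makes \<open>Z\<close> stochastically smaller.
\<close>

lemma tilted_integral_le:
  fixes Q :: "'b measure" and Z :: "nat \<Rightarrow> 'b \<Rightarrow> real"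
  assumes "prob_space Q" "0 < \<alpha>" "nonneg \<tau>"
    and Z: "\<And>i. i < n \<Longrightarrow> Z i \<in> borel_measurable Q" "\<And>i \<omega>. i < n \<Longrightarrow> \<omega> \<in> space Q \<Longrightarrow> 0 \<le> Z i \<omega>"
    and LT: "\<And>s. (\<And>i. i < n \<Longrightarrow> 0 < s i) \<Longrightarrow> (\<integral>\<omega>. exp (- (\<Sum>i<n. s i * Z i \<omega>)) \<partial>Q) = laplace_det s powr (- \<alpha>)"
    and c: "\<And>k i. k < J \<Longrightarrow> i < n \<Longrightarrow> 0 < c k i"
    and anti: "\<And>z y. (\<And>i. i < n \<Longrightarrow> 0 \<le> z i) \<Longrightarrow> (\<And>i. i < n \<Longrightarrow> 0 \<le> y i) \<Longrightarrow>
      (\<Sum>k<J. a k * exp (- (\<Sum>i<n. c k i * (z i + y i)))) \<le> (\<Sum>k<J. a k * exp (- (\<Sum>i<n. c k i * z i)))"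
  defines "\<phi> \<equiv> (\<lambda>z. \<Sum>k<(J::nat). a k * exp (- (\<Sum>i<n. c k i * z i)))"
  shows "(\<integral>\<omega>. \<phi> (\<lambda>i. Z i \<omega>) \<partial>Q) \<le>
    laplace_det \<tau> powr \<alpha> * (\<integral>\<omega>. exp (- (\<Sum>i<n. \<tau> i * Z i \<omega>)) * \<phi> (\<lambda>i. Z i \<omega>) \<partial>Q)"
proof -
  interpret prob_space Q by fact
  have [measurable]: "i < n \<Longrightarrow> Z i \<in> borel_measurable Q" for i by (rule Z)
  define F where "F = (\<lambda>s. (laplace_det (\<lambda>i. s i + \<tau> i) / laplace_det s) powr \<alpha>)"
  have F: "laplace_pos {..<n} F" unfolding F_def by (rule laplace_pos_det_ratio) fact+
  have int: "integrable Q (\<lambda>\<omega>. exp (- (\<Sum>i<n. s i * Z i \<omega>)))" if "nonneg s" for s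
  proof (rule integrable_const_bound[of _ 1])
    show "AE \<omega> in Q. norm (exp (- (\<Sum>i<n. s i * Z i \<omega>))) \<le> 1"
      using Z(2) that by (intro AE_I2) (auto simp: nonneg_def intro!: sum_nonneg)
  qed measurable
  have exp_plus: "exp (- (\<Sum>i<n. (s i + \<tau> i) * Z i \<omega>)) = exp (- (\<Sum>i<n. \<tau> i * Z i \<omega>)) * exp (- (\<Sum>i<n. s i * Z i \<omega>))" for s \<omega>
    by (simp add: distrib_right sum.distrib exp_diff exp_minus divide_inverse)
  have cn: "nonneg (c k)" "nonneg (\<lambda>i. c k i + \<tau> i)" "\<And>i. i < n \<Longrightarrow> 0 < c k i + \<tau> i" if "k < J" for k
    using c[OF that] assms(3) by (auto simp: nonneg_def less_imp_le intro: add_pos_nonneg)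
  have "(\<integral>\<omega>. \<phi> (\<lambda>i. Z i \<omega>) \<partial>Q) = (\<Sum>k<J. a k * laplace_det (c k) powr (- \<alpha>))"
    unfolding \<phi>_def using int[OF cn(1)] LT[OF c]
    by (subst Bochner_Integration.integral_sum) auto
  \<comment> \<open>This is \<open>laplace_det s powr (- \<alpha>) = F s * laplace_det (s + \<tau>)
    powr (- \<alpha>)\<close>, whose second factor is again an expectation over
    \<open>Q\<close>.\<close>
  also have "\<dots> = (\<Sum>k<J. a k * (F (c k) * (\<integral>\<omega>. exp (- (\<Sum>i<n. (c k i + \<tau> i) * Z i \<omega>)) \<partial>Q)))"
  proof (rule sum.cong)
    fix k assume "k \<in> {..<J}"
    then have k: "k < J" by simp
    have D: "1 \<le> laplace_det (c k)" "1 \<le> laplace_det (\<lambda>i. c k i + \<tau> i)"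
      using cn[OF k] laplace_det_ge_1 by auto
    then have "0 < laplace_det (\<lambda>i. c k i + \<tau> i) powr \<alpha>" by simp
    with D show "a k * laplace_det (c k) powr (- \<alpha>) = a k * (F (c k) * (\<integral>\<omega>. exp (- (\<Sum>i<n. (c k i + \<tau> i) * Z i \<omega>)) \<partial>Q))"
      using LT[of "\<lambda>i. c k i + \<tau> i", OF cn(3)] k unfolding F_def by (simp add: powr_divide powr_minus field_simps)
  qed simp
  also have "\<dots> = (\<integral>\<omega>. exp (- (\<Sum>i<n. \<tau> i * Z i \<omega>)) * (\<Sum>k<J. a k * F (c k) * exp (- (\<Sum>i<n. c k i * Z i \<omega>))) \<partial>Q)"
  proof -
    have "(\<integral>\<omega>. exp (- (\<Sum>i<n. \<tau> i * Z i \<omega>)) * (\<Sum>k<J. a k * F (c k) * exp (- (\<Sum>i<n. c k i * Z i \<omega>))) \<partial>Q) =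
      (\<integral>\<omega>. (\<Sum>k<J. a k * F (c k) * exp (- (\<Sum>i<n. (c k i + \<tau> i) * Z i \<omega>))) \<partial>Q)"
      unfolding exp_plus by (simp add: sum_distrib_left mult_ac)
    also have "\<dots> = (\<Sum>k<J. a k * F (c k) * (\<integral>\<omega>. exp (- (\<Sum>i<n. (c k i + \<tau> i) * Z i \<omega>)) \<partial>Q))"
      using int[OF cn(2)] by (subst Bochner_Integration.integral_sum) auto
    finally show ?thesis by (simp add: mult_ac)
  qed
  \<comment> \<open>The comparison is pointwise: for fixed values of \<open>Z\<close>, the convolved
    decreasing function is at most \<open>F 0\<close> times the function itself.\<close>
  also have "\<dots> \<le> (\<integral>\<omega>. exp (- (\<Sum>i<n. \<tau> i * Z i \<omega>)) * (F (\<lambda>_. 0) * \<phi> (\<lambda>i. Z i \<omega>)) \<partial>Q)"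
  proof (rule integral_mono)
    have *: "integrable Q (\<lambda>\<omega>. exp (- (\<Sum>i<n. \<tau> i * Z i \<omega>)) * (\<Sum>k<J. b k * exp (- (\<Sum>i<n. c k i * Z i \<omega>))))" for b
    proof -
      have "integrable Q (\<lambda>\<omega>. \<Sum>k<J. b k * exp (- (\<Sum>i<n. (c k i + \<tau> i) * Z i \<omega>)))"
        using int[OF cn(2)] by (intro Bochner_Integration.integrable_sum integrable_mult_right) auto
      then show ?thesis unfolding exp_plus by (simp add: sum_distrib_left mult_ac)
    qed
    show "integrable Q (\<lambda>\<omega>. exp (- (\<Sum>i<n. \<tau> i * Z i \<omega>)) * (\<Sum>k<J. a k * F (c k) * exp (- (\<Sum>i<n. c k i * Z i \<omega>))))"
      by (rule *)
    show "integrable Q (\<lambda>\<omega>. exp (- (\<Sum>i<n. \<tau> i * Z i \<omega>)) * (F (\<lambda>_. 0) * \<phi> (\<lambda>i. Z i \<omega>)))"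
      using *[of "\<lambda>k. F (\<lambda>_. 0) * a k"] unfolding \<phi>_def by (simp add: sum_distrib_left mult_ac)
    fix \<omega> assume \<omega>: "\<omega> \<in> space Q"
    have "(\<Sum>k<J. a k * F (c k) * exp (- (\<Sum>i<n. c k i * Z i \<omega>))) \<le> F (\<lambda>_. 0) * \<phi> (\<lambda>i. Z i \<omega>)"
      unfolding \<phi>_def
      by (rule laplace_pos_antimono[OF _ F]) (use c Z(2)[OF _ \<omega>] anti in \<open>auto intro: less_imp_le\<close>)
    then show "exp (- (\<Sum>i<n. \<tau> i * Z i \<omega>)) * (\<Sum>k<J. a k * F (c k) * exp (- (\<Sum>i<n. c k i * Z i \<omega>))) \<le>
       exp (- (\<Sum>i<n. \<tau> i * Z i \<omega>)) * (F (\<lambda>_. 0) * \<phi> (\<lambda>i. Z i \<omega>))"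
      by (intro mult_left_mono) auto
  qed
  also have "\<dots> = F (\<lambda>_. 0) * (\<integral>\<omega>. exp (- (\<Sum>i<n. \<tau> i * Z i \<omega>)) * \<phi> (\<lambda>i. Z i \<omega>) \<partial>Q)"
    by (simp add: mult.left_commute)
  also have "F (\<lambda>_. 0) = laplace_det \<tau> powr \<alpha>" unfolding F_def by (simp add: laplace_det_0)
  finally show ?thesis .
qed

text \<open>Products of step functions decrease in each coordinate, so
  \<open>tilted_integral_le\<close> applies before the limit. The events use a strict inequality on
  the left and a weak one on the right because the limit gives thresholds a weight strictly between
  0 and 1.\<close>

lemma prob_all_less_tilted:
  fixes Q :: "'b measure" and Z :: "nat \<Rightarrow> 'b \<Rightarrow> real"
  assumes "prob_space Q" "0 < \<alpha>" "nonneg \<tau>"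
    and Z: "\<And>i. i < n \<Longrightarrow> Z i \<in> borel_measurable Q" "\<And>i \<omega>. i < n \<Longrightarrow> \<omega> \<in> space Q \<Longrightarrow> 0 \<le> Z i \<omega>"
    and LT: "\<And>s. (\<And>i. i < n \<Longrightarrow> 0 < s i) \<Longrightarrow> (\<integral>\<omega>. exp (- (\<Sum>i<n. s i * Z i \<omega>)) \<partial>Q) = laplace_det s powr (- \<alpha>)"
    and \<theta>: "\<And>i. i < n \<Longrightarrow> 0 < \<theta> i"
  shows "measure Q {\<omega> \<in> space Q. \<forall>i<n. Z i \<omega> < \<theta> i} \<le> laplace_det \<tau> powr \<alpha> *
    (\<integral>\<omega>. exp (- (\<Sum>i<n. \<tau> i * Z i \<omega>)) * indicator {\<omega> \<in> space Q. \<forall>i<n. Z i \<omega> \<le> \<theta> i} \<omega> \<partial>Q)"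
proof -
  interpret prob_space Q by fact
  have [measurable]: "i < n \<Longrightarrow> Z i \<in> borel_measurable Q" for i by (rule Z)
  have w[measurable]: "weighted_step t \<in> borel_measurable borel" "laplace_step t m \<in> borel_measurable borel" for t m
    unfolding weighted_step_def[abs_def] laplace_step_def[abs_def] by measurable
  let ?e = "\<lambda>\<omega>. exp (- (\<Sum>i<n. \<tau> i * Z i \<omega>))"
  let ?L = "\<lambda>m \<omega>. \<Prod>i<n. laplace_step (\<theta> i) m (Z i \<omega>)"
  let ?W = "\<lambda>\<omega>. \<Prod>i<n. weighted_step (\<theta> i) (Z i \<omega>)"
  have e1: "0 \<le> ?e \<omega>" "?e \<omega> \<le> 1" if "\<omega> \<in> space Q" for \<omega>
    using Z(2)[OF _ that] assms(3) by (auto simp: nonneg_def intro!: sum_nonneg)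
  have L01: "0 \<le> ?L (m + 2) \<omega>" "?L (m + 2) \<omega> \<le> 1" if "\<omega> \<in> space Q" for m \<omega>
    using laplace_step_bounds[OF \<theta> Z(2)[OF _ that], of _ _ "m + 2"]
    by (auto intro!: prod_nonneg prod_le_1)
  have sets: "{\<omega> \<in> space Q. \<forall>i<n. Z i \<omega> < \<theta> i} \<in> sets Q" "{\<omega> \<in> space Q. \<forall>i<n. Z i \<omega> \<le> \<theta> i} \<in> sets Q"
  proof -
    have "{\<omega> \<in> space Q. \<forall>i\<in>{..<n}. Z i \<omega> < \<theta> i} \<in> sets Q" "{\<omega> \<in> space Q. \<forall>i\<in>{..<n}. Z i \<omega> \<le> \<theta> i} \<in> sets Q"
      by (rule sets.sets_Collect_finite_All; simp)+
    then show "{\<omega> \<in> space Q. \<forall>i<n. Z i \<omega> < \<theta> i} \<in> sets Q" "{\<omega> \<in> space Q. \<forall>i<n. Z i \<omega> \<le> \<theta> i} \<in> sets Q"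
      by (simp_all add: Ball_def)
  qed
  note [measurable] = borel_measurable_indicator[OF sets(1)] borel_measurable_indicator[OF sets(2)]
  have step: "(\<integral>\<omega>. ?L (m + 2) \<omega> \<partial>Q) \<le> laplace_det \<tau> powr \<alpha> * (\<integral>\<omega>. ?e \<omega> * ?L (m + 2) \<omega> \<partial>Q)" for m
  proof -
    obtain J a c where c: "\<forall>k<J. \<forall>i<n. 0 < c k i" and
      eq: "\<And>z. (\<Prod>i<n. laplace_step (\<theta> i) (m + 2) (z i)) = (\<Sum>k<(J::nat). a k * exp (- (\<Sum>i<n. c k i * z i)))"
    proof -
      have "\<exists>J a c. (\<forall>k<J. \<forall>i<n. 0 < c k i) \<and>
        (\<forall>z. (\<Prod>i<n. laplace_step (\<theta> i) (m + 2) (z i)) = (\<Sum>k<(J::nat). a k * exp (- (\<Sum>i<n. c k i * z i))))"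
        by (rule prod_laplace_step_expand) (use \<theta> in auto)
      then show thesis using that by blast
    qed
    show ?thesis
      unfolding eq
    proof (rule tilted_integral_le[OF assms(1-3) Z LT])
      fix z y :: "nat \<Rightarrow> real" assume "\<And>i. i < n \<Longrightarrow> 0 \<le> z i" "\<And>i. i < n \<Longrightarrow> 0 \<le> y i"
      then show "(\<Sum>k<J. a k * exp (- (\<Sum>i<n. c k i * (z i + y i)))) \<le> (\<Sum>k<J. a k * exp (- (\<Sum>i<n. c k i * z i)))"
        unfolding eq[symmetric]
        by (intro prod_mono conjI laplace_step_bounds(1) laplace_step_antimono) (auto simp: \<theta>)
    qed (use c in auto)
  qed
  have lim: "(\<lambda>m. \<integral>\<omega>. g \<omega> * ?L (m + 2) \<omega> \<partial>Q) \<longlonglongrightarrow> (\<integral>\<omega>. g \<omega> * ?W \<omega> \<partial>Q)"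
    if [measurable]: "g \<in> borel_measurable Q" and g: "\<And>\<omega>. \<omega> \<in> space Q \<Longrightarrow> 0 \<le> g \<omega>" "\<And>\<omega>. \<omega> \<in> space Q \<Longrightarrow> g \<omega> \<le> 1"
    for g
  proof (rule integral_dominated_convergence[where w = "\<lambda>_. 1"])
    show "AE \<omega> in Q. (\<lambda>m. g \<omega> * ?L (m + 2) \<omega>) \<longlonglongrightarrow> g \<omega> * ?W \<omega>"
      using Z(2) \<theta>
      by (intro AE_I2 tendsto_mult tendsto_const tendsto_prod LIMSEQ_ignore_initial_segment[OF laplace_step_tendsto]) auto
    show "AE \<omega> in Q. norm (g \<omega> * ?L (m + 2) \<omega>) \<le> 1" for m
      using g L01 by (intro AE_I2) (auto simp: abs_mult abs_of_nonneg intro!: mult_le_one)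
  qed (use that(1) in \<open>simp_all, measurable\<close>)
  have W: "(\<integral>\<omega>. ?W \<omega> \<partial>Q) \<le> laplace_det \<tau> powr \<alpha> * (\<integral>\<omega>. ?e \<omega> * ?W \<omega> \<partial>Q)"
  proof (rule LIMSEQ_le)
    show "(\<lambda>m. \<integral>\<omega>. ?L (m + 2) \<omega> \<partial>Q) \<longlonglongrightarrow> (\<integral>\<omega>. ?W \<omega> \<partial>Q)"
      using lim[of "\<lambda>_. 1"] by simp
    show "(\<lambda>m. laplace_det \<tau> powr \<alpha> * (\<integral>\<omega>. ?e \<omega> * ?L (m + 2) \<omega> \<partial>Q)) \<longlonglongrightarrow> laplace_det \<tau> powr \<alpha> * (\<integral>\<omega>. ?e \<omega> * ?W \<omega> \<partial>Q)"
      by (intro tendsto_mult tendsto_const lim) (use e1 in auto)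
  qed (use step in auto)
  have e0: "0 \<le> (1::real) - exp (-1)" "(1::real) - exp (-1) \<le> 1" by auto
  have W01: "0 \<le> ?W \<omega>" "?W \<omega> \<le> 1" for \<omega>
    using e0 by (auto intro!: prod_nonneg prod_le_1 simp: weighted_step_def)
  have "measure Q {\<omega> \<in> space Q. \<forall>i<n. Z i \<omega> < \<theta> i} = (\<integral>\<omega>. indicator {\<omega> \<in> space Q. \<forall>i<n. Z i \<omega> < \<theta> i} \<omega> \<partial>Q)"
    by simp
  also have "\<dots> \<le> (\<integral>\<omega>. ?W \<omega> \<partial>Q)"
  proof (rule integral_mono)
    show "integrable Q ?W" by (rule integrable_const_bound[of _ 1]) (use W01 in auto)
    show "indicat_real {\<omega> \<in> space Q. \<forall>i<n. Z i \<omega> < \<theta> i} \<omega> \<le> ?W \<omega>" for \<omega>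
      using W01(1)[of \<omega>] by (auto simp: indicator_def weighted_step_def)
    show "integrable Q (indicat_real {\<omega> \<in> space Q. \<forall>i<n. Z i \<omega> < \<theta> i})"
      by (rule integrable_const_bound[of _ 1]) (auto simp: indicator_def)
  qed
  also have "\<dots> \<le> laplace_det \<tau> powr \<alpha> * (\<integral>\<omega>. ?e \<omega> * ?W \<omega> \<partial>Q)" by (rule W)
  also have "\<dots> \<le> laplace_det \<tau> powr \<alpha> * (\<integral>\<omega>. ?e \<omega> * indicator {\<omega> \<in> space Q. \<forall>i<n. Z i \<omega> \<le> \<theta> i} \<omega> \<partial>Q)"
  proof (intro mult_left_mono integral_mono)
    fix \<omega> assume \<omega>: "\<omega> \<in> space Q"
    show "?W \<omega> \<le> indicat_real {\<omega> \<in> space Q. \<forall>i<n. Z i \<omega> \<le> \<theta> i} \<omega>"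
    proof (cases "\<forall>i<n. Z i \<omega> \<le> \<theta> i")
      case True then show ?thesis using W01 \<omega> by simp
    next
      case False
      then obtain i where "i < n" "weighted_step (\<theta> i) (Z i \<omega>) = 0" by (auto simp: weighted_step_def)
      then have W0: "?W \<omega> = 0" by (intro prod_zero) auto
      show ?thesis unfolding W0 by simp
    qed
  next
    show "integrable Q (\<lambda>\<omega>. ?e \<omega> * ?W \<omega>)"
      by (rule integrable_const_bound[of _ 1]) (use W01 e1 in \<open>auto simp: abs_mult intro!: mult_le_one AE_I2\<close>)
    show "integrable Q (\<lambda>\<omega>. ?e \<omega> * indicator {\<omega> \<in> space Q. \<forall>i<n. Z i \<omega> \<le> \<theta> i} \<omega>)"
      by (rule integrable_const_bound[of _ 1]) (use e1 in \<open>auto simp: abs_mult indicator_def intro!: mult_le_one AE_I2\<close>)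
  qed auto
  finally show ?thesis .
qed

end

section \<open>Gamma and bivariate gamma distributions\<close>

definition gamma_density :: "real \<Rightarrow> real \<Rightarrow> real" where
  "gamma_density \<beta> x = indicator {0..} x * x powr (\<beta> - 1) * exp (- x) / Gamma \<beta>"

lemma gamma_density_nonneg: "0 < \<beta> \<Longrightarrow> 0 \<le> gamma_density \<beta> x"
  unfolding gamma_density_def using Gamma_real_pos[of \<beta>] by simp

lemma gamma_density_measurable [measurable]: "gamma_density \<beta> \<in> borel_measurable borel"
  unfolding gamma_density_def[abs_def] by measurable

text \<open>Scaling by \<open>1 + s\<close> in Euler's integral. Negative \<open>s\<close> is
  included for the exponential moment in \<open>gamma_tail_le\<close>.\<close>

lemma nn_integral_gamma_density:
  assumes "0 < \<beta>" "-1 < s"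
  shows "(\<integral>\<^sup>+x. ennreal (exp (- s * x)) * ennreal (gamma_density \<beta> x) \<partial>lborel) = ennreal ((1 + s) powr (- \<beta>))"
proof -
  define I where "I = (\<integral>\<^sup>+x. ennreal (exp (- s * x)) * ennreal (gamma_density \<beta> x) \<partial>lborel)"
  have c: "0 < 1 + s" using assms by simp
  have G: "0 < Gamma \<beta>" using Gamma_real_pos[OF assms(1)] .
  have "ennreal (Gamma \<beta>) = (\<integral>\<^sup>+t. ennreal (indicator {0..} t * t powr (\<beta> - 1) / exp t) \<partial>lborel)"
    by (rule Gamma_conv_nn_integral_real) fact
  also have "\<dots> = ennreal \<bar>1 + s\<bar> * (\<integral>\<^sup>+x. ennreal (indicator {0..} (0 + (1 + s) * x) * (0 + (1 + s) * x) powr (\<beta> - 1) / exp (0 + (1 + s) * x)) \<partial>lborel)"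
    using c by (intro nn_integral_real_affine) auto
  also have "(\<integral>\<^sup>+x. ennreal (indicator {0..} (0 + (1 + s) * x) * (0 + (1 + s) * x) powr (\<beta> - 1) / exp (0 + (1 + s) * x)) \<partial>lborel)
    = (\<integral>\<^sup>+x. ennreal (Gamma \<beta> * (1 + s) powr (\<beta> - 1)) * (ennreal (exp (- s * x)) * ennreal (gamma_density \<beta> x)) \<partial>lborel)"
  proof (rule nn_integral_cong)
    fix x :: real
    have "indicator {0..} (0 + (1 + s) * x) * (0 + (1 + s) * x) powr (\<beta> - 1) / exp (0 + (1 + s) * x) =
      (Gamma \<beta> * (1 + s) powr (\<beta> - 1)) * (exp (- s * x) * gamma_density \<beta> x)"
    proof (cases "0 \<le> x")
      case True
      have "exp (0 + (1 + s) * x) = exp x * exp (s * x)" by (simp add: distrib_right exp_add)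
      moreover have "(0 + (1 + s) * x) powr (\<beta> - 1) = (1 + s) powr (\<beta> - 1) * x powr (\<beta> - 1)"
        using True c by (simp add: powr_mult)
      moreover have "indicator {0..} (0 + (1 + s) * x) = (1::real)" using True c by simp
      ultimately show ?thesis using True G by (simp add: gamma_density_def exp_minus field_simps)
    next
      case False
      then have "\<not> 0 \<le> (1 + s) * x" using c by (simp add: zero_le_mult_iff)
      then show ?thesis using False by (simp add: gamma_density_def)
    qed
    then show "ennreal (indicator {0..} (0 + (1 + s) * x) * (0 + (1 + s) * x) powr (\<beta> - 1) / exp (0 + (1 + s) * x)) =
      ennreal (Gamma \<beta> * (1 + s) powr (\<beta> - 1)) * (ennreal (exp (- s * x)) * ennreal (gamma_density \<beta> x))"
      using G gamma_density_nonneg[OF assms(1), of x] by (simp add: ennreal_mult)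
  qed
  also have "\<dots> = ennreal (Gamma \<beta> * (1 + s) powr (\<beta> - 1)) * I"
    unfolding I_def by (rule nn_integral_cmult) measurable
  finally have *: "ennreal (Gamma \<beta>) = ennreal (1 + s) * (ennreal (Gamma \<beta> * (1 + s) powr (\<beta> - 1)) * I)"
    using c by simp
  have "(1 + s) * (Gamma \<beta> * (1 + s) powr (\<beta> - 1)) = Gamma \<beta> * (1 + s) powr \<beta>"
    using c by (simp add: powr_diff)
  then have "ennreal (1 + s) * ennreal (Gamma \<beta> * (1 + s) powr (\<beta> - 1)) = ennreal (Gamma \<beta> * (1 + s) powr \<beta>)"
    using c G by (subst ennreal_mult[symmetric]) auto
  then have **: "ennreal (Gamma \<beta>) = ennreal (Gamma \<beta> * (1 + s) powr \<beta>) * I"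
    using * by (simp add: mult.assoc[symmetric])
  have "ennreal (inverse (Gamma \<beta> * (1 + s) powr \<beta>)) * ennreal (Gamma \<beta>) = ennreal (inverse (Gamma \<beta> * (1 + s) powr \<beta>)) * ennreal (Gamma \<beta> * (1 + s) powr \<beta>) * I"
    by (simp add: ** mult.assoc)
  also have "ennreal (inverse (Gamma \<beta> * (1 + s) powr \<beta>)) * ennreal (Gamma \<beta> * (1 + s) powr \<beta>) = 1"
    using c G by (subst ennreal_mult[symmetric]) (auto simp: field_simps)
  finally have "I = ennreal (inverse (Gamma \<beta> * (1 + s) powr \<beta>) * Gamma \<beta>)"
    using G by (simp add: ennreal_mult)
  also have "inverse (Gamma \<beta> * (1 + s) powr \<beta>) * Gamma \<beta> = (1 + s) powr (- \<beta>)"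
    using G by (simp add: powr_minus)
  finally show ?thesis unfolding I_def .
qed

lemma distr_eq_gamma_density:
  assumes "prob_space Q" "0 < \<alpha>" and X[measurable]: "X \<in> borel_measurable Q"
    and "\<And>\<omega>. \<omega> \<in> space Q \<Longrightarrow> 0 \<le> X \<omega>"
    and LT: "\<And>s. 0 < s \<Longrightarrow> (\<integral>\<omega>. exp (- (s * X \<omega>)) \<partial>Q) = (1 + s) powr (- \<alpha>)"
  shows "distr Q borel X = density lborel (\<lambda>x. ennreal (gamma_density \<alpha> x))"
proof -
  interpret prob_space Q by fact
  show ?thesis
  proof (rule measure_eqI_laplace)
    show "finite_measure (distr Q borel X)" by (rule finite_measure_distr) fact
    show "finite_measure (density lborel (\<lambda>x. ennreal (gamma_density \<alpha> x)))"
      using nn_integral_gamma_density[OF assms(2), of 0]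
      by (intro finite_measureI) (simp add: emeasure_density)
    show "AE x in distr Q borel X. 0 \<le> x"
      using assms(4) by (subst AE_distr_iff) auto
    show "AE x in density lborel (\<lambda>x. ennreal (gamma_density \<alpha> x)). 0 \<le> x"
      by (subst AE_density) (auto simp: gamma_density_def indicator_def)
    fix s :: real assume s: "0 < s"
    have int: "integrable Q (\<lambda>\<omega>. exp (- (s * X \<omega>)))"
      by (rule integrable_const_bound[of _ 1]) (use assms(4) s in \<open>auto intro!: AE_I2\<close>)
    have "(\<integral>\<^sup>+x. ennreal (exp (- s * x)) \<partial>distr Q borel X) = (\<integral>\<^sup>+\<omega>. ennreal (exp (- (s * X \<omega>))) \<partial>Q)"
      by (subst nn_integral_distr) auto
    also have "\<dots> = ennreal ((1 + s) powr (- \<alpha>))"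
      using int by (subst nn_integral_eq_integral) (auto simp: LT[OF s])
    also have "\<dots> = (\<integral>\<^sup>+x. ennreal (exp (- s * x)) \<partial>density lborel (\<lambda>x. ennreal (gamma_density \<alpha> x)))"
      using s assms(2) by (subst nn_integral_density) (simp_all add: nn_integral_gamma_density[symmetric] mult.commute)
    finally show "(\<integral>\<^sup>+x. ennreal (exp (- s * x)) \<partial>distr Q borel X) = (\<integral>\<^sup>+x. ennreal (exp (- s * x)) \<partial>density lborel (\<lambda>x. ennreal (gamma_density \<alpha> x)))" .
  qed auto
qed

text \<open>
  Kibble's bivariate gamma density: expanding \<open>(1 + s + t + (1 - r) s t)\<^sup>-\<^sup>\<alpha>\<close> in powers of \<open>r\<close> gives a mixture of
  products of Laplace transforms of scaled gamma densities.
\<close>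

definition scaled_gamma_density :: "real \<Rightarrow> real \<Rightarrow> real \<Rightarrow> real" where
  "scaled_gamma_density \<rho> \<beta> x = gamma_density \<beta> (x / \<rho>) / \<rho>"

text \<open>Negative binomial weights, of total mass 1 when \<open>0 < \<alpha>\<close> and
  \<open>0 \<le> r < 1\<close>.\<close>

definition kibble_coeff :: "real \<Rightarrow> real \<Rightarrow> nat \<Rightarrow> real" where
  "kibble_coeff \<alpha> r m = (1 - r) powr \<alpha> * (pochhammer \<alpha> m / fact m) * r ^ m"

text \<open>Values in \<open>ennreal\<close> let the series be integrated term by term without any
  convergence to check.\<close>

definition kibble_density :: "real \<Rightarrow> real \<Rightarrow> real \<Rightarrow> real \<Rightarrow> ennreal" where
  "kibble_density \<alpha> r x y = (\<Sum>m. ennreal (kibble_coeff \<alpha> r m) *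
    (ennreal (scaled_gamma_density (1 - r) (\<alpha> + real m) x) * ennreal (scaled_gamma_density (1 - r) (\<alpha> + real m) y)))"

lemma scaled_gamma_density_measurable [measurable]: "scaled_gamma_density \<rho> \<beta> \<in> borel_measurable borel"
  unfolding scaled_gamma_density_def[abs_def] by measurable

lemma scaled_gamma_density_nonneg: "0 < \<rho> \<Longrightarrow> 0 < \<beta> \<Longrightarrow> 0 \<le> scaled_gamma_density \<rho> \<beta> x"
  unfolding scaled_gamma_density_def by (simp add: gamma_density_nonneg)

lemma kibble_density_measurable [measurable]:
  "(\<lambda>(x, y). kibble_density \<alpha> r x y) \<in> borel_measurable (borel \<Otimes>\<^sub>M borel)"
  unfolding kibble_density_def split_beta' by measurable

lemma kibble_coeff_nonneg: "0 < \<alpha> \<Longrightarrow> 0 \<le> r \<Longrightarrow> 0 \<le> kibble_coeff \<alpha> r m"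
  unfolding kibble_coeff_def by (simp add: pochhammer_nonneg)

lemma nn_integral_scaled_gamma_density:
  assumes "0 < \<rho>" "0 < \<beta>" "0 \<le> s"
  shows "(\<integral>\<^sup>+x. ennreal (exp (- s * x)) * ennreal (scaled_gamma_density \<rho> \<beta> x) \<partial>lborel) = ennreal ((1 + \<rho> * s) powr (- \<beta>))"
proof -
  have "(\<integral>\<^sup>+x. ennreal (exp (- s * x)) * ennreal (scaled_gamma_density \<rho> \<beta> x) \<partial>lborel) =
    ennreal \<bar>\<rho>\<bar> * (\<integral>\<^sup>+x. ennreal (exp (- s * (0 + \<rho> * x))) * ennreal (scaled_gamma_density \<rho> \<beta> (0 + \<rho> * x)) \<partial>lborel)"
    using assms by (intro nn_integral_real_affine) auto
  also have "\<dots> = (\<integral>\<^sup>+x. ennreal \<rho> * (ennreal (exp (- s * (0 + \<rho> * x))) * ennreal (scaled_gamma_density \<rho> \<beta> (0 + \<rho> * x))) \<partial>lborel)"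
    using assms by (subst nn_integral_cmult) auto
  also have "\<dots> = (\<integral>\<^sup>+x. ennreal (exp (- (\<rho> * s) * x)) * ennreal (gamma_density \<beta> x) \<partial>lborel)"
    using assms gamma_density_nonneg[OF assms(2)]
    by (intro nn_integral_cong) (simp add: scaled_gamma_density_def ennreal_mult[symmetric] mult_ac)
  also have "\<dots> = ennreal ((1 + \<rho> * s) powr (- \<beta>))"
    using assms mult_nonneg_nonneg[of \<rho> s] by (intro nn_integral_gamma_density) linarith+
  finally show ?thesis .
qed

lemma nn_integral_kibble_density:
  assumes "0 < \<alpha>" "0 \<le> r" "r < 1" "0 \<le> s" "0 \<le> t"
  shows "(\<integral>\<^sup>+x. ennreal (exp (- s * x)) * (\<integral>\<^sup>+y. ennreal (exp (- t * y)) * kibble_density \<alpha> r x y \<partial>lborel) \<partial>lborel) =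
    ennreal ((1 + s + t + (1 - r) * s * t) powr (- \<alpha>))"
proof -
  let ?\<rho> = "1 - r"
  let ?g = "\<lambda>m x. ennreal (scaled_gamma_density ?\<rho> (\<alpha> + real m) x)"
  let ?P = "(1 + ?\<rho> * s) * (1 + ?\<rho> * t)"
  have \<rho>: "0 < ?\<rho>" using assms by simp
  have P1: "1 \<le> 1 + ?\<rho> * s" "1 \<le> 1 + ?\<rho> * t" using assms by auto
  then have P: "1 * 1 \<le> ?P" by (intro mult_mono) auto
  have "(\<integral>\<^sup>+y. ennreal (exp (- t * y)) * kibble_density \<alpha> r x y \<partial>lborel) =
    (\<Sum>m. ennreal (kibble_coeff \<alpha> r m) * ?g m x * ennreal ((1 + ?\<rho> * t) powr (- (\<alpha> + real m))))" for x
  proof -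
    have "(\<integral>\<^sup>+y. ennreal (exp (- t * y)) * kibble_density \<alpha> r x y \<partial>lborel) =
      (\<integral>\<^sup>+y. (\<Sum>m. (ennreal (kibble_coeff \<alpha> r m) * ?g m x) * (ennreal (exp (- t * y)) * ?g m y)) \<partial>lborel)"
      unfolding kibble_density_def ennreal_suminf_cmult[symmetric] by (simp add: mult_ac)
    also have "\<dots> = (\<Sum>m. \<integral>\<^sup>+y. (ennreal (kibble_coeff \<alpha> r m) * ?g m x) * (ennreal (exp (- t * y)) * ?g m y) \<partial>lborel)"
      by (rule nn_integral_suminf) measurable
    also have "\<dots> = (\<Sum>m. ennreal (kibble_coeff \<alpha> r m) * ?g m x * ennreal ((1 + ?\<rho> * t) powr (- (\<alpha> + real m))))"
      using \<rho> assms by (subst nn_integral_cmult) (simp_all add: nn_integral_scaled_gamma_density[unfolded mult_minus_left] del: minus_add_distrib)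
    finally show ?thesis .
  qed
  then have "(\<integral>\<^sup>+x. ennreal (exp (- s * x)) * (\<integral>\<^sup>+y. ennreal (exp (- t * y)) * kibble_density \<alpha> r x y \<partial>lborel) \<partial>lborel) =
    (\<integral>\<^sup>+x. (\<Sum>m. (ennreal (kibble_coeff \<alpha> r m) * ennreal ((1 + ?\<rho> * t) powr (- (\<alpha> + real m)))) * (ennreal (exp (- s * x)) * ?g m x)) \<partial>lborel)"
    by (intro nn_integral_cong) (simp add: ennreal_suminf_cmult[symmetric] mult_ac del: ennreal_suminf_cmult)
  also have "\<dots> = (\<Sum>m. \<integral>\<^sup>+x. (ennreal (kibble_coeff \<alpha> r m) * ennreal ((1 + ?\<rho> * t) powr (- (\<alpha> + real m)))) * (ennreal (exp (- s * x)) * ?g m x) \<partial>lborel)"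
    by (rule nn_integral_suminf) measurable
  also have "\<dots> = (\<Sum>m. ennreal (kibble_coeff \<alpha> r m * ((1 + ?\<rho> * t) powr (- (\<alpha> + real m)) * (1 + ?\<rho> * s) powr (- (\<alpha> + real m)))))"
    using \<rho> assms
    by (subst nn_integral_cmult)
       (simp_all add: nn_integral_scaled_gamma_density[unfolded mult_minus_left] kibble_coeff_nonneg ennreal_mult mult.assoc del: minus_add_distrib)
  \<comment> \<open>With \<open>?P = (1 + \<rho> s) (1 + \<rho> t)\<close> the binomial series sums
    to \<open>\<rho> powr \<alpha> * (?P - r) powr (- \<alpha>)\<close>. As
    \<open>?P - r = \<rho> (1 + s + t + \<rho> s t)\<close>, the power of \<open>\<rho>\<close>
    cancels.\<close>
  also have "\<dots> = ennreal ((1 + s + t + (1 - r) * s * t) powr (- \<alpha>))"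
  proof (rule suminf_ennreal_eq)
    show "0 \<le> kibble_coeff \<alpha> r m * ((1 + ?\<rho> * t) powr (- (\<alpha> + real m)) * (1 + ?\<rho> * s) powr (- (\<alpha> + real m)))" for m
      using assms by (simp add: kibble_coeff_nonneg)
    have rP: "0 \<le> r / ?P" "r / ?P < 1" using assms P by (auto simp: field_simps)
    have "(\<lambda>m. ((- \<alpha>) gchoose m) * (- (r / ?P)) ^ m) sums (1 + (- (r / ?P))) powr (- \<alpha>)"
      by (rule gen_binomial_real) (use rP in \<open>simp only: abs_minus abs_of_nonneg\<close>)
    then have "(\<lambda>m. (?\<rho> powr \<alpha> * ?P powr (- \<alpha>)) * (((- \<alpha>) gchoose m) * (- (r / ?P)) ^ m)) sums
       ((?\<rho> powr \<alpha> * ?P powr (- \<alpha>)) * (1 + (- (r / ?P))) powr (- \<alpha>))"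
      by (rule sums_mult)
    moreover have "(?\<rho> powr \<alpha> * ?P powr (- \<alpha>)) * (((- \<alpha>) gchoose m) * (- (r / ?P)) ^ m) =
      kibble_coeff \<alpha> r m * ((1 + ?\<rho> * t) powr (- (\<alpha> + real m)) * (1 + ?\<rho> * s) powr (- (\<alpha> + real m)))" for m
    proof -
      have "((- \<alpha>) gchoose m) * (- (r / ?P)) ^ m = pochhammer \<alpha> m / fact m * (r / ?P) ^ m"
        by (simp add: gbinomial_pochhammer power_minus[of "r / ?P"] flip: mult.assoc power_add)
      also have "\<dots> = pochhammer \<alpha> m / fact m * r ^ m * ?P powr (- real m)"
      proof -
        have "(r / p) ^ m = r ^ m * p powr (- real m)" if "0 < p" for p :: real
          using that by (simp add: power_divide powr_minus_divide powr_realpow)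
        from this[of ?P] show ?thesis using P by simp
      qed
      finally have "(?\<rho> powr \<alpha> * ?P powr (- \<alpha>)) * (((- \<alpha>) gchoose m) * (- (r / ?P)) ^ m) =
        kibble_coeff \<alpha> r m * (?P powr (- \<alpha>) * ?P powr (- real m))"
        by (simp add: kibble_coeff_def)
      also have "?P powr (- \<alpha>) * ?P powr (- real m) = ?P powr (- (\<alpha> + real m))"
        by (simp flip: powr_add)
      also have "\<dots> = (1 + ?\<rho> * t) powr (- (\<alpha> + real m)) * (1 + ?\<rho> * s) powr (- (\<alpha> + real m))"
        using P1 by (simp add: powr_mult mult.commute del: minus_add_distrib)
      finally show ?thesis .
    qed
    moreover have "(?\<rho> powr \<alpha> * ?P powr (- \<alpha>)) * (1 + (- (r / ?P))) powr (- \<alpha>) = (1 + s + t + (1 - r) * s * t) powr (- \<alpha>)"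
    proof -
      have "(?\<rho> powr \<alpha> * ?P powr (- \<alpha>)) * (1 + (- (r / ?P))) powr (- \<alpha>) =
        inverse ?\<rho> powr (- \<alpha>) * (?P * (1 + (- (r / ?P)))) powr (- \<alpha>)"
        using \<rho> P rP by (simp add: powr_mult powr_minus inverse_powr)
      also have "\<dots> = (inverse ?\<rho> * (?P * (1 + (- (r / ?P))))) powr (- \<alpha>)"
        using \<rho> P rP by (subst powr_mult) auto
      also have "inverse ?\<rho> * (?P * (1 + (- (r / ?P)))) = 1 + s + t + (1 - r) * s * t"
      proof -
        have "p * (1 + (- (r / p))) = p - r" if "0 < p" for p :: real
          using that by (simp add: field_simps)
        from this[of ?P] have "?P * (1 + (- (r / ?P))) = ?P - r" using P by simp
        also have "\<dots> = ?\<rho> * (1 + s + t + (1 - r) * s * t)" by (simp add: algebra_simps)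
        finally show ?thesis using \<rho> by simp
      qed
      finally show ?thesis .
    qed
    ultimately show "(\<lambda>m. kibble_coeff \<alpha> r m * ((1 + ?\<rho> * t) powr (- (\<alpha> + real m)) * (1 + ?\<rho> * s) powr (- (\<alpha> + real m)))) sums
       (1 + s + t + (1 - r) * s * t) powr (- \<alpha>)"
      by simp
  qed
  finally show ?thesis .
qed

lemma kibble_density_negative: "x < 0 \<or> y < 0 \<Longrightarrow> r < 1 \<Longrightarrow> kibble_density \<alpha> r x y = 0"
  unfolding kibble_density_def by (auto simp: scaled_gamma_density_def gamma_density_def indicator_def zero_le_divide_iff)

text \<open>One-dimensional uniqueness is used twice: first for \<open>X\<close> under
  \<open>Q\<close> weighted by \<open>exp (- t * Y)\<close> with \<open>t\<close> fixed, then for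
  \<open>Y\<close> under \<open>Q\<close> restricted to \<open>X \<in> S\<close>. The transform
  needed in the second round is the mass that the law identified in the first round gives to
  \<open>S\<close>.\<close>

lemma emeasure_eq_kibble_density:
  assumes "prob_space Q" "0 < \<alpha>" "0 \<le> r" "r < 1"
    and X[measurable]: "X \<in> borel_measurable Q" and Y[measurable]: "Y \<in> borel_measurable Q"
    and nonneg: "\<And>\<omega>. \<omega> \<in> space Q \<Longrightarrow> 0 \<le> X \<omega>" "\<And>\<omega>. \<omega> \<in> space Q \<Longrightarrow> 0 \<le> Y \<omega>"
    and LT: "\<And>s t. 0 < s \<Longrightarrow> 0 < t \<Longrightarrow> (\<integral>\<omega>. exp (- (s * X \<omega>)) * exp (- (t * Y \<omega>)) \<partial>Q) = (1 + s + t + (1 - r) * s * t) powr (- \<alpha>)"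
    and S[measurable]: "S \<in> sets borel" and T[measurable]: "T \<in> sets borel"
  shows "emeasure Q {\<omega> \<in> space Q. X \<omega> \<in> S \<and> Y \<omega> \<in> T} =
    (\<integral>\<^sup>+y. (\<integral>\<^sup>+x. indicator S x * kibble_density \<alpha> r x y \<partial>lborel) * indicator T y \<partial>lborel)"
proof -
  interpret prob_space Q by fact
  note kibble_density_measurable[measurable (raw)]
  have k[measurable]: "(\<lambda>x. kibble_density \<alpha> r x y) \<in> borel_measurable borel" "(\<lambda>y. kibble_density \<alpha> r x y) \<in> borel_measurable borel" for x y
    using measurable_compose_Pair1[of x borel, OF _ kibble_density_measurable]
      measurable_compose[OF measurable_Pair2'[of y borel] kibble_density_measurable] by auto
  have first: "distr (density Q (\<lambda>\<omega>. ennreal (exp (- (t * Y \<omega>))))) borel X =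
    density lborel (\<lambda>x. \<integral>\<^sup>+y. ennreal (exp (- t * y)) * kibble_density \<alpha> r x y \<partial>lborel)" if t: "0 < t" for t
  proof (rule measure_eqI_laplace)
    have "emeasure (density Q (\<lambda>\<omega>. ennreal (exp (- (t * Y \<omega>))))) (space Q) = (\<integral>\<^sup>+\<omega>. ennreal (exp (- (t * Y \<omega>))) * indicator (space Q) \<omega> \<partial>Q)"
      by (subst emeasure_density) auto
    also have "\<dots> \<le> (\<integral>\<^sup>+\<omega>. 1 \<partial>Q)"
      using nonneg t by (intro nn_integral_mono) (auto simp: indicator_def)
    finally have "finite_measure (density Q (\<lambda>\<omega>. ennreal (exp (- (t * Y \<omega>)))))"
      by (intro finite_measureI) (auto simp: emeasure_space_1 top_unique)
    then show "finite_measure (distr (density Q (\<lambda>\<omega>. ennreal (exp (- (t * Y \<omega>))))) borel X)"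
      by (rule finite_measure.finite_measure_distr) simp
    show "finite_measure (density lborel (\<lambda>x. \<integral>\<^sup>+y. ennreal (exp (- t * y)) * kibble_density \<alpha> r x y \<partial>lborel))"
      using nn_integral_kibble_density[OF assms(2-4), of 0 t] t
      by (intro finite_measureI) (simp add: emeasure_density)
    show "AE x in distr (density Q (\<lambda>\<omega>. ennreal (exp (- (t * Y \<omega>))))) borel X. 0 \<le> x"
      using nonneg by (subst AE_distr_iff) (auto simp: AE_density)
    have "(\<integral>\<^sup>+y. ennreal (exp (- t * y)) * kibble_density \<alpha> r x y \<partial>lborel) = 0" if "x < 0" for x
      using that assms(4) by (simp add: kibble_density_negative)
    then show "AE x in density lborel (\<lambda>x. \<integral>\<^sup>+y. ennreal (exp (- t * y)) * kibble_density \<alpha> r x y \<partial>lborel). 0 \<le> x"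
      by (intro AE_density[THEN iffD2] AE_I2) (measurable, metis not_le less_irrefl)
    fix s :: real assume s: "0 < s"
    have int: "integrable Q (\<lambda>\<omega>. exp (- (s * X \<omega>)) * exp (- (t * Y \<omega>)))"
      by (rule integrable_const_bound[of _ 1]) (use nonneg s t in \<open>auto intro!: AE_I2 mult_le_one\<close>)
    have "(\<integral>\<^sup>+x. ennreal (exp (- s * x)) \<partial>distr (density Q (\<lambda>\<omega>. ennreal (exp (- (t * Y \<omega>))))) borel X) =
      (\<integral>\<^sup>+\<omega>. ennreal (exp (- (s * X \<omega>)) * exp (- (t * Y \<omega>))) \<partial>Q)"
      by (subst nn_integral_distr, simp, simp, subst nn_integral_density)
         (auto simp: ennreal_mult mult.commute)
    also have "\<dots> = ennreal ((1 + s + t + (1 - r) * s * t) powr (- \<alpha>))"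
      using int by (subst nn_integral_eq_integral) (auto simp: LT[OF s t])
    also have "\<dots> = (\<integral>\<^sup>+x. ennreal (exp (- s * x)) \<partial>density lborel (\<lambda>x. \<integral>\<^sup>+y. ennreal (exp (- t * y)) * kibble_density \<alpha> r x y \<partial>lborel))"
      using nn_integral_kibble_density[OF assms(2-4), of s t] s t by (subst nn_integral_density) (auto simp: mult.commute)
    finally show "(\<integral>\<^sup>+x. ennreal (exp (- s * x)) \<partial>distr (density Q (\<lambda>\<omega>. ennreal (exp (- (t * Y \<omega>))))) borel X) =
      (\<integral>\<^sup>+x. ennreal (exp (- s * x)) \<partial>density lborel (\<lambda>x. \<integral>\<^sup>+y. ennreal (exp (- t * y)) * kibble_density \<alpha> r x y \<partial>lborel))" .
  qed auto
  have second: "distr (density Q (\<lambda>\<omega>. indicator S (X \<omega>))) borel Y =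
    density lborel (\<lambda>y. \<integral>\<^sup>+x. indicator S x * kibble_density \<alpha> r x y \<partial>lborel)"
  proof (rule measure_eqI_laplace)
    have "emeasure (density Q (\<lambda>\<omega>. indicator S (X \<omega>))) (space Q) = (\<integral>\<^sup>+\<omega>. indicator S (X \<omega>) * indicator (space Q) \<omega> \<partial>Q)"
      by (subst emeasure_density) auto
    also have "\<dots> \<le> (\<integral>\<^sup>+\<omega>. 1 \<partial>Q)"
      using nonneg  by (intro nn_integral_mono) (auto simp: indicator_def)
    finally have "finite_measure (density Q (\<lambda>\<omega>. indicator S (X \<omega>)))"
      by (intro finite_measureI) (auto simp: emeasure_space_1 top_unique)
    then show "finite_measure (distr (density Q (\<lambda>\<omega>. indicator S (X \<omega>))) borel Y)"
      by (rule finite_measure.finite_measure_distr) simp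
    have "(\<integral>\<^sup>+y. (\<integral>\<^sup>+x. indicator S x * kibble_density \<alpha> r x y \<partial>lborel) \<partial>lborel) \<le>
      (\<integral>\<^sup>+y. (\<integral>\<^sup>+x. kibble_density \<alpha> r x y \<partial>lborel) \<partial>lborel)"
      by (intro nn_integral_mono) (auto simp: indicator_def)
    also have "\<dots> = (\<integral>\<^sup>+x. (\<integral>\<^sup>+y. kibble_density \<alpha> r x y \<partial>lborel) \<partial>lborel)"
      by (rule lborel_pair.Fubini') measurable
    also have "\<dots> < \<infinity>" using nn_integral_kibble_density[OF assms(2-4), of 0 0] by simp
    finally show "finite_measure (density lborel (\<lambda>y. \<integral>\<^sup>+x. indicator S x * kibble_density \<alpha> r x y \<partial>lborel))"
      by (intro finite_measureI) (simp add: emeasure_density)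
    show "AE y in distr (density Q (\<lambda>\<omega>. indicator S (X \<omega>))) borel Y. 0 \<le> y"
      using nonneg by (subst AE_distr_iff) (auto simp: AE_density)
    have "(\<integral>\<^sup>+x. indicator S x * kibble_density \<alpha> r x y \<partial>lborel) = 0" if "y < 0" for y
      using that assms(4) by (simp add: kibble_density_negative)
    then show "AE y in density lborel (\<lambda>y. \<integral>\<^sup>+x. indicator S x * kibble_density \<alpha> r x y \<partial>lborel). 0 \<le> y"
      by (intro AE_density[THEN iffD2] AE_I2) (measurable, metis not_le less_irrefl)
    fix t :: real assume t: "0 < t"
    have "(\<integral>\<^sup>+y. ennreal (exp (- t * y)) \<partial>distr (density Q (\<lambda>\<omega>. indicator S (X \<omega>))) borel Y) =
      (\<integral>\<^sup>+\<omega>. ennreal (exp (- (t * Y \<omega>))) * indicator S (X \<omega>) \<partial>Q)"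
      by (subst nn_integral_distr, simp, simp, subst nn_integral_density) (auto simp: mult.commute)
    also have "\<dots> = emeasure (distr (density Q (\<lambda>\<omega>. ennreal (exp (- (t * Y \<omega>))))) borel X) S"
      by (subst emeasure_distr, simp, simp, subst emeasure_density)
         (auto intro!: nn_integral_cong simp: indicator_def)
    also have "\<dots> = (\<integral>\<^sup>+x. (\<integral>\<^sup>+y. ennreal (exp (- t * y)) * kibble_density \<alpha> r x y \<partial>lborel) * indicator S x \<partial>lborel)"
      unfolding first[OF t] by (subst emeasure_density) auto
    also have "\<dots> = (\<integral>\<^sup>+x. (\<integral>\<^sup>+y. ennreal (exp (- t * y)) * (indicator S x * kibble_density \<alpha> r x y) \<partial>lborel) \<partial>lborel)"
      by (intro nn_integral_cong) (auto simp: indicator_def)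
    also have "\<dots> = (\<integral>\<^sup>+y. (\<integral>\<^sup>+x. ennreal (exp (- t * y)) * (indicator S x * kibble_density \<alpha> r x y) \<partial>lborel) \<partial>lborel)"
      by (rule lborel_pair.Fubini') measurable
    also have "\<dots> = (\<integral>\<^sup>+y. (\<integral>\<^sup>+x. indicator S x * kibble_density \<alpha> r x y \<partial>lborel) * ennreal (exp (- t * y)) \<partial>lborel)"
      by (intro nn_integral_cong, subst nn_integral_cmult) (auto simp: mult.commute)
    also have "\<dots> = (\<integral>\<^sup>+y. ennreal (exp (- t * y)) \<partial>density lborel (\<lambda>y. \<integral>\<^sup>+x. indicator S x * kibble_density \<alpha> r x y \<partial>lborel))"
      by (subst nn_integral_density) auto
    finally show "(\<integral>\<^sup>+y. ennreal (exp (- t * y)) \<partial>distr (density Q (\<lambda>\<omega>. indicator S (X \<omega>))) borel Y) =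
      (\<integral>\<^sup>+y. ennreal (exp (- t * y)) \<partial>density lborel (\<lambda>y. \<integral>\<^sup>+x. indicator S x * kibble_density \<alpha> r x y \<partial>lborel))" .
  qed auto
  have "emeasure Q {\<omega> \<in> space Q. X \<omega> \<in> S \<and> Y \<omega> \<in> T} = emeasure (distr (density Q (\<lambda>\<omega>. indicator S (X \<omega>))) borel Y) T"
  proof -
    have "emeasure (distr (density Q (\<lambda>\<omega>. indicator S (X \<omega>))) borel Y) T =
      (\<integral>\<^sup>+\<omega>. indicator S (X \<omega>) * indicator (Y -` T \<inter> space Q) \<omega> \<partial>Q)"
      by (subst emeasure_distr, simp, simp, subst emeasure_density) auto
    also have "\<dots> = (\<integral>\<^sup>+\<omega>. indicator {\<omega> \<in> space Q. X \<omega> \<in> S \<and> Y \<omega> \<in> T} \<omega> \<partial>Q)"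
      by (intro nn_integral_cong) (auto simp: indicator_def)
    also have "\<dots> = emeasure Q {\<omega> \<in> space Q. X \<omega> \<in> S \<and> Y \<omega> \<in> T}"
      by (rule nn_integral_indicator) measurable
    finally show ?thesis ..
  qed
  also have "\<dots> = (\<integral>\<^sup>+y. (\<integral>\<^sup>+x. indicator S x * kibble_density \<alpha> r x y \<partial>lborel) * indicator T y \<partial>lborel)"
    unfolding second by (subst emeasure_density) auto
  finally show ?thesis .
qed

text \<open>Bounds the ratio of Kibble's density to the product of its marginals when both arguments
  are in \<open>(0, L]\<close>. It tends to 1 when \<open>r\<close> and \<open>r * L^2\<close> tend
  to 0, and a limit of exactly 1 is what the second moment method requires.\<close>

definition kibble_bound :: "real \<Rightarrow> real \<Rightarrow> real \<Rightarrow> real" where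
  "kibble_bound \<alpha> r L = (1 - r) powr (- \<alpha>) * (1 + (exp (r * L\<^sup>2 / (1 - r)\<^sup>2) - 1) / \<alpha>)"

text \<open>Termwise, \<open>x ^ m \<le> L ^ m\<close> and
  \<open>exp (- x / (1 - r)) \<le> exp (- x)\<close>. The normalising constants of the two gamma
  densities bring in two Pochhammer factors; one cancels against \<open>kibble_coeff\<close>, the
  other is at least \<open>\<alpha>\<close> for \<open>m \<ge> 1\<close>, and an exponential series
  in \<open>r * L^2 / (1 - r)^2\<close> remains.\<close>

lemma kibble_density_le:
  assumes "0 < \<alpha>" "0 \<le> r" "r < 1" "0 < x" "x \<le> L" "0 < y" "y \<le> L"
  shows "kibble_density \<alpha> r x y \<le> ennreal (kibble_bound \<alpha> r L * gamma_density \<alpha> x * gamma_density \<alpha> y)"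
proof -
  let ?\<rho> = "1 - r"
  let ?q = "r * L\<^sup>2 / ?\<rho>\<^sup>2"
  have \<rho>: "0 < ?\<rho>" using assms by simp
  have L: "0 < L" using assms by simp
  have q: "0 \<le> ?q" using assms by simp
  have G: "0 < Gamma \<alpha>" "0 < pochhammer \<alpha> m" for m using Gamma_real_pos assms(1) by (auto intro: pochhammer_pos)
  have Gm: "Gamma (\<alpha> + real m) = Gamma \<alpha> * pochhammer \<alpha> m" for m
  proof -
    have "pochhammer \<alpha> m = Gamma (\<alpha> + of_nat m) / Gamma \<alpha>"
      by (rule pochhammer_Gamma) (use assms(1) in \<open>auto elim!: nonpos_Ints_cases\<close>)
    then show ?thesis using G(1) by simp
  qed
  have g: "scaled_gamma_density ?\<rho> (\<alpha> + real m) x \<le> gamma_density \<alpha> x * (?\<rho> powr (- \<alpha>) * (L / ?\<rho>) ^ m / pochhammer \<alpha> m)"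
    if x: "0 < x" "x \<le> L" for m x
  proof -
    have "exp (- (x / ?\<rho>)) \<le> exp (- x)" using x assms by (simp add: field_simps)
    moreover have "x ^ m \<le> L ^ m" using x by (intro power_mono) auto
    ultimately have "x powr (\<alpha> - 1) * x ^ m * exp (- (x / ?\<rho>)) \<le> x powr (\<alpha> - 1) * L ^ m * exp (- x)"
      using x by (intro mult_mono) auto
    then have "(x powr (\<alpha> - 1) * x ^ m * exp (- (x / ?\<rho>))) * (?\<rho> powr (- \<alpha>) / ?\<rho> ^ m / (Gamma \<alpha> * pochhammer \<alpha> m)) \<le>
      (x powr (\<alpha> - 1) * L ^ m * exp (- x)) * (?\<rho> powr (- \<alpha>) / ?\<rho> ^ m / (Gamma \<alpha> * pochhammer \<alpha> m))"
      using \<rho> G(1) G(2)[of m] by (intro mult_right_mono) (auto intro!: divide_nonneg_nonneg mult_nonneg_nonneg)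
    moreover have "scaled_gamma_density ?\<rho> (\<alpha> + real m) x =
      (x powr (\<alpha> - 1) * x ^ m * exp (- (x / ?\<rho>))) * (?\<rho> powr (- \<alpha>) / ?\<rho> ^ m / (Gamma \<alpha> * pochhammer \<alpha> m))"
    proof -
      have E: "(x / ?\<rho>) powr (\<alpha> + real m - 1) / ?\<rho> = x powr (\<alpha> - 1) * x ^ m * (?\<rho> powr (- \<alpha>) / ?\<rho> ^ m)"
      proof -
        have "(x / ?\<rho>) powr (\<alpha> + real m - 1) = (x / ?\<rho>) powr (\<alpha> - 1) * (x / ?\<rho>) powr real m"
          by (simp flip: powr_add add: algebra_simps)
        also have "\<dots> = x powr (\<alpha> - 1) / ?\<rho> powr (\<alpha> - 1) * (x ^ m / ?\<rho> ^ m)"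
          using x \<rho> by (simp add: powr_divide powr_realpow power_divide)
        also have "?\<rho> powr (\<alpha> - 1) = inverse (?\<rho> powr (- \<alpha>)) / ?\<rho>"
          using \<rho> by (simp add: powr_diff powr_minus)
        finally show ?thesis using \<rho> by (simp add: field_simps)
      qed
      have "scaled_gamma_density ?\<rho> (\<alpha> + real m) x =
        ((x / ?\<rho>) powr (\<alpha> + real m - 1) / ?\<rho>) * (exp (- (x / ?\<rho>)) / (Gamma \<alpha> * pochhammer \<alpha> m))"
        using x \<rho> unfolding scaled_gamma_density_def gamma_density_def Gm by simp
      then show ?thesis unfolding E by (simp only: divide_inverse mult_ac)
    qed
    moreover have "gamma_density \<alpha> x * (?\<rho> powr (- \<alpha>) * (L / ?\<rho>) ^ m / pochhammer \<alpha> m) =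
      (x powr (\<alpha> - 1) * L ^ m * exp (- x)) * (?\<rho> powr (- \<alpha>) / ?\<rho> ^ m / (Gamma \<alpha> * pochhammer \<alpha> m))"
      using x unfolding gamma_density_def by (simp add: power_divide mult_ac)
    ultimately show ?thesis by simp
  qed
  let ?D = "gamma_density \<alpha> x * gamma_density \<alpha> y * ?\<rho> powr (- \<alpha>)"
  have D: "0 \<le> ?D" using gamma_density_nonneg[OF assms(1)] by simp
  have ph: "1 / pochhammer \<alpha> m \<le> (if m = 0 then 1 else 1 / \<alpha>)" for m
  proof (cases m)
    case (Suc k)
    have "1 \<le> pochhammer (\<alpha> + 1) k"
      unfolding pochhammer_prod using assms(1) by (intro prod_ge_1) auto
    then have "\<alpha> * 1 \<le> pochhammer \<alpha> m" unfolding Suc pochhammer_rec using assms(1) by (intro mult_left_mono) auto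
    then show ?thesis using Suc assms(1) by (simp add: frac_le)
  qed simp
  \<comment> \<open>An exponential series divided by \<open>\<alpha>\<close>; the extra summand at
    \<open>m = 0\<close> restores the coefficient 1 there.\<close>
  let ?b = "\<lambda>m. (if m = 0 then 1 - 1 / \<alpha> else 0) + ?q ^ m /\<^sub>R fact m * (1 / \<alpha>)"
  have term_le: "kibble_coeff \<alpha> r m * (scaled_gamma_density ?\<rho> (\<alpha> + real m) x * scaled_gamma_density ?\<rho> (\<alpha> + real m) y) \<le> ?D * ?b m" for m
  proof -
    have "kibble_coeff \<alpha> r m * (scaled_gamma_density ?\<rho> (\<alpha> + real m) x * scaled_gamma_density ?\<rho> (\<alpha> + real m) y) \<le>
      kibble_coeff \<alpha> r m * ((gamma_density \<alpha> x * (?\<rho> powr (- \<alpha>) * (L / ?\<rho>) ^ m / pochhammer \<alpha> m)) *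
        (gamma_density \<alpha> y * (?\<rho> powr (- \<alpha>) * (L / ?\<rho>) ^ m / pochhammer \<alpha> m)))"
      using assms \<rho> G L gamma_density_nonneg[OF assms(1)]
      by (intro mult_left_mono mult_mono g kibble_coeff_nonneg)
         (auto intro!: scaled_gamma_density_nonneg mult_nonneg_nonneg divide_nonneg_nonneg less_imp_le[OF G(2)])
    also have "\<dots> = ?D * (?q ^ m / fact m * (1 / pochhammer \<alpha> m))"
    proof -
      have "?\<rho> powr \<alpha> * ?\<rho> powr (- \<alpha>) = 1" using \<rho> by (simp flip: powr_add)
      moreover have "r ^ m * ((L / ?\<rho>) ^ m * (L / ?\<rho>) ^ m) = ?q ^ m"
        by (simp add: power_mult_distrib[symmetric] power2_eq_square)
      moreover have "kibble_coeff \<alpha> r m * ((gamma_density \<alpha> x * (?\<rho> powr (- \<alpha>) * (L / ?\<rho>) ^ m / pochhammer \<alpha> m)) *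
        (gamma_density \<alpha> y * (?\<rho> powr (- \<alpha>) * (L / ?\<rho>) ^ m / pochhammer \<alpha> m))) =
        ?D * ((?\<rho> powr \<alpha> * ?\<rho> powr (- \<alpha>)) * (r ^ m * ((L / ?\<rho>) ^ m * (L / ?\<rho>) ^ m)) / fact m * (1 / pochhammer \<alpha> m))"
        unfolding kibble_coeff_def using G(2)[of m] by (simp add: field_simps)
      ultimately show ?thesis by simp
    qed
    also have "\<dots> \<le> ?D * (?q ^ m / fact m * (if m = 0 then 1 else 1 / \<alpha>))"
      using D q ph by (intro mult_left_mono) auto
    also have "\<dots> = ?D * ?b m" by (simp add: divide_inverse mult.commute)
    finally show ?thesis .
  qed
  have "(\<lambda>m. ?D * ?b m) sums (?D * ((1 - 1 / \<alpha>) + exp ?q * (1 / \<alpha>)))"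
    by (intro sums_mult sums_add sums_mult2 exp_converges sums_If_finite[of "\<lambda>m. m = 0" "\<lambda>_. 1 - 1 / \<alpha>", simplified])
  moreover have D_eq: "?D * ((1 - 1 / \<alpha>) + exp ?q * (1 / \<alpha>)) = kibble_bound \<alpha> r L * gamma_density \<alpha> x * gamma_density \<alpha> y"
    unfolding kibble_bound_def using assms(1) by (simp add: field_simps)
  moreover have b0: "0 \<le> ?D * ?b m" for m
  proof (rule order_trans[OF _ term_le])
    show "0 \<le> kibble_coeff \<alpha> r m * (scaled_gamma_density ?\<rho> (\<alpha> + real m) x * scaled_gamma_density ?\<rho> (\<alpha> + real m) y)"
      using assms \<rho> by (intro mult_nonneg_nonneg kibble_coeff_nonneg scaled_gamma_density_nonneg) auto
  qed
  ultimately have "(\<Sum>m. ennreal (?D * ?b m)) = ennreal (kibble_bound \<alpha> r L * gamma_density \<alpha> x * gamma_density \<alpha> y)"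
    by (intro suminf_ennreal_eq) (simp_all only: D_eq)
  moreover have "kibble_density \<alpha> r x y \<le> (\<Sum>m. ennreal (?D * ?b m))"
    unfolding kibble_density_def
  proof (rule suminf_le)
    fix m
    have "ennreal (kibble_coeff \<alpha> r m) * (ennreal (scaled_gamma_density ?\<rho> (\<alpha> + real m) x) * ennreal (scaled_gamma_density ?\<rho> (\<alpha> + real m) y))
      = ennreal (kibble_coeff \<alpha> r m * (scaled_gamma_density ?\<rho> (\<alpha> + real m) x * scaled_gamma_density ?\<rho> (\<alpha> + real m) y))"
      using assms \<rho> by (simp add: ennreal_mult kibble_coeff_nonneg scaled_gamma_density_nonneg)
    also have "\<dots> \<le> ennreal (?D * ?b m)" using term_le by (rule ennreal_leI)
    finally show "ennreal (kibble_coeff \<alpha> r m) * (ennreal (scaled_gamma_density ?\<rho> (\<alpha> + real m) x) * ennreal (scaled_gamma_density ?\<rho> (\<alpha> + real m) y)) \<le> ennreal (?D * ?b m)" .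
  qed auto
  ultimately show ?thesis by simp
qed

text \<open>The window is bounded above because the density ratio is controlled only up to the level
  \<open>L\<close>.\<close>

definition gamma_prob :: "real \<Rightarrow> real \<Rightarrow> real \<Rightarrow> real" where
  "gamma_prob \<alpha> u L = measure (density lborel (\<lambda>x. ennreal (gamma_density \<alpha> x))) {u<..<L}"

lemma emeasure_gamma_density:
  assumes "0 < \<alpha>"
  shows "(\<integral>\<^sup>+x. ennreal (gamma_density \<alpha> x) * indicator {u<..<L} x \<partial>lborel) = ennreal (gamma_prob \<alpha> u L)"
proof -
  have "finite_measure (density lborel (\<lambda>x. ennreal (gamma_density \<alpha> x)))"
    using nn_integral_gamma_density[OF assms, of 0]
    by (intro finite_measureI) (simp add: emeasure_density)
  then have "emeasure (density lborel (\<lambda>x. ennreal (gamma_density \<alpha> x))) {u<..<L} = ennreal (gamma_prob \<alpha> u L)"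
    unfolding gamma_prob_def by (rule finite_measure.emeasure_eq_measure)
  then show ?thesis by (subst (asm) emeasure_density) auto
qed

lemma prob_gamma:
  assumes "prob_space Q" "0 < \<alpha>" and X[measurable]: "X \<in> borel_measurable Q"
    and "\<And>\<omega>. \<omega> \<in> space Q \<Longrightarrow> 0 \<le> X \<omega>"
    and LT: "\<And>s. 0 < s \<Longrightarrow> (\<integral>\<omega>. exp (- (s * X \<omega>)) \<partial>Q) = (1 + s) powr (- \<alpha>)"
  shows "measure Q {\<omega> \<in> space Q. X \<omega> \<in> {u<..<L}} = gamma_prob \<alpha> u L"
proof -
  have "measure Q {\<omega> \<in> space Q. X \<omega> \<in> {u<..<L}} = measure (distr Q borel X) {u<..<L}"
    by (subst measure_distr) (auto intro!: arg_cong[of _ _ "measure Q"])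
  moreover have "distr Q borel X = density lborel (\<lambda>x. ennreal (gamma_density \<alpha> x))"
    by (rule distr_eq_gamma_density[OF assms(1,2)]) (use assms in auto)
  ultimately show ?thesis unfolding gamma_prob_def by simp
qed

lemma prob_kibble_le:
  assumes "prob_space Q" "0 < \<alpha>" "0 \<le> r" "r < 1"
    and XY: "X \<in> borel_measurable Q" "Y \<in> borel_measurable Q"
      "\<And>\<omega>. \<omega> \<in> space Q \<Longrightarrow> 0 \<le> X \<omega>" "\<And>\<omega>. \<omega> \<in> space Q \<Longrightarrow> 0 \<le> Y \<omega>"
    and LT: "\<And>s t. 0 < s \<Longrightarrow> 0 < t \<Longrightarrow> (\<integral>\<omega>. exp (- (s * X \<omega>)) * exp (- (t * Y \<omega>)) \<partial>Q) = (1 + s + t + (1 - r) * s * t) powr (- \<alpha>)"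
    and "0 \<le> u"
  shows "measure Q {\<omega> \<in> space Q. X \<omega> \<in> {u<..<L} \<and> Y \<omega> \<in> {u<..<L}} \<le> kibble_bound \<alpha> r L * (gamma_prob \<alpha> u L)\<^sup>2"
proof -
  interpret prob_space Q by fact
  have kb: "0 \<le> kibble_bound \<alpha> r L"
    unfolding kibble_bound_def using assms by (intro mult_nonneg_nonneg add_nonneg_nonneg divide_nonneg_nonneg) auto
  have gp: "0 \<le> gamma_prob \<alpha> u L" unfolding gamma_prob_def by simp
  let ?I = "indicator {u<..<L} :: real \<Rightarrow> ennreal"
  let ?g = "\<lambda>x. ennreal (gamma_density \<alpha> x)"
  have "emeasure Q {\<omega> \<in> space Q. X \<omega> \<in> {u<..<L} \<and> Y \<omega> \<in> {u<..<L}} =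
    (\<integral>\<^sup>+y. (\<integral>\<^sup>+x. ?I x * kibble_density \<alpha> r x y \<partial>lborel) * ?I y \<partial>lborel)"
    by (rule emeasure_eq_kibble_density[OF assms(1-4) XY LT]) auto
  also have "\<dots> = (\<integral>\<^sup>+y. (\<integral>\<^sup>+x. ?I x * ?I y * kibble_density \<alpha> r x y \<partial>lborel) \<partial>lborel)"
    by (intro nn_integral_cong) (auto simp: indicator_def)
  also have "\<dots> \<le> (\<integral>\<^sup>+y. (\<integral>\<^sup>+x. (ennreal (kibble_bound \<alpha> r L) * (?g y * ?I y)) * (?g x * ?I x) \<partial>lborel) \<partial>lborel)"
  proof (intro nn_integral_mono)
    fix x y :: real
    show "?I x * ?I y * kibble_density \<alpha> r x y \<le> (ennreal (kibble_bound \<alpha> r L) * (?g y * ?I y)) * (?g x * ?I x)"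
    proof (cases "x \<in> {u<..<L} \<and> y \<in> {u<..<L}")
      case True
      then have "kibble_density \<alpha> r x y \<le> ennreal (kibble_bound \<alpha> r L * gamma_density \<alpha> x * gamma_density \<alpha> y)"
        using assms by (intro kibble_density_le) auto
      then show ?thesis using True kb gamma_density_nonneg[OF assms(2)] by (simp add: ennreal_mult mult_ac)
    qed (auto simp: indicator_def)
  qed
  also have "\<dots> = (\<integral>\<^sup>+y. (ennreal (kibble_bound \<alpha> r L) * ennreal (gamma_prob \<alpha> u L)) * (?g y * ?I y) \<partial>lborel)"
    by (subst nn_integral_cmult) (auto simp: emeasure_gamma_density[OF assms(2)] mult_ac)
  also have "\<dots> = ennreal (kibble_bound \<alpha> r L) * ennreal (gamma_prob \<alpha> u L) * ennreal (gamma_prob \<alpha> u L)"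
    by (subst nn_integral_cmult) (auto simp: emeasure_gamma_density[OF assms(2)])
  also have "\<dots> = ennreal (kibble_bound \<alpha> r L * (gamma_prob \<alpha> u L)\<^sup>2)"
    using kb gp by (simp add: ennreal_mult power2_eq_square mult.assoc)
  finally show ?thesis
    using kb by (simp add: emeasure_eq_measure)
qed

text \<open>For \<open>x \<ge> 1\<close> one has \<open>x powr (\<alpha> - 1) \<ge> 1 / x\<close>,
  which treats all \<open>\<alpha> > 0\<close> at once. The factor lost is of the order of a power
  of \<open>u\<close>, hence logarithmic in the block length.\<close>

lemma gamma_prob_ge:
  assumes "0 < \<alpha>" "1 \<le> u"
  shows "exp (- (u + 1)) / ((u + 1) * Gamma \<alpha>) \<le> gamma_prob \<alpha> u (u + 1)"
proof -
  let ?c = "exp (- (u + 1)) / ((u + 1) * Gamma \<alpha>)"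
  have G: "0 < Gamma \<alpha>" using Gamma_real_pos assms(1) .
  have c0: "0 \<le> ?c" using assms G by simp
  have "ennreal ?c = (\<integral>\<^sup>+x. ennreal ?c * indicator {u<..<u+1} x \<partial>lborel)"
    by (subst nn_integral_cmult_indicator) auto
  also have "\<dots> \<le> (\<integral>\<^sup>+x. ennreal (gamma_density \<alpha> x) * indicator {u<..<u+1} x \<partial>lborel)"
  proof (intro nn_integral_mono)
    fix x :: real
    show "ennreal ?c * indicator {u<..<u+1} x \<le> ennreal (gamma_density \<alpha> x) * indicator {u<..<u+1} x"
    proof (cases "x \<in> {u<..<u+1}")
      case True
      then have x: "1 \<le> x" "x \<le> u + 1" using assms by auto
      have "1 / (u + 1) \<le> 1 / x" using x by (intro divide_left_mono) auto
      also have "1 / x = x powr (-1)" using x by (simp add: powr_minus divide_inverse)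
      also have "\<dots> \<le> x powr (\<alpha> - 1)" using x assms by (intro powr_mono) auto
      finally have "1 / (u + 1) * exp (- (u + 1)) / Gamma \<alpha> \<le> x powr (\<alpha> - 1) * exp (- x) / Gamma \<alpha>"
        using x G by (intro divide_right_mono mult_mono) auto
      then have "?c \<le> gamma_density \<alpha> x" using x by (simp add: gamma_density_def)
      then show ?thesis using True by (simp add: ennreal_leI)
    qed auto
  qed
  also have "\<dots> = ennreal (gamma_prob \<alpha> u (u + 1))" by (rule emeasure_gamma_density[OF assms(1)])
  finally show ?thesis using c0 by (simp add: gamma_prob_def)
qed

text \<open>Chernoff's bound with exponential moment
  \<open>(1 - \<theta>) powr (- \<alpha>)\<close>. The moment is computed from the density, as the
  hypothesis speaks only of decaying exponentials.\<close>

lemma gamma_tail_le: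
  assumes "prob_space Q" "0 < \<alpha>" and X[measurable]: "X \<in> borel_measurable Q"
    and "\<And>\<omega>. \<omega> \<in> space Q \<Longrightarrow> 0 \<le> X \<omega>"
    and LT: "\<And>s. 0 < s \<Longrightarrow> (\<integral>\<omega>. exp (- (s * X \<omega>)) \<partial>Q) = (1 + s) powr (- \<alpha>)"
    and \<theta>: "0 < \<theta>" "\<theta> < 1"
  shows "measure Q {\<omega> \<in> space Q. x < X \<omega>} \<le> (1 - \<theta>) powr (- \<alpha>) * exp (- \<theta> * x)"
proof -
  interpret prob_space Q by fact
  have "emeasure Q {\<omega> \<in> space Q. x < X \<omega>} = emeasure (distr Q borel X) {x<..}"
    by (subst emeasure_distr) (auto intro!: arg_cong[of _ _ "emeasure Q"])
  also have "\<dots> = (\<integral>\<^sup>+y. ennreal (gamma_density \<alpha> y) * indicator {x<..} y \<partial>lborel)"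
  proof -
    have "distr Q borel X = density lborel (\<lambda>x. ennreal (gamma_density \<alpha> x))"
      by (rule distr_eq_gamma_density[OF assms(1,2)]) (use assms in auto)
    then show ?thesis by (simp add: emeasure_density)
  qed
  also have "\<dots> \<le> (\<integral>\<^sup>+y. ennreal (exp (- \<theta> * x)) * (ennreal (exp (- (- \<theta>) * y)) * ennreal (gamma_density \<alpha> y)) \<partial>lborel)"
  proof (intro nn_integral_mono)
    fix y :: real
    show "ennreal (gamma_density \<alpha> y) * indicator {x<..} y \<le> ennreal (exp (- \<theta> * x)) * (ennreal (exp (- (- \<theta>) * y)) * ennreal (gamma_density \<alpha> y))"
    proof (cases "x < y")
      case True
      then have "0 \<le> - \<theta> * x + \<theta> * y" using \<theta> by (simp add: mult_left_mono)
      then have "1 * gamma_density \<alpha> y \<le> exp (- \<theta> * x + \<theta> * y) * gamma_density \<alpha> y"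
        using gamma_density_nonneg[OF assms(2)] by (intro mult_right_mono) (simp_all only: one_le_exp_iff)
      then show ?thesis using True gamma_density_nonneg[OF assms(2)]
        by (simp only: exp_add) (simp add: ennreal_mult[symmetric] mult.assoc ennreal_leI)
    qed simp
  qed
  also have "\<dots> = ennreal (exp (- \<theta> * x)) * ennreal ((1 + - \<theta>) powr (- \<alpha>))"
    using \<theta> assms(2) by (subst nn_integral_cmult) (simp_all only: nn_integral_gamma_density, auto)
  also have "\<dots> = ennreal ((1 - \<theta>) powr (- \<alpha>) * exp (- \<theta> * x))"
    by (simp add: ennreal_mult mult.commute)
  finally show ?thesis by (simp add: emeasure_eq_measure)
qed

section \<open>The second moment method on a block\<close>

text \<open>Chebyshev's argument: if \<open>W\<close> counts the events that occur and
  \<open>m\<close> is its mean, the indicator of \<open>W = 0\<close> is at most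
  \<open>(W / m - 1)^2\<close>.\<close>

lemma (in prob_space) prob_none_le_second_moment:
  assumes S: "\<And>i. i < n \<Longrightarrow> S i \<in> events" and p: "\<And>i. i < n \<Longrightarrow> prob (S i) = p" "0 < p" and "0 < (n::nat)"
    and T: "(\<Sum>i<n. \<Sum>j<n. prob (S i \<inter> S j)) \<le> T"
  shows "prob {\<omega> \<in> space M. \<forall>i<n. \<omega> \<notin> S i} \<le> T / (real n * p)\<^sup>2 - 1"
proof -
  define m where "m = real n * p"
  have m: "0 < m" using assms by (simp add: m_def)
  let ?W = "\<lambda>\<omega>. \<Sum>i<n. indicat_real (S i) \<omega>"
  have ind: "integrable M (indicat_real (S i))" if "i < n" for i
    using S[OF that] by (intro integrable_real_indicator) (auto simp: less_top[symmetric])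
  have ind2: "integrable M (indicat_real (S i \<inter> S j))" if "i < n" "j < n" for i j
    using S that by (intro integrable_real_indicator) (auto simp: less_top[symmetric])
  have W: "integrable M ?W" using ind by (intro Bochner_Integration.integrable_sum) auto
  have W2_eq: "(?W \<omega>)\<^sup>2 = (\<Sum>i<n. \<Sum>j<n. indicat_real (S i \<inter> S j) \<omega>)" for \<omega>
    by (simp add: power2_eq_square sum_product indicator_inter_arith)
  have W2: "integrable M (\<lambda>\<omega>. (?W \<omega>)\<^sup>2)"
    unfolding W2_eq using ind2 by (intro Bochner_Integration.integrable_sum) auto
  have EW: "expectation ?W = m"
    using ind p S by (subst Bochner_Integration.integral_sum) (auto simp: m_def)
  have EW2: "expectation (\<lambda>\<omega>. (?W \<omega>)\<^sup>2) \<le> T"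
  proof -
    have "expectation (\<lambda>\<omega>. (?W \<omega>)\<^sup>2) = (\<Sum>i<n. \<Sum>j<n. expectation (indicat_real (S i \<inter> S j)))"
      unfolding W2_eq using ind2
      by (subst Bochner_Integration.integral_sum) (auto intro!: Bochner_Integration.integrable_sum sum.cong)
    also have "\<dots> = (\<Sum>i<n. \<Sum>j<n. prob (S i \<inter> S j))"
      using S by (intro sum.cong refl) auto
    finally show ?thesis using T by simp
  qed
  define A where "A = {\<omega> \<in> space M. \<forall>i<n. \<omega> \<notin> S i}"
  have A: "A \<in> events"
  proof -
    have "A = space M - (\<Union>i\<in>{..<n}. S i)" by (auto simp: A_def)
    also have "\<dots> \<in> events" using S by (intro sets.Diff sets.finite_UN) auto
    finally show ?thesis .
  qed
  have sq: "(?W \<omega> / m - 1)\<^sup>2 = (?W \<omega>)\<^sup>2 / m\<^sup>2 - 2 / m * ?W \<omega> + 1" for \<omega>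
    by (simp add: power2_diff power_divide)
  have "prob A = expectation (indicat_real A)" using A by simp
  also have "\<dots> \<le> expectation (\<lambda>\<omega>. (?W \<omega>)\<^sup>2 / m\<^sup>2 - 2 / m * ?W \<omega> + 1)"
  proof (rule integral_mono)
    show "integrable M (indicat_real A)" using A by (intro integrable_real_indicator) (auto simp: less_top[symmetric])
    show "integrable M (\<lambda>\<omega>. (?W \<omega>)\<^sup>2 / m\<^sup>2 - 2 / m * ?W \<omega> + 1)" using W W2 by simp
    show "indicat_real A \<omega> \<le> (?W \<omega>)\<^sup>2 / m\<^sup>2 - 2 / m * ?W \<omega> + 1" for \<omega>
    proof (cases "\<omega> \<in> A")
      case True
      then have "?W \<omega> = 0" by (intro sum.neutral) (auto simp: A_def)
      then show ?thesis by (simp add: indicator_def)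
    next
      case False
      then show ?thesis unfolding sq[symmetric] by simp
    qed
  qed
  also have "\<dots> = expectation (\<lambda>\<omega>. (?W \<omega>)\<^sup>2) / m\<^sup>2 - 1"
    using W W2 m by (simp add: EW prob_space del: Bochner_Integration.integral_sum)
  also have "\<dots> \<le> T / m\<^sup>2 - 1" using EW2 by (simp add: divide_right_mono)
  finally show ?thesis unfolding m_def A_def .
qed

lemma kibble_bound_mono:
  assumes "0 < \<alpha>" "0 \<le> r" "r \<le> r'" "r' < 1"
  shows "kibble_bound \<alpha> r L \<le> kibble_bound \<alpha> r' L"
proof -
  have "(1 - r) powr (- \<alpha>) \<le> (1 - r') powr (- \<alpha>)" using assms by (intro powr_mono2') auto
  moreover have "r * L\<^sup>2 / (1 - r)\<^sup>2 \<le> r' * L\<^sup>2 / (1 - r')\<^sup>2"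
    using assms by (intro frac_le mult_right_mono power_mono) auto
  then have "1 + (exp (r * L\<^sup>2 / (1 - r)\<^sup>2) - 1) / \<alpha> \<le> 1 + (exp (r' * L\<^sup>2 / (1 - r')\<^sup>2) - 1) / \<alpha>"
    using assms by (simp add: divide_right_mono)
  moreover have "0 \<le> 1 + (exp (r * L\<^sup>2 / (1 - r)\<^sup>2) - 1) / \<alpha>"
    using assms by (intro add_nonneg_nonneg divide_nonneg_nonneg) auto
  ultimately show ?thesis unfolding kibble_bound_def by (intro mult_mono) auto
qed

context inverse_M_matrix
begin

text \<open>The two terms are the two sources of variance. Pairs with
  \<open>R i j * R j i \<le> \<eta>\<close> are compared with independent ones. Any other pair has
  \<open>R i j * C \<ge> \<eta>\<close>, and as the rows of \<open>R\<close> sum to at most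
  \<open>1 / \<tau>\<close>, each index has at most \<open>C / (\<tau> * \<eta>)\<close> such
  partners; these and the diagonal pairs are divided by the expected count.\<close>

theorem prob_all_less_block:
  fixes Q :: "'b measure" and Z :: "nat \<Rightarrow> 'b \<Rightarrow> real"
  assumes Q: "prob_space Q" and \<alpha>: "0 < \<alpha>" and n: "0 < n" and \<tau>: "0 < \<tau>"
    and Z: "\<And>i. i < n \<Longrightarrow> Z i \<in> borel_measurable Q" "\<And>i \<omega>. i < n \<Longrightarrow> \<omega> \<in> space Q \<Longrightarrow> 0 \<le> Z i \<omega>"
    and LT: "\<And>s. (\<And>i. i < n \<Longrightarrow> 0 < s i) \<Longrightarrow> (\<integral>\<omega>. exp (- (\<Sum>i<n. s i * Z i \<omega>)) \<partial>Q) = laplace_det s powr (- \<alpha>)"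
    and c: "0 < c" "\<And>i. i < n \<Longrightarrow> c \<le> resolvent (\<lambda>_. \<tau>) i i"
    and C: "\<And>i j. i < n \<Longrightarrow> j < n \<Longrightarrow> K i j \<le> C"
    and \<eta>: "0 < \<eta>" "\<eta> / c\<^sup>2 < 1" and u: "0 < u"
    and p: "0 < gamma_prob \<alpha> u L"
    and \<theta>: "\<And>i. i < n \<Longrightarrow> 0 < \<theta> i \<and> \<theta> i \<le> u * resolvent (\<lambda>_. \<tau>) i i"
  shows "measure Q {\<omega> \<in> space Q. \<forall>i<n. Z i \<omega> < \<theta> i} \<le>
    (kibble_bound \<alpha> (\<eta> / c\<^sup>2) L - 1) + (C / (\<tau> * \<eta>) + 1) / (real n * gamma_prob \<alpha> u L)"
proof -
  interpret Q: prob_space Q by fact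
  have [measurable]: "i < n \<Longrightarrow> Z i \<in> borel_measurable Q" for i by (rule Z)
  let ?\<tau> = "\<lambda>_::nat. \<tau>"
  have nn: "nonneg ?\<tau>" using \<tau> by (simp add: nonneg_def)
  define R where "R = resolvent ?\<tau>"
  have R0: "0 \<le> R i j" if "i < n" "j < n" for i j unfolding R_def by (rule resolvent_nonneg[OF nn that])
  have Rc: "c \<le> R i i" "0 < R i i" if "i < n" for i using c that by (auto simp: R_def intro: less_le_trans)
  define D where "D = laplace_det ?\<tau>"
  have D: "1 \<le> D" unfolding D_def by (rule laplace_det_ge_1[OF nn])
  define w where "w = (\<lambda>\<omega>. D powr \<alpha> * exp (- (\<Sum>i<n. \<tau> * Z i \<omega>)))"
  have w[measurable]: "w \<in> borel_measurable Q" unfolding w_def by measurable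
  have w0: "0 \<le> w \<omega>" for \<omega> unfolding w_def by simp
  have wb: "w \<omega> \<le> D powr \<alpha>" if "\<omega> \<in> space Q" for \<omega>
    unfolding w_def using Z(2)[OF _ that] \<tau> by (intro mult_left_le) (auto intro!: sum_nonneg)
  define Q' where "Q' = density Q (\<lambda>\<omega>. ennreal (w \<omega>))"
  have sp: "space Q' = space Q" "sets Q' = sets Q" by (simp_all add: Q'_def)
  \<comment> \<open>Under \<open>Q'\<close> the vector is permanental with kernel \<open>R\<close>
    in place of \<open>K\<close>: passing from \<open>\<tau>\<close> to \<open>\<tau> + s\<close>
    multiplies the determinant by factors built from \<open>R\<close>.\<close>
  have exp_w: "(\<integral>\<omega>. exp (- (\<Sum>i<n. s i * Z i \<omega>)) \<partial>Q') = (laplace_det (\<lambda>i. \<tau> + s i) / D) powr (- \<alpha>)"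
    if "\<And>i. i < n \<Longrightarrow> 0 \<le> s i" for s
  proof -
    have "(\<integral>\<omega>. exp (- (\<Sum>i<n. s i * Z i \<omega>)) \<partial>Q') = (\<integral>\<omega>. w \<omega> *\<^sub>R exp (- (\<Sum>i<n. s i * Z i \<omega>)) \<partial>Q)"
      unfolding Q'_def by (rule integral_density) (auto simp: w0)
    also have "\<dots> = (\<integral>\<omega>. D powr \<alpha> * exp (- (\<Sum>i<n. (\<tau> + s i) * Z i \<omega>)) \<partial>Q)"
      by (simp add: w_def distrib_right sum.distrib exp_diff exp_minus divide_inverse mult.assoc)
    also have "\<dots> = D powr \<alpha> * laplace_det (\<lambda>i. \<tau> + s i) powr (- \<alpha>)"
      using LT[of "\<lambda>i. \<tau> + s i"] that \<tau> by (simp add: add_pos_nonneg)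
    also have "\<dots> = (laplace_det (\<lambda>i. \<tau> + s i) / D) powr (- \<alpha>)"
    proof -
      have "1 \<le> laplace_det (\<lambda>i. \<tau> + s i)" using that \<tau> by (intro laplace_det_ge_1) (auto simp: nonneg_def)
      then show ?thesis using D by (simp add: powr_divide powr_minus field_simps)
    qed
    finally show ?thesis .
  qed
  have "prob_space Q'"
  proof
    have "integrable Q w" by (rule Q.integrable_const_bound[of _ "D powr \<alpha>"]) (use w0 wb in \<open>auto intro!: AE_I2\<close>)
    then have "emeasure Q' (space Q') = ennreal (\<integral>\<omega>. w \<omega> \<partial>Q)"
      unfolding Q'_def by (simp add: emeasure_density w0 nn_integral_eq_integral cong: nn_integral_cong)
    also have "(\<integral>\<omega>. w \<omega> \<partial>Q) = D powr \<alpha> * laplace_det ?\<tau> powr (- \<alpha>)"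
      unfolding w_def using LT[of ?\<tau>] \<tau> by simp
    also have "\<dots> = 1" using D unfolding D_def by (simp add: powr_minus)
    finally show "emeasure Q' (space Q') = 1" by simp
  qed
  interpret Q': prob_space Q' by fact
  \<comment> \<open>After division by \<open>R i i\<close> each coordinate is
    Gamma(\<open>\<alpha>\<close>) under the tilted law, so all events \<open>S i\<close> below have
    the same probability.\<close>
  define Y where "Y = (\<lambda>i \<omega>. Z i \<omega> / R i i)"
  have Y[measurable]: "Y i \<in> borel_measurable Q'" if "i < n" for i
    using Z(1)[OF that] unfolding Y_def measurable_cong_sets[OF sp(2) refl] by measurable
  have Y0: "0 \<le> Y i \<omega>" if "i < n" "\<omega> \<in> space Q'" for i \<omega>
    using Z(2) R0 that by (simp add: Y_def sp)
  have one: "(\<integral>\<omega>. exp (- (s * Y i \<omega>)) \<partial>Q') = (1 + s) powr (- \<alpha>)" if "i < n" "0 < s" for i s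
  proof -
    let ?s = "\<lambda>k. if k = i then s / R i i else 0"
    have "(\<integral>\<omega>. exp (- (s * Y i \<omega>)) \<partial>Q') = (\<integral>\<omega>. exp (- (\<Sum>k<n. ?s k * Z k \<omega>)) \<partial>Q')"
      using that by (simp add: Y_def if_distrib[of "\<lambda>y. y * _"] cong: if_cong)
    also have "\<dots> = (laplace_det (update_at ?\<tau> i (s / R i i)) / D) powr (- \<alpha>)"
      using Rc[OF that(1)] that by (subst exp_w) (auto simp: update_at_def)
    also have "laplace_det (update_at ?\<tau> i (s / R i i)) = D * (1 + s)"
      unfolding laplace_det_update[OF nn that(1)] D_def using Rc[OF that(1)] by (simp add: R_def)
    finally show ?thesis using D by simp
  qed
  have two: "(\<integral>\<omega>. exp (- (s * Y i \<omega>)) * exp (- (t * Y j \<omega>)) \<partial>Q') =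
      (1 + s + t + (1 - R i j * R j i / (R i i * R j j)) * s * t) powr (- \<alpha>)"
    if ij: "i < n" "j < n" "i \<noteq> j" and st: "0 < s" "0 < t" for i j s t
  proof -
    let ?s = "\<lambda>k. (if k = i then s / R i i else 0) + (if k = j then t / R j j else 0)"
    have "exp (- (s * Y i \<omega>)) * exp (- (t * Y j \<omega>)) = exp (- (\<Sum>k<n. ?s k * Z k \<omega>))" for \<omega>
    proof -
      have "(\<Sum>k<n. ?s k * Z k \<omega>) = s * Y i \<omega> + t * Y j \<omega>"
        using ij by (simp add: Y_def distrib_right sum.distrib if_distrib[of "\<lambda>y. y * _"] cong: if_cong)
      then show ?thesis by (simp flip: exp_add)
    qed
    then have "(\<integral>\<omega>. exp (- (s * Y i \<omega>)) * exp (- (t * Y j \<omega>)) \<partial>Q') = (\<integral>\<omega>. exp (- (\<Sum>k<n. ?s k * Z k \<omega>)) \<partial>Q')"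
      by simp
    also have "\<dots> = (laplace_det (update_at (update_at ?\<tau> i (s / R i i)) j (t / R j j)) / D) powr (- \<alpha>)"
      using Rc(2)[OF ij(1)] Rc(2)[OF ij(2)] st by (subst exp_w) (auto simp: update_at_def add.assoc)
    \<comment> \<open>Two rank one updates: the factor for \<open>j\<close> contains the diagonal
      entry of the resolvent already updated at \<open>i\<close>, which brings in
      \<open>R j i * R i j\<close>.\<close>
    also have "laplace_det (update_at (update_at ?\<tau> i (s / R i i)) j (t / R j j)) =
      D * (1 + s) * (1 + t / R j j * (R j j - s / R i i * R j i * R i j / (1 + s)))"
    proof -
      have n': "nonneg (update_at ?\<tau> i (s / R i i))" using Rc(2)[OF ij(1)] st by (intro nonneg_update_at nn) auto
      have "s / R i i * R i i = s" using Rc(2)[OF ij(1)] by simp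
      then show ?thesis
        unfolding laplace_det_update[OF n' ij(2)] laplace_det_update[OF nn ij(1)]
        using resolvent_update[OF nn _ ij(1,2,2), of "s / R i i"] Rc(2)[OF ij(1)] st
        by (simp add: D_def R_def)
    qed
    also have "\<dots> = D * (1 + s + t + (1 - R i j * R j i / (R i i * R j j)) * s * t)"
    proof -
      have "(1 + s) * (1 + t / b * (b - s / a * e * d / (1 + s))) = 1 + s + t + (1 - d * e / (a * b)) * s * t"
        if "0 < a" "0 < b" for a b d e :: real
      proof -
        have "v * (1 + t / b * (b - s / a * e * d / v)) = v + t * v - s * t * (d * e / (a * b))" if "0 < v" for v
          using that \<open>0 < a\<close> \<open>0 < b\<close> by (simp add: field_simps)
        from this[of "1 + s"] show ?thesis using st by (simp add: algebra_simps)
      qed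
      from this[OF Rc(2)[OF ij(1)] Rc(2)[OF ij(2)]] show ?thesis by (simp add: mult.assoc)
    qed
    finally show ?thesis using D by simp
  qed
  define q where "q = gamma_prob \<alpha> u L"
  define \<kappa> where "\<kappa> = kibble_bound \<alpha> (\<eta> / c\<^sup>2) L"
  define S where "S = (\<lambda>i. {\<omega> \<in> space Q'. Y i \<omega> \<in> {u<..<L}})"
  have S: "S i \<in> sets Q'" if "i < n" for i
  proof -
    have [measurable]: "Y i \<in> borel_measurable Q'" using Y that .
    show ?thesis unfolding S_def by measurable
  qed
  have S_prob: "measure Q' (S i) = q" if "i < n" for i
    unfolding S_def q_def by (rule prob_gamma[OF \<open>prob_space Q'\<close> \<alpha> Y[OF that] Y0[OF that] one[OF that]])
  have \<kappa>0: "0 \<le> \<kappa>" unfolding \<kappa>_def kibble_bound_def using \<alpha> \<eta> c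
    by (intro mult_nonneg_nonneg add_nonneg_nonneg divide_nonneg_nonneg) auto
  have pair: "measure Q' (S i \<inter> S j) \<le> \<kappa> * q\<^sup>2 + (if i = j then q else 0) + R i j * (C / \<eta> * q)" if ij: "i < n" "j < n" for i j
  proof -
    have C0: "0 \<le> C" using C[OF ij] K_nonneg[OF ij] by simp
    have q0: "0 \<le> q" using p by (simp add: q_def)
    have le_q: "measure Q' (S i \<inter> S j) \<le> q"
      using Q'.finite_measure_mono[of "S i \<inter> S j" "S i"] S[OF ij(1)] S_prob[OF ij(1)] by simp
    have pos: "0 \<le> \<kappa> * q\<^sup>2" "0 \<le> R i j * (C / \<eta> * q)" using \<kappa>0 R0[OF ij] C0 q0 \<eta> by auto
    show ?thesis
    proof (cases "i = j")
      case True then show ?thesis using le_q pos by simp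
    next
      case False
      show ?thesis
      proof (cases "R i j * R j i \<le> \<eta>")
        case True
        let ?r = "R i j * R j i / (R i i * R j j)"
        have "c\<^sup>2 \<le> R i i * R j j" unfolding power2_eq_square using Rc c ij by (intro mult_mono) (auto intro: less_imp_le)
        then have "?r \<le> \<eta> / c\<^sup>2" using True \<eta> c by (intro frac_le) auto
        then have r: "0 \<le> ?r" "?r \<le> \<eta> / c\<^sup>2"
          using R0[OF ij] R0[OF ij(2,1)] R0[OF ij(1,1)] R0[OF ij(2,2)] by simp_all
        have "S i \<inter> S j = {\<omega> \<in> space Q'. Y i \<omega> \<in> {u<..<L} \<and> Y j \<omega> \<in> {u<..<L}}" by (auto simp: S_def)
        also have "measure Q' \<dots> \<le> kibble_bound \<alpha> ?r L * q\<^sup>2"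
          unfolding q_def
          by (rule prob_kibble_le[OF \<open>prob_space Q'\<close> \<alpha> r(1) _ Y[OF ij(1)] Y[OF ij(2)] Y0[OF ij(1)] Y0[OF ij(2)] two[OF ij False]])
             (use r \<eta> u in auto)
        also have "\<dots> \<le> \<kappa> * q\<^sup>2"
          unfolding \<kappa>_def using r \<eta> \<alpha> by (intro mult_right_mono kibble_bound_mono) auto
        finally show ?thesis using pos False by simp
      next
        case False
        have "R j i \<le> C" using resolvent_le_K[OF nn ij(2,1)] C[OF ij(2,1)] by (simp add: R_def)
        then have "\<eta> \<le> R i j * C" using False R0[OF ij] mult_left_mono[of "R j i" C "R i j"] by simp
        then have "1 \<le> R i j * (C / \<eta>)" using \<eta> by (simp add: pos_le_divide_eq)
        then have "1 * q \<le> R i j * (C / \<eta>) * q" using q0 by (intro mult_right_mono)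
        then show ?thesis using le_q pos \<open>i \<noteq> j\<close> by (simp add: mult.assoc)
      qed
    qed
  qed
  have "(\<Sum>i<n. \<Sum>j<n. measure Q' (S i \<inter> S j)) \<le> (\<Sum>i<n. \<Sum>j<n. \<kappa> * q\<^sup>2 + (if i = j then q else 0) + R i j * (C / \<eta> * q))"
    by (intro sum_mono pair) auto
  also have "\<dots> = (\<Sum>i<n. real n * (\<kappa> * q\<^sup>2) + q + (\<Sum>j<n. R i j) * (C / \<eta> * q))"
    by (intro sum.cong refl) (simp only: sum.distrib sum_distrib_right, simp)
  also have "\<dots> \<le> (\<Sum>i<n. real n * (\<kappa> * q\<^sup>2) + q + 1 / \<tau> * (C / \<eta> * q))"
  proof (intro sum_mono add_left_mono mult_right_mono)
    fix i assume "i \<in> {..<n}"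
    then have i: "i < n" by simp
    have "(\<Sum>j<n. R i j) * \<tau> \<le> 1" using resolvent_row_sum[OF nn i] by (simp add: R_def sum_distrib_right)
    then show "(\<Sum>j<n. R i j) \<le> 1 / \<tau>" using \<tau> by (simp add: pos_le_divide_eq)
    have "0 \<le> C" using C[OF i i] K_nonneg[OF i i] by simp
    then show "0 \<le> C / \<eta> * q" using \<eta> p by (simp add: q_def)
  qed
  also have "\<dots> = real n * (real n * (\<kappa> * q\<^sup>2) + q * (C / (\<tau> * \<eta>) + 1))"
    by (simp add: algebra_simps)
  finally have T: "(\<Sum>i<n. \<Sum>j<n. measure Q' (S i \<inter> S j)) \<le> real n * (real n * (\<kappa> * q\<^sup>2) + q * (C / (\<tau> * \<eta>) + 1))" .
  have none: "measure Q' {\<omega> \<in> space Q'. \<forall>i<n. \<omega> \<notin> S i} \<le>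
      real n * (real n * (\<kappa> * q\<^sup>2) + q * (C / (\<tau> * \<eta>) + 1)) / (real n * q)\<^sup>2 - 1"
    by (rule Q'.prob_none_le_second_moment[OF S S_prob _ n T]) (use p in \<open>auto simp: q_def\<close>)
  have "measure Q {\<omega> \<in> space Q. \<forall>i<n. Z i \<omega> < \<theta> i} \<le> laplace_det ?\<tau> powr \<alpha> *
    (\<integral>\<omega>. exp (- (\<Sum>i<n. ?\<tau> i * Z i \<omega>)) * indicator {\<omega> \<in> space Q. \<forall>i<n. Z i \<omega> \<le> \<theta> i} \<omega> \<partial>Q)"
    by (rule prob_all_less_tilted[OF Q \<alpha> nn Z LT]) (use \<theta> in auto)
  also have "\<dots> = (\<integral>\<omega>. w \<omega> *\<^sub>R indicator {\<omega> \<in> space Q. \<forall>i<n. Z i \<omega> \<le> \<theta> i} \<omega> \<partial>Q)"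
    by (simp add: w_def D_def mult.assoc)
  also have "\<dots> = (\<integral>\<omega>. indicator {\<omega> \<in> space Q. \<forall>i<n. Z i \<omega> \<le> \<theta> i} \<omega> \<partial>Q')"
  proof -
    have "{\<omega> \<in> space Q. \<forall>i\<in>{..<n}. Z i \<omega> \<le> \<theta> i} \<in> sets Q"
      by (rule sets.sets_Collect_finite_All; simp)
    then have [measurable]: "{\<omega> \<in> space Q. \<forall>i<n. Z i \<omega> \<le> \<theta> i} \<in> sets Q" by (simp add: Ball_def)
    show ?thesis unfolding Q'_def by (rule integral_density[symmetric]) (auto simp: w0)
  qed
  also have "\<dots> = measure Q' {\<omega> \<in> space Q. \<forall>i<n. Z i \<omega> \<le> \<theta> i}"
    by (simp add: sp)
  also have "\<dots> \<le> measure Q' {\<omega> \<in> space Q'. \<forall>i<n. \<omega> \<notin> S i}"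
  proof (rule Q'.finite_measure_mono)
    have e: "{\<omega> \<in> space Q'. \<forall>i<n. \<omega> \<notin> S i} = space Q' - (\<Union>i\<in>{..<n}. S i)" by auto
    show "{\<omega> \<in> space Q'. \<forall>i<n. \<omega> \<notin> S i} \<in> sets Q'"
      unfolding e using S by (intro sets.Diff sets.finite_UN) auto
    \<comment> \<open>An index with \<open>Y i\<close> in the window has
      \<open>Z i > u * R i i \<ge> \<theta> i\<close>.\<close>
    show "{\<omega> \<in> space Q. \<forall>i<n. Z i \<omega> \<le> \<theta> i} \<subseteq> {\<omega> \<in> space Q'. \<forall>i<n. \<omega> \<notin> S i}"
    proof safe
      fix \<omega> i assume \<omega>: "\<omega> \<in> space Q" "\<forall>i<n. Z i \<omega> \<le> \<theta> i" "i < n" "\<omega> \<in> S i"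
      then have "Z i \<omega> \<le> u * R i i" using \<theta>[of i] by (force simp: R_def)
      then have "Y i \<omega> \<le> u" unfolding Y_def using Rc(2)[OF \<open>i < n\<close>] by (simp add: pos_divide_le_eq)
      then show False using \<omega>(4) by (simp add: S_def)
    qed (simp add: sp)
  qed
  also note none
  also have "real n * (real n * (\<kappa> * q\<^sup>2) + q * (C / (\<tau> * \<eta>) + 1)) / (real n * q)\<^sup>2 - 1 =
    (\<kappa> - 1) + (C / (\<tau> * \<eta>) + 1) / (real n * q)"
  proof -
    have "x * (x * (\<kappa> * q\<^sup>2) + q * a) / (x * q)\<^sup>2 - 1 = (\<kappa> - 1) + a / (x * q)" if "0 < x" for x a :: real
      using that p unfolding q_def[symmetric] by (simp add: field_simps power2_eq_square)
    from this[of "real n" "C / (\<tau> * \<eta>) + 1"] show ?thesis using n by simp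
  qed
  finally show ?thesis unfolding q_def \<kappa>_def .
qed

end

section \<open>Potential theory\<close>

text \<open>\<open>p h\<close> is the transition matrix \<open>P_h\<close> and \<open>V h\<close>
  the potential up to time \<open>h\<close>. The role of a generator is played by
  \<open>(1 - P_h) U = V h\<close> together with \<open>V h / h\<close> tending to the identity.
  State 0 is a dummy that allows sums over all naturals; \<open>p h j 0 = 0\<close> removes it. The
  vanishing of the columns of \<open>U\<close> at infinity confines negative minima to finite
  sets.\<close>

locale symmetric_potential =
  fixes p :: "real \<Rightarrow> nat \<Rightarrow> nat \<Rightarrow> real" and U :: "nat \<Rightarrow> nat \<Rightarrow> real" and V :: "real \<Rightarrow> nat \<Rightarrow> nat \<Rightarrow> real"
  assumes p_nonneg: "\<And>h j i. 0 < h \<Longrightarrow> 1 \<le> j \<Longrightarrow> 0 \<le> p h j i"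
    and p_zero: "\<And>h j. 0 < h \<Longrightarrow> 1 \<le> j \<Longrightarrow> p h j 0 = 0"
    and p_sum: "\<And>h j. 0 < h \<Longrightarrow> 1 \<le> j \<Longrightarrow> \<exists>t\<le>1. p h j sums t"
    and U_nonneg: "\<And>j k. 0 \<le> U j k"
    and U_sym: "\<And>j k. 1 \<le> j \<Longrightarrow> 1 \<le> k \<Longrightarrow> U j k = U k j"
    and U_eq: "\<And>h j k. 0 < h \<Longrightarrow> 1 \<le> j \<Longrightarrow> 1 \<le> k \<Longrightarrow> (\<lambda>i. p h j i * U i k) sums (U j k - V h j k)"
    and V_lim: "\<And>j k. 1 \<le> j \<Longrightarrow> 1 \<le> k \<Longrightarrow> ((\<lambda>h. V h j k / h) \<longlongrightarrow> (if j = k then 1 else 0)) (at_right 0)"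
    and U_vanish: "\<And>k. 1 \<le> k \<Longrightarrow> (\<lambda>j. U j k) \<longlonglongrightarrow> 0"
begin

definition superharmonic :: "(nat \<Rightarrow> real) \<Rightarrow> bool" where
  "superharmonic f \<longleftrightarrow> (\<forall>j\<ge>1. 0 \<le> f j) \<and> (\<forall>h>0. \<forall>j\<ge>1. \<exists>s\<le>f j. (\<lambda>i. p h j i * f i) sums s)"

definition pot :: "nat set \<Rightarrow> (nat \<Rightarrow> real) \<Rightarrow> nat \<Rightarrow> real" where
  "pot B x j = (\<Sum>k\<in>B. U j k * x k)"

lemma superharmonic_0: "superharmonic (\<lambda>_. 0)"
  unfolding superharmonic_def by auto

lemma superharmonic_1: "superharmonic (\<lambda>_. 1)"
  unfolding superharmonic_def using p_sum by auto

lemma pot_sums: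
  assumes "finite B" "B \<subseteq> {1..}" "0 < h" "1 \<le> j"
  shows "(\<lambda>i. p h j i * pot B x i) sums (pot B x j - (\<Sum>k\<in>B. V h j k * x k))"
proof -
  have "(\<lambda>i. \<Sum>k\<in>B. p h j i * U i k * x k) sums (\<Sum>k\<in>B. (U j k - V h j k) * x k)"
    using assms by (intro sums_sum sums_mult2 U_eq) auto
  then show ?thesis unfolding pot_def
    by (simp add: sum_distrib_left left_diff_distrib sum_subtractf mult.assoc)
qed

lemma V_sum_lim:
  assumes "finite B" "B \<subseteq> {1..}" "1 \<le> j"
  shows "((\<lambda>h. (\<Sum>k\<in>B. V h j k * x k) / h) \<longlongrightarrow> (if j \<in> B then x j else 0)) (at_right 0)"
proof -
  have "((\<lambda>h. \<Sum>k\<in>B. V h j k / h * x k) \<longlongrightarrow> (\<Sum>k\<in>B. (if j = k then 1 else 0) * x k)) (at_right 0)"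
    using assms by (intro tendsto_sum tendsto_mult tendsto_const V_lim) auto
  moreover have "(\<Sum>k\<in>B. (if j = k then 1 else 0) * x k) = (if j \<in> B then x j else 0)"
    using assms(1) by (simp add: if_distrib[of "\<lambda>y. y * _"] cong: if_cong)
  ultimately show ?thesis by (simp add: sum_divide_distrib)
qed

text \<open>Recovers the sign of a charge from its potential: \<open>V h x\<close> is
  \<open>(1 - P_h) U x\<close>, and after division by \<open>h\<close> it tends to
  \<open>x j\<close> on \<open>B\<close>.\<close>

lemma V_sum_nonneg_imp:
  assumes "finite B" "B \<subseteq> {1..}" "1 \<le> j" "\<And>h. 0 < h \<Longrightarrow> 0 \<le> (\<Sum>k\<in>B. V h j k * x k)"
  shows "0 \<le> (if j \<in> B then x j else 0)"
proof (rule tendsto_lowerbound[OF V_sum_lim[OF assms(1-3)]])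
  show "\<forall>\<^sub>F h in at_right 0. 0 \<le> (\<Sum>k\<in>B. V h j k * x k) / h"
    using eventually_at_right_less[of 0] by eventually_elim (use assms(4) in auto)
qed simp

text \<open>
  At a negative minimum of \<open>f - U x\<close> the generator has the wrong sign; adding a small multiple of the potential of
  the indicator of the finite set where \<open>f - U x\<close> is close to its minimum makes this strict.
\<close>

lemma domination_principle:
  assumes B: "finite B" "B \<subseteq> {1..}" and f: "superharmonic f"
    and le: "\<And>j. j \<in> B \<Longrightarrow> 0 < x j \<Longrightarrow> pot B x j \<le> f j" and "1 \<le> j"
  shows "pot B x j \<le> f j"
proof (rule ccontr)
  assume "\<not> pot B x j \<le> f j"
  define y where "y = (\<lambda>i. f i - pot B x i)"
  define m where "m = - y j"
  have m: "0 < m" using \<open>\<not> pot B x j \<le> f j\<close> by (simp add: m_def y_def)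
  have "(\<lambda>i. pot B x i) \<longlonglongrightarrow> (\<Sum>k\<in>B. 0 * x k)"
    unfolding pot_def using B by (intro tendsto_sum tendsto_mult tendsto_const U_vanish) auto
  then have "\<forall>\<^sub>F i in sequentially. pot B x i < m / 2"
    using m by (intro order_tendstoD(2)) auto
  then obtain M where M: "\<And>i. M \<le> i \<Longrightarrow> pot B x i < m / 2"
    by (auto simp: eventually_sequentially)
  \<comment> \<open>Finite, since \<open>f\<close> is nonnegative and the potential is below
    \<open>m / 2\<close> far out.\<close>
  define G where "G = {i. 1 \<le> i \<and> y i < - (m / 2)}"
  have "G \<subseteq> {..<M}"
  proof
    fix i assume i: "i \<in> G"
    then have "0 \<le> f i" using f by (auto simp: G_def superharmonic_def)
    then have "m / 2 < pot B x i" using i by (simp add: G_def y_def)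
    then show "i \<in> {..<M}" using M[of i] by (cases "M \<le> i") auto
  qed
  then have G: "finite G" "G \<subseteq> {1..}" by (auto simp: G_def intro: finite_subset)
  define \<rho> where "\<rho> = (\<lambda>_::nat. 1::real)"
  have pos: "0 \<le> pot G \<rho> i" for i unfolding pot_def \<rho>_def using U_nonneg by (auto intro: sum_nonneg)
  \<comment> \<open>Small enough for the perturbation at \<open>j\<close> to stay below
    \<open>m / 2\<close>, so that \<open>z j\<close> remains below \<open>- m / 2\<close>.\<close>
  define \<epsilon> where "\<epsilon> = m / (2 * (1 + pot G \<rho> j))"
  have \<epsilon>: "0 < \<epsilon>" using m pos[of j] by (simp add: \<epsilon>_def)
  define z where "z = (\<lambda>i. y i + \<epsilon> * pot G \<rho> i)"
  have zj: "z j < - (m / 2)"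
  proof -
    have "\<epsilon> * pot G \<rho> j < \<epsilon> * (1 + pot G \<rho> j)" using \<epsilon> by simp
    also have "\<dots> = m / 2" unfolding \<epsilon>_def using pos[of j] by (simp add: field_simps)
    finally show ?thesis unfolding z_def m_def by simp
  qed
  have zy: "y i \<le> z i" for i unfolding z_def using \<epsilon> pos[of i] by simp
  have jG: "j \<in> G" using zj zy[of j] assms(5) by (simp add: G_def)
  obtain j0 where j0: "j0 \<in> G" "\<And>i. i \<in> G \<Longrightarrow> z j0 \<le> z i"
    using arg_min_if_finite(1)[OF G(1), of z] arg_min_least[OF G(1), of _ z] jG by blast
  have z0: "z j0 < 0" using j0(2)[OF jG] zj m by simp
  \<comment> \<open>Outside \<open>G\<close> the values are at least \<open>- m / 2\<close>, hence
    above \<open>z j\<close>; the minimum over \<open>G\<close> is therefore global.\<close>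
  have zmin: "z j0 \<le> z i" if "1 \<le> i" for i
  proof (cases "i \<in> G")
    case False
    then have "- (m / 2) \<le> y i" using that by (auto simp: G_def)
    then show ?thesis using zy[of i] j0(2)[OF jG] zj by linarith
  qed (rule j0)
  have j01: "1 \<le> j0" using j0(1) by (simp add: G_def)
  have V: "\<epsilon> * (\<Sum>k\<in>G. V h j0 k * \<rho> k) \<le> (\<Sum>k\<in>B. V h j0 k * x k)" if h: "0 < h" for h
  proof -
    obtain s where s: "s \<le> f j0" "(\<lambda>i. p h j0 i * f i) sums s"
      using f h j01 unfolding superharmonic_def by blast
    obtain t where t: "t \<le> 1" "p h j0 sums t" using p_sum[OF h j01] by auto
    have "(\<lambda>i. p h j0 i * f i - p h j0 i * pot B x i + \<epsilon> * (p h j0 i * pot G \<rho> i)) sums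
      (s - (pot B x j0 - (\<Sum>k\<in>B. V h j0 k * x k)) + \<epsilon> * (pot G \<rho> j0 - (\<Sum>k\<in>G. V h j0 k * \<rho> k)))"
      using s B G h j01 by (intro sums_add sums_diff sums_mult pot_sums) auto
    then have 1: "(\<lambda>i. p h j0 i * z i) sums
      (s - (pot B x j0 - (\<Sum>k\<in>B. V h j0 k * x k)) + \<epsilon> * (pot G \<rho> j0 - (\<Sum>k\<in>G. V h j0 k * \<rho> k)))"
      unfolding z_def y_def by (simp add: algebra_simps)
    have 2: "(\<lambda>i. p h j0 i * z j0) sums (t * z j0)" by (rule sums_mult2[OF t(2)])
    have "t * z j0 \<le> s - (pot B x j0 - (\<Sum>k\<in>B. V h j0 k * x k)) + \<epsilon> * (pot G \<rho> j0 - (\<Sum>k\<in>G. V h j0 k * \<rho> k))"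
    proof (rule sums_le[OF _ 2 1])
      show "p h j0 i * z j0 \<le> p h j0 i * z i" for i
        using p_zero[OF h j01] p_nonneg[OF h j01, of i] zmin[of i] by (cases "i = 0") (auto intro: mult_left_mono)
    qed
    \<comment> \<open>Loss of mass can only raise a negative value.\<close>
    moreover have "z j0 \<le> t * z j0"
      using t(1) z0 mult_right_mono_neg[of t 1 "z j0"] by simp
    ultimately show ?thesis using s(1) unfolding z_def y_def by (simp add: algebra_simps)
  qed
  \<comment> \<open>As \<open>h\<close> tends to 0 the inequality for \<open>V\<close> becomes
    \<open>\<epsilon> \<le> x j0\<close> with \<open>j0 \<in> B\<close>, and then the hypothesis on
    positive charges contradicts \<open>z j0 < 0\<close>.\<close>
  have "\<epsilon> * (if j0 \<in> G then \<rho> j0 else 0) \<le> (if j0 \<in> B then x j0 else 0)"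
  proof (rule tendsto_le[OF _ V_sum_lim[OF B j01] tendsto_mult[OF tendsto_const V_sum_lim[OF G j01]]])
    show "\<forall>\<^sub>F h in at_right 0. \<epsilon> * ((\<Sum>k\<in>G. V h j0 k * \<rho> k) / h) \<le> (\<Sum>k\<in>B. V h j0 k * x k) / h"
      using eventually_at_right_less[of 0]
    proof eventually_elim
      case (elim h)
      then show ?case using V[OF elim] by (simp add: divide_right_mono)
    qed
  qed simp
  then have "j0 \<in> B" "0 < x j0" using j0(1) \<epsilon> by (auto simp: \<rho>_def split: if_splits)
  then have "0 \<le> y j0" using le by (simp add: y_def)
  then show False using z0 zy[of j0] by simp
qed

text \<open>Domination by the zero function, for \<open>x\<close> and for \<open>- x\<close>,
  spreads the vanishing from \<open>B\<close> to all states, whence \<open>V h x = 0\<close> on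
  \<open>B\<close> for every \<open>h\<close>. This makes each finite block of \<open>U\<close>
  invertible.\<close>

lemma pot_eq_0_imp:
  assumes B: "finite B" "B \<subseteq> {1..}" and "\<And>j. j \<in> B \<Longrightarrow> pot B x j = 0" and "k \<in> B"
  shows "x k = 0"
proof -
  have k: "1 \<le> k" using assms by auto
  have neg: "pot B (\<lambda>i. - x i) j = - pot B x j" for j by (simp add: pot_def sum_negf)
  have zero: "pot B x j = 0" if "1 \<le> j" for j
    using domination_principle[OF B superharmonic_0, of x j] domination_principle[OF B superharmonic_0, of "\<lambda>i. - x i" j]
      assms(3) that unfolding neg by force
  have "(\<Sum>l\<in>B. V h k l * x l) = 0" if h: "0 < h" for h
  proof -
    have "(\<lambda>i. p h k i * pot B x i) = (\<lambda>_. 0)"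
    proof
      show "p h k i * pot B x i = 0" for i
        using p_zero[OF h k] zero[of i] by (cases "i = 0") auto
    qed
    with pot_sums[OF B h k, of x] have "(\<lambda>_. 0) sums (pot B x k - (\<Sum>l\<in>B. V h k l * x l))" by simp
    then have "pot B x k - (\<Sum>l\<in>B. V h k l * x l) = 0" using sums_unique2[OF _ sums_zero] by blast
    then show ?thesis using zero[OF k] by simp
  qed
  then have "0 \<le> x k" "0 \<le> - x k"
    using V_sum_nonneg_imp[OF B k, of x] V_sum_nonneg_imp[OF B k, of "\<lambda>i. - x i"] assms(4)
    by (simp_all add: sum_negf)
  then show ?thesis by simp
qed

text \<open>The charge \<open>x\<close> is a column of the inverse of a block. By domination its
  potential is nonnegative everywhere, and it vanishes at \<open>k\<close>, so
  \<open>V h x = - P_h (U x) \<le> 0\<close> there.\<close>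

lemma equilibrium_off_support:
  assumes B: "finite B" "B \<subseteq> {1..}" and "\<And>j. j \<in> B \<Longrightarrow> pot B x j = (if j = l then 1 else 0)" and "k \<in> B" "k \<noteq> l"
  shows "x k \<le> 0"
proof -
  have k: "1 \<le> k" using assms by auto
  have neg: "pot B (\<lambda>i. - x i) j = - pot B x j" for j by (simp add: pot_def sum_negf)
  have nonneg: "0 \<le> pot B x j" if "1 \<le> j" for j
    using domination_principle[OF B superharmonic_0, of "\<lambda>i. - x i" j] assms(3) that unfolding neg by force
  have "0 \<le> (\<Sum>l\<in>B. V h k l * (- x l))" if h: "0 < h" for h
  proof -
    have "0 \<le> pot B x k - (\<Sum>l\<in>B. V h k l * x l)"
    proof (rule sums_le[OF _ sums_zero pot_sums[OF B h k]])
      show "0 \<le> p h k i * pot B x i" for i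
        using p_zero[OF h k] p_nonneg[OF h k, of i] nonneg[of i] by (cases "i = 0") auto
    qed
    then show ?thesis using assms(3)[OF assms(4)] assms(5) by (simp add: sum_negf)
  qed
  from V_sum_nonneg_imp[OF B k this] show ?thesis using assms(4) by simp
qed

text \<open>By domination the potential lies below \<open>f\<close> and touches it at
  \<open>k\<close>, so \<open>P_h (U x) \<le> P_h f \<le> f = U x\<close> at \<open>k\<close>.
  Applied to the constant 1 and to \<open>f\<close>, this gives the signs of the two vectors in the
  rank one correction.\<close>

lemma balayage_nonneg:
  assumes B: "finite B" "B \<subseteq> {1..}" and f: "superharmonic f" and eq: "\<And>j. j \<in> B \<Longrightarrow> pot B x j = f j" and "k \<in> B"
  shows "0 \<le> x k"
proof -
  have k: "1 \<le> k" using assms by auto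
  have le: "pot B x j \<le> f j" if "1 \<le> j" for j
    using domination_principle[OF B f, of x j] eq that by simp
  have "0 \<le> (\<Sum>l\<in>B. V h k l * x l)" if h: "0 < h" for h
  proof -
    obtain s where s: "s \<le> f k" "(\<lambda>i. p h k i * f i) sums s"
      using f h k unfolding superharmonic_def by blast
    have "pot B x k - (\<Sum>l\<in>B. V h k l * x l) \<le> s"
    proof (rule sums_le[OF _ pot_sums[OF B h k] s(2)])
      show "p h k i * pot B x i \<le> p h k i * f i" for i
        using p_zero[OF h k] p_nonneg[OF h k, of i] le[of i] by (cases "i = 0") (auto intro: mult_left_mono)
    qed
    then show ?thesis using s(1) eq[OF assms(5)] by simp
  qed
  from V_sum_nonneg_imp[OF B k this] show ?thesis using assms(5) by simp
qed

text \<open>With \<open>a\<close> the inverse of the block of \<open>U\<close>, the inverse of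
  \<open>U + 1 f^T\<close> is \<open>a - (a 1) (f^T a) / (1 + f^T a 1)\<close>. Both vectors are
  nonnegative, so the off-diagonal entries only decrease, while the row sums become
  \<open>b i / (1 + s)\<close>.\<close>

theorem inverse_M_matrix_exists:
  assumes f: "superharmonic f" and N: "1 \<le> N"
  shows "\<exists>A. inverse_M_matrix n (\<lambda>i j. U (N + i) (N + j) + f (N + j)) A"
proof -
  define B where "B = {N..<N + n}"
  have B: "finite B" "B \<subseteq> {1..}" using N by (auto simp: B_def)
  let ?u = "\<lambda>i j. U (N + i) (N + j)"
  let ?f = "\<lambda>i. f (N + i)"
  have pot_B: "pot B (\<lambda>k. x (k - N)) (N + i) = (\<Sum>j<n. ?u i j * x j)" for x i
    unfolding pot_def B_def
    by (rule sum.reindex_bij_witness[of _ "\<lambda>j. N + j" "\<lambda>k. k - N"]) auto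
  have inB: "j \<in> B \<Longrightarrow> \<exists>i<n. j = N + i" for j unfolding B_def by (auto intro!: exI[of _ "j - N"])
  let ?M = "Matrix.mat n n (\<lambda>(i, j). ?u i j)"
  have M: "?M \<in> carrier_mat n n" by simp
  have det: "Determinant.det ?M \<noteq> 0"
  proof
    assume "Determinant.det ?M = 0"
    then obtain v where v: "v \<in> carrier_vec n" "v \<noteq> 0\<^sub>v n" "?M *\<^sub>v v = 0\<^sub>v n"
      using det_0_iff_vec_prod_zero_field[OF M] by auto
    have "(\<Sum>j<n. ?u i j * vec_index v j) = 0" if "i < n" for i
    proof -
      have "vec_index (?M *\<^sub>v v) i = 0" using v(3) that by simp
      then show ?thesis using that v(1) by (simp add: scalar_prod_def atLeast0LessThan)
    qed
    then have "pot B (\<lambda>k. vec_index v (k - N)) j = 0" if "j \<in> B" for j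
      using inB[OF that] pot_B[of "vec_index v"] by auto
    from pot_eq_0_imp[OF B this] have z: "vec_index v (k - N) = 0" if "k \<in> B" for k using that by blast
    have "vec_index v i = 0" if "i < n" for i using z[of "N + i"] that by (simp add: B_def)
    then have "v = 0\<^sub>v n" using v(1) by (intro eq_vecI) auto
    then show False using v(2) by simp
  qed
  define a where "a = (\<lambda>i j. adj_mat ?M $$ (i, j) / Determinant.det ?M)"
  have adj: "adj_mat ?M \<in> carrier_mat n n" "?M * adj_mat ?M = Determinant.det ?M \<cdot>\<^sub>m 1\<^sub>m n"
     "adj_mat ?M * ?M = Determinant.det ?M \<cdot>\<^sub>m 1\<^sub>m n"
    using adj_mat[OF M] by auto
  have UA: "(\<Sum>j<n. ?u i j * a j k) = (if i = k then 1 else 0)" if "i < n" "k < n" for i k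
  proof -
    have "(?M * adj_mat ?M) $$ (i, k) = Determinant.det ?M * (if i = k then 1 else 0)"
      unfolding adj(2) using that by simp
    then have "(\<Sum>j<n. ?u i j * adj_mat ?M $$ (j, k)) = Determinant.det ?M * (if i = k then 1 else 0)"
      using that adj(1) by (simp add: scalar_prod_def atLeast0LessThan)
    then show ?thesis unfolding a_def using det by (simp add: sum_divide_distrib[symmetric])
  qed
  have AU: "(\<Sum>j<n. a i j * ?u j k) = (if i = k then 1 else 0)" if "i < n" "k < n" for i k
  proof -
    have "(adj_mat ?M * ?M) $$ (i, k) = Determinant.det ?M * (if i = k then 1 else 0)"
      unfolding adj(3) using that by simp
    then have "(\<Sum>j<n. adj_mat ?M $$ (i, j) * ?u j k) = Determinant.det ?M * (if i = k then 1 else 0)"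
      using that adj(1) by (simp add: scalar_prod_def atLeast0LessThan)
    then show ?thesis unfolding a_def using det by (simp add: sum_divide_distrib[symmetric])
  qed
  \<comment> \<open>Symmetry of \<open>a\<close> lets \<open>c = a f\<close> serve as the row vector
    \<open>f^T a\<close> of the correction.\<close>
  have sym: "a i k = a k i" if "i < n" "k < n" for i k
  proof -
    have "a i k = (\<Sum>j<n. a i j * (if k = j then 1 else 0))"
      using that by (simp add: if_distrib[of "\<lambda>y. _ * y"] cong: if_cong)
    also have "\<dots> = (\<Sum>j<n. a i j * (\<Sum>l<n. a k l * ?u l j))"
      using that by (intro sum.cong) (auto simp: AU)
    also have "\<dots> = (\<Sum>j<n. \<Sum>l<n. a i j * ?u j l * a k l)"
      unfolding sum_distrib_left
      by (intro sum.cong refl) (use N in \<open>simp add: U_sym mult.commute mult.left_commute\<close>)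
    also have "\<dots> = (\<Sum>l<n. (\<Sum>j<n. a i j * ?u j l) * a k l)"
      by (subst sum.swap) (simp add: sum_distrib_right)
    also have "\<dots> = (\<Sum>l<n. (if i = l then 1 else 0) * a k l)"
      using that by (intro sum.cong) (auto simp: AU)
    also have "\<dots> = a k i" using that by (simp add: if_distrib[of "\<lambda>y. y * _"] cong: if_cong)
    finally show ?thesis .
  qed
  have solve: "pot B (\<lambda>k. (\<Sum>r<n. a (k - N) r * g r)) (N + i) = g i" if "i < n" for g i
  proof -
    have "pot B (\<lambda>k. (\<Sum>r<n. a (k - N) r * g r)) (N + i) = (\<Sum>j<n. ?u i j * (\<Sum>r<n. a j r * g r))"
      using pot_B[of "\<lambda>k. (\<Sum>r<n. a k r * g r)" i] .
    also have "\<dots> = (\<Sum>r<n. (\<Sum>j<n. ?u i j * a j r) * g r)"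
      unfolding sum_distrib_left sum_distrib_right by (subst sum.swap) (simp add: mult.assoc)
    also have "\<dots> = (\<Sum>r<n. (if i = r then 1 else 0) * g r)"
      using that by (intro sum.cong) (auto simp: UA)
    also have "\<dots> = g i" using that by (simp add: if_distrib[of "\<lambda>y. y * _"] cong: if_cong)
    finally show ?thesis .
  qed
  have a_off: "a i k \<le> 0" if "i < n" "k < n" "i \<noteq> k" for i k
  proof -
    let ?x = "\<lambda>j. a (j - N) k"
    have "pot B ?x j = (if j = N + k then 1 else 0)" if j: "j \<in> B" for j
      using inB[OF j] pot_B[of "\<lambda>q. a q k"] UA \<open>k < n\<close> by auto
    from equilibrium_off_support[OF B this, of "N + i"] show ?thesis using that by (simp add: B_def)
  qed
  define b where "b = (\<lambda>i. \<Sum>r<n. a i r)"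
  define c where "c = (\<lambda>i. \<Sum>r<n. a i r * ?f r)"
  have b_nonneg: "0 \<le> b i" if "i < n" for i
  proof -
    have "pot B (\<lambda>k. (\<Sum>r<n. a (k - N) r * 1)) j = 1" if "j \<in> B" for j
      using inB[OF that] solve[of _ "\<lambda>_. 1"] by auto
    from balayage_nonneg[OF B superharmonic_1 this, of "N + i"] show ?thesis
      using that by (simp add: B_def b_def)
  qed
  have c_nonneg: "0 \<le> c i" if "i < n" for i
  proof -
    have "pot B (\<lambda>k. (\<Sum>r<n. a (k - N) r * ?f r)) j = f j" if "j \<in> B" for j
      using inB[OF that] solve[of _ ?f] by auto
    from balayage_nonneg[OF B f this, of "N + i"] show ?thesis
      using that by (simp add: B_def c_def)
  qed
  define s where "s = (\<Sum>i<n. c i)"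
  have s: "0 \<le> s" unfolding s_def using c_nonneg by (auto intro: sum_nonneg)
  have cU: "(\<Sum>j<n. c j * ?u j k) = ?f k" if "k < n" for k
  proof -
    have "(\<Sum>j<n. c j * ?u j k) = (\<Sum>r<n. ?f r * (\<Sum>j<n. a r j * ?u j k))"
      unfolding c_def sum_distrib_left sum_distrib_right
      by (subst sum.swap, intro sum.cong refl) (simp add: sym mult_ac)
    also have "\<dots> = (\<Sum>r<n. ?f r * (if r = k then 1 else 0))"
      using that by (intro sum.cong) (auto simp: AU)
    also have "\<dots> = ?f k" using that by (simp add: if_distrib[of "\<lambda>y. _ * y"] cong: if_cong)
    finally show ?thesis .
  qed
  \<comment> \<open>Sherman-Morrison for the rank one perturbation \<open>1 f\<^sup>T\<close> of the block of \<open>U\<close>\<close>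
  have "inverse_M_matrix n (\<lambda>i j. U (N + i) (N + j) + f (N + j)) (\<lambda>i j. a i j - b i * c j / (1 + s))"
  proof
    show "0 \<le> U (N + i) (N + j) + f (N + j)" for i j
      using U_nonneg f N by (auto simp: superharmonic_def intro: add_nonneg_nonneg)
    show "a i j - b i * c j / (1 + s) \<le> 0" if "i < n" "j < n" "i \<noteq> j" for i j
    proof -
      have "0 \<le> b i * c j / (1 + s)" using b_nonneg[OF that(1)] c_nonneg[OF that(2)] s by simp
      then show ?thesis using a_off[OF that] by simp
    qed
    show "0 \<le> (\<Sum>j<n. a i j - b i * c j / (1 + s))" if "i < n" for i
    proof -
      have "(\<Sum>j<n. a i j - b i * c j / (1 + s)) = b i - b i * s / (1 + s)"
        by (simp add: sum_subtractf b_def s_def sum_distrib_left sum_divide_distrib)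
      also have "\<dots> = b i / (1 + s)" using s by (simp add: field_simps)
      finally show ?thesis using b_nonneg[OF that] s by simp
    qed
    show "(\<Sum>j<n. (a i j - b i * c j / (1 + s)) * (U (N + j) (N + k) + f (N + k))) = (if i = k then 1 else 0)"
      if "i < n" "k < n" for i k
    proof -
      have "(\<Sum>j<n. (a i j - b i * c j / (1 + s)) * (U (N + j) (N + k) + f (N + k))) =
        (\<Sum>j<n. a i j * ?u j k) + (\<Sum>j<n. a i j) * ?f k
          - b i / (1 + s) * ((\<Sum>j<n. c j * ?u j k) + (\<Sum>j<n. c j) * ?f k)"
        unfolding sum_distrib_left sum_distrib_right sum.distrib[symmetric] sum_subtractf[symmetric] 
        by (intro sum.cong refl) (simp add: algebra_simps)
      also have "\<dots> = (if i = k then 1 else 0) + b i * ?f k - b i / (1 + s) * (?f k + s * ?f k)"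
        unfolding AU[OF that] cU[OF that(2)] b_def[symmetric] s_def[symmetric] by (simp add: b_def)
      also have "b i / (1 + s) * (?f k + s * ?f k) = b i * ?f k"
        using s by (simp add: field_simps)
      finally show ?thesis by simp
    qed
  qed
  then show ?thesis by blast
qed

end

section \<open>The potential of a symmetric transient process\<close>

lemma filterlim_ennreal_at_right:
  assumes "0 \<le> t"
  shows "filterlim ennreal (at_right (ennreal t)) (at_right t)"
proof (subst filterlim_at, intro conjI)
  have "((\<lambda>s. ennreal s) \<longlongrightarrow> ennreal t) (at_right t)"
    by (intro tendsto_ennrealI tendsto_ident_at)
  then show "(ennreal \<longlongrightarrow> ennreal t) (at_right t)" .
  show "\<forall>\<^sub>F s in at_right t. ennreal s \<in> {ennreal t<..} \<and> ennreal s \<noteq> ennreal t"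
    using eventually_at_right_less[of t]
    by eventually_elim (use assms in \<open>auto simp: ennreal_less_iff\<close>)
qed

locale symmetric_transient_process = borel_right_process M F "{1..}" X P
  for M :: "'w measure" and F :: "ennreal \<Rightarrow> 'w measure" and X :: "ennreal \<Rightarrow> 'w \<Rightarrow> nat option" and P +
  assumes symmetric: "symmetric_process {1..} X P"
    and transient: "transient_process {1..} X P"
begin

definition p :: "real \<Rightarrow> nat \<Rightarrow> nat \<Rightarrow> real" where
  "p t j k = transition_function P X (ennreal t) j k"

lemma space_P: "1 \<le> j \<Longrightarrow> space (P j) = space M"
  using sets_eq_imp_space_eq[OF sets_P] by simp

lemma X_measurable: "1 \<le> j \<Longrightarrow> X t \<in> measurable (P j) (count_space (insert None (Some ` {1..})))"
  using measurable_from_subalg[OF subalgebra_F adapted] measurable_cong_sets[OF sets_P refl] by auto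

lemma X_range: "\<omega> \<in> space M \<Longrightarrow> X t \<omega> \<noteq> Some 0"
  using measurable_space[OF measurable_from_subalg[OF subalgebra_F adapted], of \<omega> t] by auto

lemma X_sets [measurable]: "1 \<le> j \<Longrightarrow> {\<omega> \<in> space (P j). X t \<omega> = Some k} \<in> sets (P j)"
proof (cases "k = 0")
  case True
  assume "1 \<le> j"
  then have e: "{\<omega> \<in> space (P j). X t \<omega> = Some k} = {}" using X_range True by (auto simp: space_P)
  show ?thesis unfolding e by simp
next
  case False
  assume j: "1 \<le> j"
  have "X t -` {Some k} \<inter> space (P j) \<in> sets (P j)"
    by (rule measurable_sets[OF X_measurable[OF j]]) (use False in auto)
  moreover have "X t -` {Some k} \<inter> space (P j) = {\<omega> \<in> space (P j). X t \<omega> = Some k}" by auto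
  ultimately show ?thesis by simp
qed

lemma p_eq: "p t j k = measure (P j) {\<omega> \<in> space (P j). X (ennreal t) \<omega> = Some k}"
  unfolding p_def transition_function_def ..

lemma p_nonneg: "0 \<le> p t j k"
  unfolding p_eq by simp

lemma p_zero: "1 \<le> j \<Longrightarrow> p t j 0 = 0"
proof -
  assume "1 \<le> j"
  then have e: "{\<omega> \<in> space (P j). X (ennreal t) \<omega> = Some 0} = {}" using X_range by (auto simp: space_P)
  show ?thesis unfolding p_eq e by simp
qed

lemma p_sym: "1 \<le> j \<Longrightarrow> 1 \<le> k \<Longrightarrow> p t j k = p t k j"
  using symmetric unfolding symmetric_process_def p_def by simp

lemma p_sum: assumes "1 \<le> j" shows "\<exists>s\<le>1. p t j sums s"
proof -
  interpret prob_space "P j" using prob_space_P assms by simp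
  have "(\<lambda>i. measure (P j) {\<omega> \<in> space (P j). X (ennreal t) \<omega> = Some i}) sums
    measure (P j) (\<Union>i. {\<omega> \<in> space (P j). X (ennreal t) \<omega> = Some i})"
    by (rule finite_measure_UNION) (use X_sets[OF assms] in \<open>auto simp: disjoint_family_on_def\<close>)
  then have "p t j sums measure (P j) (\<Union>i. {\<omega> \<in> space (P j). X (ennreal t) \<omega> = Some i})"
    unfolding p_eq[abs_def] .
  then show ?thesis using prob_le_1 by blast
qed

lemma p_right_continuous:
  assumes "0 \<le> t" "1 \<le> j"
  shows "((\<lambda>s. p s j k) \<longlongrightarrow> p t j k) (at_right t)"
  unfolding tendsto_at_iff_sequentially
proof (intro allI impI)
  fix u :: "nat \<Rightarrow> real" assume u: "\<forall>i. u i \<in> {t<..} - {t}" "u \<longlonglongrightarrow> t"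
  interpret prob_space "P j" using prob_space_P assms by simp
  have ut: "filterlim u (at_right t) sequentially"
    using u by (intro tendsto_imp_filterlim_at_right) auto
  let ?A = "\<lambda>s. {\<omega> \<in> space (P j). X (ennreal s) \<omega> = Some k}"
  have "(\<lambda>n. \<integral>\<omega>. indicat_real (?A (u n)) \<omega> \<partial>P j) \<longlonglongrightarrow> (\<integral>\<omega>. indicat_real (?A t) \<omega> \<partial>P j)"
  proof (rule integral_dominated_convergence[where w = "\<lambda>_. 1"])
    show "AE \<omega> in P j. (\<lambda>n. indicat_real (?A (u n)) \<omega>) \<longlonglongrightarrow> indicat_real (?A t) \<omega>"
    proof (rule AE_I2)
      fix \<omega> assume \<omega>: "\<omega> \<in> space (P j)"
      have "\<forall>\<^sub>F s in at_right (ennreal t). X s \<omega> = X (ennreal t) \<omega>"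
        using \<omega> assms space_P by (intro right_continuous_X) auto
      then have "\<forall>\<^sub>F s in at_right t. X (ennreal s) \<omega> = X (ennreal t) \<omega>"
        using filterlim_ennreal_at_right[OF assms(1)] by (rule eventually_compose_filterlim)
      then have "\<forall>\<^sub>F n in sequentially. X (ennreal (u n)) \<omega> = X (ennreal t) \<omega>"
        using ut by (rule eventually_compose_filterlim)
      then show "(\<lambda>n. indicat_real (?A (u n)) \<omega>) \<longlonglongrightarrow> indicat_real (?A t) \<omega>"
        by (intro tendsto_eventually, eventually_elim) (auto simp: indicator_def)
    qed
    show "AE \<omega> in P j. norm (indicat_real (?A (u n)) \<omega>) \<le> 1" for n by (simp add: indicator_def)
  qed (use X_sets[OF assms(2)] in auto)
  then show "((\<lambda>s. p s j k) \<circ> u) \<longlonglongrightarrow> p t j k"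
    unfolding p_eq comp_def by (simp add: X_sets[OF assms(2)])
qed

lemma p_initial:
  assumes "1 \<le> j"
  shows "p 0 j k = (if j = k then 1 else 0)"
proof -
  interpret prob_space "P j" using prob_space_P assms by simp
  have i: "AE \<omega> in P j. X 0 \<omega> = Some j" using initial assms by simp
  show ?thesis
  proof (cases "j = k")
    case True
    have "AE \<omega> in P j. \<omega> \<in> {\<omega> \<in> space (P j). X 0 \<omega> = Some k}"
      using i AE_space by eventually_elim (use True in auto)
    then show ?thesis using True X_sets[OF assms, of 0 k] prob_eq_1 unfolding p_eq by simp
  next
    case False
    have "AE \<omega> in P j. \<omega> \<notin> {\<omega> \<in> space (P j). X 0 \<omega> = Some k}"
      using i by eventually_elim (use False in auto)
    then show ?thesis using False X_sets[OF assms, of 0 k] prob_eq_0 unfolding p_eq by simp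
  qed
qed

text \<open>A right continuous function is the limit of step functions that look at a grid point
  strictly to the right of \<open>t\<close>; hence the floor plus one.\<close>

lemma p_measurable:
  assumes "1 \<le> j"
  shows "(\<lambda>t. indicator {0..} t * p t j k) \<in> borel_measurable borel"
proof (rule borel_measurable_LIMSEQ_real)
  fix t :: real
  show "(\<lambda>n. indicator {0..} t * p ((real_of_int \<lfloor>real (Suc n) * t\<rfloor> + 1) / real (Suc n)) j k) \<longlonglongrightarrow> indicator {0..} t * p t j k"
  proof (cases "0 \<le> t")
    case True
    let ?u = "\<lambda>n. (real_of_int \<lfloor>real (Suc n) * t\<rfloor> + 1) / real (Suc n)"
    have gt: "t < ?u n" for n
    proof -
      have "real (Suc n) * t < real_of_int \<lfloor>real (Suc n) * t\<rfloor> + 1" by linarith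
      then show ?thesis by (simp add: pos_less_divide_eq mult.commute)
    qed
    have le: "?u n \<le> t + 1 / real (Suc n)" for n
    proof -
      have "?u n \<le> (real (Suc n) * t + 1) / real (Suc n)" by (intro divide_right_mono) auto
      also have "\<dots> = t + 1 / real (Suc n)" by (simp add: add_divide_distrib)
      finally show ?thesis .
    qed
    have l: "(\<lambda>n. t + 1 / real (Suc n)) \<longlonglongrightarrow> t" by real_asymp
    have "?u \<longlonglongrightarrow> t"
      by (rule tendsto_sandwich[OF _ _ tendsto_const l]; rule always_eventually; intro allI less_imp_le gt le)
    then have "filterlim ?u (at_right t) sequentially"
      by (rule tendsto_imp_filterlim_at_right) (rule always_eventually, rule allI, rule gt)
    from filterlim_compose[OF p_right_continuous[OF True assms, of k] this] show ?thesis
      by (intro tendsto_mult tendsto_const)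
  qed simp
next
  fix n
  have "(\<lambda>t. (\<lambda>i::int. p ((real_of_int i + 1) / real (Suc n)) j k) \<lfloor>real (Suc n) * t\<rfloor>) \<in> borel_measurable borel"
    by (rule measurable_compose[of _ _ "count_space UNIV"]) simp_all
  then show "(\<lambda>t. indicator {0..} t * p ((real_of_int \<lfloor>real (Suc n) * t\<rfloor> + 1) / real (Suc n)) j k) \<in> borel_measurable borel"
    by (intro borel_measurable_times) simp_all
qed

section \<open>Semigroup property and splitting of the potential\<close>

lemma chapman_kolmogorov:
  assumes "0 \<le> h" "0 \<le> t" "1 \<le> j" "1 \<le> k"
  shows "ennreal (p (t + h) j k) = (\<Sum>i. ennreal (p h j i) * ennreal (p t i k))"
proof -
  interpret prob_space "P j" using prob_space_P assms by simp
  let ?T = "\<lambda>_::'w. ennreal h"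
  let ?G = "pre_sigma ?T"
  have st: "stopping_time F ?T" by (rule stopping_time_const)
  have "subalgebra (P j) ?G"
    unfolding subalgebra_def
  proof (intro conjI subsetI)
    show "space ?G = space (P j)" using space_P assms by (simp add: space_pre_sigma)
    fix A assume "A \<in> sets ?G"
    from sets_pre_sigmaD[OF st this, of \<top>] have "A \<in> sets (F \<top>)" by simp
    then show "A \<in> sets (P j)" using subalgebra_F[of \<top>] sets_P[of j] assms by (auto simp: subalgebra_def)
  qed
  then interpret finite_measure_subalgebra "P j" ?G
    by unfold_locales
  let ?f = "\<lambda>\<omega>. if X (ennreal h + ennreal t) \<omega> = Some k then 1 else (0::real)"
  let ?g = "\<lambda>\<omega>. case X (ennreal h) \<omega> of None \<Rightarrow> 0 | Some i \<Rightarrow> p t i k"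
  have eq: "AE \<omega> in P j. real_cond_exp (P j) ?G ?f \<omega> = ?g \<omega>"
    unfolding p_def by (rule strong_Markov[OF st]) (use assms in auto)
  have X1: "1 \<le> j" by fact
  have f_ind: "\<omega> \<in> space (P j) \<Longrightarrow> ?f \<omega> = indicator {\<omega> \<in> space (P j). X (ennreal (t + h)) \<omega> = Some k} \<omega>" for \<omega>
    using assms by (simp add: indicator_def ennreal_plus[symmetric] add.commute del: ennreal_plus)
  have int: "integrable (P j) ?f"
    by (subst Bochner_Integration.integrable_cong[OF refl f_ind])
       (use X_sets[OF X1] in \<open>auto intro!: integrable_real_indicator simp: less_top[symmetric]\<close>)
  have g_sum: "ennreal (?g \<omega>) = (\<Sum>i. ennreal (p t i k) * indicator {\<omega> \<in> space (P j). X (ennreal h) \<omega> = Some i} \<omega>)"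
    if "\<omega> \<in> space (P j)" for \<omega>
  proof (cases "X (ennreal h) \<omega>")
    case (Some i)
    have "(\<Sum>l. ennreal (p t l k) * indicator {\<omega> \<in> space (P j). X (ennreal h) \<omega> = Some l} \<omega>) =
      (\<Sum>l\<in>{i}. ennreal (p t l k) * indicator {\<omega> \<in> space (P j). X (ennreal h) \<omega> = Some l} \<omega>)"
      by (rule suminf_finite) (use Some in auto)
    then show ?thesis using Some that by simp
  qed simp
  have g_meas: "(\<lambda>\<omega>. \<Sum>i. ennreal (p t i k) * indicator {\<omega> \<in> space (P j). X (ennreal h) \<omega> = Some i} \<omega>) \<in> borel_measurable (P j)"
    using X_sets[OF X1] by measurable
  have "p (t + h) j k = (\<integral>\<omega>. ?f \<omega> \<partial>P j)"
    unfolding p_eq by (subst Bochner_Integration.integral_cong[OF refl f_ind]) (use X_sets[OF X1] in auto)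
  also have "\<dots> = (\<integral>\<omega>. real_cond_exp (P j) ?G ?f \<omega> \<partial>P j)"
    using real_cond_exp_int(2)[OF int] by simp
  finally have "ennreal (p (t + h) j k) = ennreal (\<integral>\<omega>. real_cond_exp (P j) ?G ?f \<omega> \<partial>P j)" by simp
  also have "\<dots> = (\<integral>\<^sup>+\<omega>. ennreal (real_cond_exp (P j) ?G ?f \<omega>) \<partial>P j)"
  proof (rule nn_integral_eq_integral[symmetric])
    show "integrable (P j) (real_cond_exp (P j) ?G ?f)" using real_cond_exp_int(1)[OF int] .
    show "AE \<omega> in P j. 0 \<le> real_cond_exp (P j) ?G ?f \<omega>"
      using eq by eventually_elim (auto simp: p_nonneg split: option.split)
  qed
  also have "\<dots> = (\<integral>\<^sup>+\<omega>. (\<Sum>i. ennreal (p t i k) * indicator {\<omega> \<in> space (P j). X (ennreal h) \<omega> = Some i} \<omega>) \<partial>P j)"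
    using eq AE_space by (intro nn_integral_cong_AE, eventually_elim) (simp add: g_sum)
  also have "\<dots> = (\<Sum>i. \<integral>\<^sup>+\<omega>. ennreal (p t i k) * indicator {\<omega> \<in> space (P j). X (ennreal h) \<omega> = Some i} \<omega> \<partial>P j)"
    by (rule nn_integral_suminf) (use X_sets[OF X1] in measurable)
  also have "\<dots> = (\<Sum>i. ennreal (p h j i) * ennreal (p t i k))"
    using X_sets[OF X1] by (subst nn_integral_cmult_indicator) (auto simp: p_eq emeasure_eq_measure mult.commute)
  finally show ?thesis .
qed

definition pd :: "nat \<Rightarrow> nat \<Rightarrow> ennreal" where "pd j k = potential_density X P j k"

definition potential_upto :: "real \<Rightarrow> nat \<Rightarrow> nat \<Rightarrow> ennreal" where
  "potential_upto h j k = (\<integral>\<^sup>+t. ennreal (indicator {0..} t * p t j k) * indicator {..<h} t \<partial>lborel)"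

lemma pd_eq: "pd j k = (\<integral>\<^sup>+t. ennreal (indicator {0..} t * p t j k) \<partial>lborel)"
  unfolding pd_def potential_density_def p_def by (intro nn_integral_cong) (simp add: indicator_def)

lemma pd_finite: "1 \<le> j \<Longrightarrow> 1 \<le> k \<Longrightarrow> pd j k < \<top>"
  using transient unfolding transient_process_def pd_def by simp

lemma pd_sym: "1 \<le> j \<Longrightarrow> 1 \<le> k \<Longrightarrow> pd j k = pd k j"
  unfolding pd_eq by (simp add: p_sym)

text \<open>\<open>U = V_h + P_h U\<close>: the time integral is cut at \<open>h\<close>, and its
  tail is shifted and expanded by Chapman-Kolmogorov. State 0 is treated apart, as measurability of
  \<open>p t i k\<close> in \<open>t\<close> is available only for \<open>i \<ge> 1\<close>; the
  factor \<open>p h j 0 = 0\<close> disposes of it.\<close>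

lemma pd_split:
  assumes "0 < h" "1 \<le> j" "1 \<le> k"
  shows "pd j k = potential_upto h j k + (\<Sum>i. ennreal (p h j i) * pd i k)"
proof -
  let ?q = "\<lambda>t. ennreal (indicator {0..} t * p t j k)"
  have [measurable]: "?q \<in> borel_measurable borel" using p_measurable[OF assms(2)] by measurable
  have "pd j k = (\<integral>\<^sup>+t. ?q t * indicator {..<h} t + ?q t * indicator {h..} t \<partial>lborel)"
    unfolding pd_eq by (intro nn_integral_cong) (auto simp: indicator_def)
  also have "\<dots> = potential_upto h j k + (\<integral>\<^sup>+t. ?q t * indicator {h..} t \<partial>lborel)"
    unfolding potential_upto_def by (rule nn_integral_add) measurable
  also have "(\<integral>\<^sup>+t. ?q t * indicator {h..} t \<partial>lborel) = (\<integral>\<^sup>+t. ?q (h + 1 * t) * indicator {h..} (h + 1 * t) \<partial>lborel)"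
    using nn_integral_real_affine[of "\<lambda>t. ?q t * indicator {h..} t" 1 h] by simp
  also have "\<dots> = (\<integral>\<^sup>+t. (\<Sum>i. ennreal (p h j i) * ennreal (indicator {0..} t * p t i k)) \<partial>lborel)"
  proof (rule nn_integral_cong)
    fix t :: real
    show "?q (h + 1 * t) * indicator {h..} (h + 1 * t) = (\<Sum>i. ennreal (p h j i) * ennreal (indicator {0..} t * p t i k))"
    proof (cases "0 \<le> t")
      case True
      then show ?thesis using chapman_kolmogorov[of h t j k] assms by (simp add: add.commute)
    qed simp
  qed
  also have "\<dots> = (\<Sum>i. \<integral>\<^sup>+t. ennreal (p h j i) * ennreal (indicator {0..} t * p t i k) \<partial>lborel)"
  proof (rule nn_integral_suminf)
    fix i
    show "(\<lambda>t. ennreal (p h j i) * ennreal (indicator {0..} t * p t i k)) \<in> borel_measurable lborel"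
    proof (cases "i = 0")
      case True then show ?thesis using p_zero[OF assms(2), of h] by simp
    next
      case False
      then have [measurable]: "(\<lambda>t. indicator {0..} t * p t i k) \<in> borel_measurable borel" by (intro p_measurable) simp
      show ?thesis by measurable
    qed
  qed
  also have "\<dots> = (\<Sum>i. ennreal (p h j i) * pd i k)"
  proof (rule suminf_cong)
    fix i
    show "(\<integral>\<^sup>+t. ennreal (p h j i) * ennreal (indicator {0..} t * p t i k) \<partial>lborel) = ennreal (p h j i) * pd i k"
    proof (cases "i = 0")
      case True then show ?thesis using p_zero[OF assms(2), of h] by simp
    next
      case False
      then have [measurable]: "(\<lambda>t. indicator {0..} t * p t i k) \<in> borel_measurable borel" by (intro p_measurable) simp
      show ?thesis unfolding pd_eq by (rule nn_integral_cmult) measurable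
    qed
  qed
  finally show ?thesis .
qed

lemma potential_upto_bounds:
  assumes "0 < h" "1 \<le> j" and b: "\<And>t. 0 \<le> t \<Longrightarrow> t < h \<Longrightarrow> a \<le> p t j k \<and> p t j k \<le> b"
  shows "ennreal (a * h) \<le> potential_upto h j k" "potential_upto h j k \<le> ennreal (b * h)"
proof -
  have b0: "0 \<le> b" using b[of 0] p_nonneg[of 0 j k] assms(1) by linarith
  have const: "(\<integral>\<^sup>+t. ennreal c * indicator {0..<h} t \<partial>lborel) = ennreal (c * h)" if "0 \<le> c" for c
    using assms(1) that by (subst nn_integral_cmult_indicator) (auto simp: ennreal_mult)
  show "potential_upto h j k \<le> ennreal (b * h)"
    unfolding const[OF b0, symmetric] potential_upto_def
    by (intro nn_integral_mono) (use b in \<open>auto simp: indicator_def ennreal_leI\<close>)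
  show "ennreal (a * h) \<le> potential_upto h j k"
  proof (cases "0 \<le> a")
    case True
    show ?thesis
      unfolding const[OF True, symmetric] potential_upto_def
      by (intro nn_integral_mono) (use b in \<open>auto simp: indicator_def ennreal_leI\<close>)
  next
    case False
    then have "a * h \<le> 0" using assms(1) by (simp add: mult_nonpos_nonneg)
    then show ?thesis by (simp add: ennreal_neg)
  qed
qed

definition U :: "nat \<Rightarrow> nat \<Rightarrow> real" where "U j k = enn2real (pd j k)"
definition V :: "real \<Rightarrow> nat \<Rightarrow> nat \<Rightarrow> real" where "V h j k = enn2real (potential_upto h j k)"

lemma potential_upto_le: "potential_upto h j k \<le> pd j k"
  unfolding potential_upto_def pd_eq by (intro nn_integral_mono) (auto simp: indicator_def)

lemma ennreal_V: "1 \<le> j \<Longrightarrow> 1 \<le> k \<Longrightarrow> ennreal (V h j k) = potential_upto h j k"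
  unfolding V_def using le_less_trans[OF potential_upto_le pd_finite] by simp

lemma ennreal_U: "1 \<le> j \<Longrightarrow> 1 \<le> k \<Longrightarrow> ennreal (U j k) = pd j k"
  unfolding U_def using pd_finite by simp

text \<open>\<open>V h j k / h\<close> is the average of \<open>p t j k\<close> over
  \<open>[0, h)\<close>, and \<open>p\<close> is right continuous with the identity as value at time
  0.\<close>

lemma V_lim:
  assumes "1 \<le> j" "1 \<le> k"
  shows "((\<lambda>h. V h j k / h) \<longlongrightarrow> (if j = k then 1 else 0)) (at_right 0)"
proof (rule tendstoI)
  fix e :: real assume e: "0 < e"
  let ?c = "if j = k then 1 else (0::real)"
  have "\<forall>\<^sub>F t in at_right 0. dist (p t j k) ?c < e / 2"
    using tendstoD[OF p_right_continuous[of 0 j k], of "e / 2"] e assms p_initial[OF assms(1), of k] by simp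
  then obtain \<delta> where \<delta>: "0 < \<delta>" "\<And>t. 0 < t \<Longrightarrow> t < \<delta> \<Longrightarrow> dist (p t j k) ?c < e / 2"
    unfolding eventually_at_right_field by auto
  have pb: "?c - e / 2 \<le> p t j k \<and> p t j k \<le> ?c + e / 2" if "0 \<le> t" "t < \<delta>" for t
  proof (cases "t = 0")
    case True
    then show ?thesis using p_initial[OF assms(1), of k] e by simp
  next
    case False
    then have "dist (p t j k) ?c < e / 2" using that by (intro \<delta>) auto
    then show ?thesis unfolding dist_real_def by linarith
  qed
  show "\<forall>\<^sub>F h in at_right 0. dist (V h j k / h) ?c < e"
    unfolding eventually_at_right_field
  proof (intro exI conjI allI impI)
    show "0 < \<delta>" by fact
    fix h assume h: "0 < h" "h < \<delta>"
    have "ennreal ((?c - e / 2) * h) \<le> potential_upto h j k" "potential_upto h j k \<le> ennreal ((?c + e / 2) * h)"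
      using potential_upto_bounds[OF h(1) assms(1), of "?c - e / 2" k "?c + e / 2"] pb h by auto
    then have "ennreal ((?c - e / 2) * h) \<le> ennreal (V h j k)" "ennreal (V h j k) \<le> ennreal ((?c + e / 2) * h)"
      unfolding ennreal_V[OF assms] by auto
    then have "(?c - e / 2) * h \<le> V h j k" "V h j k \<le> (?c + e / 2) * h"
      using h e by (auto simp: V_def ennreal_le_iff)
    then have "?c - e / 2 \<le> V h j k / h" "V h j k / h \<le> ?c + e / 2"
      using h by (simp_all add: pos_le_divide_eq pos_divide_le_eq)
    then show "dist (V h j k / h) ?c < e" using e unfolding dist_real_def by linarith
  qed
qed

lemma U_eq:
  assumes "0 < h" "1 \<le> j" "1 \<le> k"
  shows "(\<lambda>i. p h j i * U i k) sums (U j k - V h j k)"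
proof -
  have t: "ennreal (p h j i * U i k) = ennreal (p h j i) * pd i k" for i
    using p_zero[OF assms(2), of h] ennreal_U[of i k] assms(3)
    by (cases "i = 0") (auto simp: ennreal_mult p_nonneg U_def)
  have VU: "V h j k \<le> U j k"
    unfolding U_def V_def by (rule enn2real_mono[OF potential_upto_le pd_finite]) (use assms in auto)
  have eq: "ennreal (U j k) = ennreal (V h j k) + (\<Sum>i. ennreal (p h j i * U i k))"
    unfolding t ennreal_U[OF assms(2,3)] ennreal_V[OF assms(2,3)] by (rule pd_split[OF assms])
  have "ennreal (U j k - V h j k) = ennreal (U j k) - ennreal (V h j k)"
    by (rule ennreal_minus[symmetric]) (simp add: V_def)
  also have "\<dots> = (\<Sum>i. ennreal (p h j i * U i k))"
    unfolding eq by (rule ennreal_add_diff_cancel_left) simp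
  finally have S: "(\<Sum>i. ennreal (p h j i * U i k)) = ennreal (U j k - V h j k)" ..
  have nn: "0 \<le> p h j i * U i k" for i by (simp add: p_nonneg U_def)
  have sm: "summable (\<lambda>i. p h j i * U i k)"
    by (rule summable_suminf_not_top[OF nn]) (simp add: S)
  have "(\<Sum>i. p h j i * U i k) = U j k - V h j k"
    using S VU suminf_nonneg[OF sm nn] by (simp add: suminf_ennreal2[OF nn sm])
  then show ?thesis using summable_sums[OF sm] by simp
qed

end

lemma infsum_ennreal_finite_sum_le:
  fixes g :: "'a \<Rightarrow> ennreal"
  assumes "finite G" "G \<subseteq> A"
  shows "sum g G \<le> (\<Sum>\<^sub>\<infinity>k\<in>A. g k)"
proof -
  have "infsum g G \<le> infsum g A"
    by (rule infsum_mono_neutral) (use assms in \<open>auto intro: nonneg_summable_on_complete\<close>)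
  then show ?thesis using assms by simp
qed

lemma infsum_ennreal_sum_le:
  assumes "\<And>k. k \<in> A \<Longrightarrow> 0 \<le> g k" "(\<Sum>\<^sub>\<infinity>k\<in>A. ennreal (g k)) \<le> ennreal c" "0 \<le> c" "finite G" "G \<subseteq> A"
  shows "sum g G \<le> c"
proof -
  have "ennreal (sum g G) = (\<Sum>k\<in>G. ennreal (g k))" using assms by (subst sum_ennreal) auto
  also have "\<dots> \<le> ennreal c" using infsum_ennreal_finite_sum_le[OF assms(4,5), of "\<lambda>k. ennreal (g k)"] assms(2) by simp
  finally show ?thesis using assms(3) by (simp add: ennreal_le_iff)
qed

lemma sums_bounded_nonneg:
  fixes g :: "nat \<Rightarrow> real"
  assumes "\<And>k. 0 \<le> g k" "\<And>G. finite G \<Longrightarrow> sum g G \<le> c"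
  shows "\<exists>s\<le>c. g sums s"
proof -
  have "summable g" by (rule summableI_nonneg_bounded[of _ c]) (use assms in auto)
  moreover from this have "suminf g \<le> c" by (rule suminf_le_const) (use assms in auto)
  ultimately show ?thesis using summable_sums by blast
qed

context symmetric_transient_process
begin

lemma symmetric_potential_p_U_V:
  assumes "\<And>j G. 1 \<le> j \<Longrightarrow> finite G \<Longrightarrow> G \<subseteq> {1..} \<Longrightarrow> (\<Sum>k\<in>G. U j k) \<le> C"
  shows "symmetric_potential p U V"
proof
  show "U j k = U k j" if "1 \<le> j" "1 \<le> k" for j k using pd_sym[OF that] by (simp add: U_def)
  \<comment> \<open>A row of \<open>U\<close> is summable, so its entries tend to 0; symmetry turns
    the row into a column.\<close>
  show "(\<lambda>j. U j k) \<longlonglongrightarrow> 0" if k: "1 \<le> k" for k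
  proof -
    let ?g = "\<lambda>j. if j = 0 then 0 else U k j"
    have "\<exists>s\<le>C. ?g sums s"
    proof (rule sums_bounded_nonneg)
      fix G :: "nat set" assume G: "finite G"
      have "sum ?g G = (\<Sum>j\<in>G - {0}. U k j)" by (rule sum.mono_neutral_cong_right) (use G in auto)
      also have "\<dots> \<le> C" using G by (intro assms[OF k]) auto
      finally show "sum ?g G \<le> C" .
    qed (simp add: U_def)
    then have "?g \<longlonglongrightarrow> 0" by (auto simp: sums_iff intro: summable_LIMSEQ_zero)
    then show ?thesis
      by (rule Lim_transform_eventually, intro eventually_sequentiallyI[of 1]) (use pd_sym[OF k] in \<open>simp add: U_def\<close>)
  qed
qed (use p_nonneg p_zero p_sum U_eq V_lim in \<open>auto simp: U_def\<close>)

text \<open>Monotonicity in time puts \<open>P_h f\<close> below \<open>P_s f\<close> for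
  \<open>s < h\<close>, and the latter tends to \<open>f\<close>. The conclusion is
  \<open>superharmonic\<close> unfolded, since that constant lives in a locale not yet interpreted
  here.\<close>

lemma excessive_superharmonic:
  assumes "excessive {1..} X P f"
  shows "(\<forall>j\<ge>1. 0 \<le> f j) \<and> (\<forall>h>0. \<forall>j\<ge>1. \<exists>s\<le>f j. (\<lambda>i. p h j i * f i) sums s)"
proof (intro conjI allI impI)
  show f: "0 \<le> f j" if "1 \<le> j" for j using assms that unfolding excessive_def by simp
  fix h :: real and j :: nat assume h: "0 < h" and j: "1 \<le> j"
  let ?S = "\<lambda>t. semigroup_op {1..} X P t f j"
  have anti: "antimono_on {0<..<\<top>} ?S" and lim: "(?S \<longlongrightarrow> ennreal (f j)) (at_right 0)"
    using assms j unfolding excessive_def by auto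
  have "?S (ennreal h) \<le> ennreal (f j)"
  proof (rule tendsto_lowerbound)
    show "((\<lambda>s. ?S (ennreal s)) \<longlongrightarrow> ennreal (f j)) (at_right 0)"
      using filterlim_compose[OF lim, of ennreal "at_right 0"] filterlim_ennreal_at_right[of 0] by simp
    show "\<forall>\<^sub>F s in at_right 0. ?S (ennreal h) \<le> ?S (ennreal s)"
      unfolding eventually_at_right_field
    proof (intro exI conjI allI impI)
      fix s assume s: "0 < s" "s < h"
      have "ennreal s \<in> {0<..<\<top>}" "ennreal h \<in> {0<..<\<top>}" "ennreal s \<le> ennreal h"
        using s h by (auto simp: ennreal_leI)
      then show "?S (ennreal h) \<le> ?S (ennreal s)" using anti unfolding monotone_on_def by blast
    qed (rule h)
  qed simp
  then have le: "(\<Sum>\<^sub>\<infinity>k\<in>{1..}. ennreal (p h j k * f k)) \<le> ennreal (f j)"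
    unfolding semigroup_op_def p_def .
  show "\<exists>s\<le>f j. (\<lambda>i. p h j i * f i) sums s"
  proof (rule sums_bounded_nonneg)
    show "0 \<le> p h j i * f i" for i
      using p_zero[OF j, of h] p_nonneg[of h j i] f[of i] by (cases "i = 0") auto
    fix G :: "nat set" assume G: "finite G"
    have "(\<Sum>i\<in>G. p h j i * f i) = (\<Sum>i\<in>G - {0}. p h j i * f i)"
      by (rule sum.mono_neutral_right) (use G p_zero[OF j, of h] in auto)
    also have "\<dots> \<le> f j"
      using G f p_nonneg j by (intro infsum_ennreal_sum_le[OF _ le]) auto
    finally show "(\<Sum>i\<in>G. p h j i * f i) \<le> f j" .
  qed
qed

end

section \<open>The limit superior\<close>

text \<open>With \<open>r\<close> a negative power of \<open>N\<close> and \<open>L\<close>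
  logarithmic in \<open>N\<close>, both \<open>r\<close> and \<open>r * L^2\<close> tend to
  0.\<close>

lemma kibble_bound_tendsto:
  assumes "0 < \<alpha>" "0 < a" "0 < d"
  shows "(\<lambda>N. kibble_bound \<alpha> (real N powr (- a) / d) (b * ln (real N) + 1)) \<longlonglongrightarrow> 1"
proof -
  have r: "(\<lambda>N. real N powr (- a) / d) \<longlonglongrightarrow> 0"
    using assms by real_asymp
  have q: "(\<lambda>N. real N powr (- a) / d * (b * ln (real N) + 1)\<^sup>2) \<longlonglongrightarrow> 0"
  proof -
    have "(\<lambda>N. real N powr (- a) * ln (real N) ^ 2) \<longlonglongrightarrow> 0" "(\<lambda>N. real N powr (- a) * ln (real N)) \<longlonglongrightarrow> 0"
      "(\<lambda>N. real N powr (- a)) \<longlonglongrightarrow> 0"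
      using assms(2) by real_asymp+
    then have "(\<lambda>N. b\<^sup>2 / d * (real N powr (- a) * ln (real N) ^ 2) + 2 * b / d * (real N powr (- a) * ln (real N))
       + 1 / d * real N powr (- a)) \<longlonglongrightarrow> b\<^sup>2 / d * 0 + 2 * b / d * 0 + 1 / d * 0"
      by (intro tendsto_add tendsto_mult tendsto_const)
    moreover have "b\<^sup>2 / d * (x * l ^ 2) + 2 * b / d * (x * l) + 1 / d * x = x / d * (b * l + 1)\<^sup>2" for x l :: real
      using assms(3) by (simp add: field_simps power2_eq_square)
    ultimately show ?thesis by simp
  qed
  have "(\<lambda>N. (1 - real N powr (- a) / d) powr (- \<alpha>) *
      (1 + (exp (real N powr (- a) / d * (b * ln (real N) + 1)\<^sup>2 / (1 - real N powr (- a) / d)\<^sup>2) - 1) / \<alpha>))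
    \<longlonglongrightarrow> (1 - 0) powr (- \<alpha>) * (1 + (exp (0 / (1 - 0)\<^sup>2) - 1) / \<alpha>)"
    using assms(1) by (intro tendsto_intros r q) auto
  then show ?thesis unfolding kibble_bound_def by simp
qed

text \<open>The first factor is of order at most \<open>N^(\<epsilon> / 4)\<close>, since tilt and
  dependence threshold are both \<open>N^(- \<epsilon> / 8)\<close>; the second, which bounds the
  inverse of the expected count, is of order \<open>N^(- \<epsilon>) log N\<close>. \<open>G\<close>
  stands for \<open>Gamma \<alpha>\<close>.\<close>

lemma block_error_tendsto:
  assumes "0 < \<epsilon>" "\<epsilon> < 1"
  shows "(\<lambda>N. (C / (real N powr (- (\<epsilon> / 8)) * real N powr (- (\<epsilon> / 8))) + 1) *
    ((((1 - \<epsilon>) * ln (real N) + 1) * G) * exp ((1 - \<epsilon>) * ln (real N) + 1) / real N)) \<longlonglongrightarrow> 0"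
proof -
  have "(\<lambda>N. real N powr (- (3 * \<epsilon> / 4)) * ln (real N)) \<longlonglongrightarrow> 0" "(\<lambda>N. real N powr (- (3 * \<epsilon> / 4))) \<longlonglongrightarrow> 0"
    "(\<lambda>N. real N powr (- \<epsilon>) * ln (real N)) \<longlonglongrightarrow> 0" "(\<lambda>N. real N powr (- \<epsilon>)) \<longlonglongrightarrow> 0"
    using assms by real_asymp+
  then have "(\<lambda>N. C * G * exp 1 * ((1 - \<epsilon>) * (real N powr (- (3 * \<epsilon> / 4)) * ln (real N)) + real N powr (- (3 * \<epsilon> / 4))) +
      G * exp 1 * ((1 - \<epsilon>) * (real N powr (- \<epsilon>) * ln (real N)) + real N powr (- \<epsilon>)))
    \<longlonglongrightarrow> C * G * exp 1 * ((1 - \<epsilon>) * 0 + 0) + G * exp 1 * ((1 - \<epsilon>) * 0 + 0)"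
    by (intro tendsto_intros)
  then have lim: "(\<lambda>N. C * G * exp 1 * ((1 - \<epsilon>) * (real N powr (- (3 * \<epsilon> / 4)) * ln (real N)) + real N powr (- (3 * \<epsilon> / 4))) +
      G * exp 1 * ((1 - \<epsilon>) * (real N powr (- \<epsilon>) * ln (real N)) + real N powr (- \<epsilon>))) \<longlonglongrightarrow> 0"
    by simp
  show ?thesis
  proof (rule Lim_transform_eventually[OF lim], rule eventually_sequentiallyI[of 1])
    fix N :: nat assume N: "1 \<le> N"
    have 1: "1 / (real N powr (- (\<epsilon> / 8)) * real N powr (- (\<epsilon> / 8))) = real N powr (\<epsilon> / 4)"
      using N by (simp add: powr_add[symmetric] powr_minus_divide)
    have 2: "exp ((1 - \<epsilon>) * ln (real N) + 1) / real N = exp 1 * real N powr (- \<epsilon>)"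
      using N by (simp add: powr_def exp_add left_diff_distrib exp_diff exp_minus divide_inverse)
    have 3: "real N powr (- (3 * \<epsilon> / 4)) = real N powr (\<epsilon> / 4) * real N powr (- \<epsilon>)"
      using N by (simp add: powr_add[symmetric])
    have "(C / (real N powr (- (\<epsilon> / 8)) * real N powr (- (\<epsilon> / 8))) + 1) *
      ((((1 - \<epsilon>) * ln (real N) + 1) * G) * exp ((1 - \<epsilon>) * ln (real N) + 1) / real N) =
      (C * (1 / (real N powr (- (\<epsilon> / 8)) * real N powr (- (\<epsilon> / 8)))) + 1) *
      ((((1 - \<epsilon>) * ln (real N) + 1) * G) * (exp ((1 - \<epsilon>) * ln (real N) + 1) / real N))"
      by simp
    also have "\<dots> = (C * real N powr (\<epsilon> / 4) + 1) * ((((1 - \<epsilon>) * ln (real N) + 1) * G) * (exp 1 * real N powr (- \<epsilon>)))"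
      unfolding 1 2 ..
    finally show "C * G * exp 1 * ((1 - \<epsilon>) * (real N powr (- (3 * \<epsilon> / 4)) * ln (real N)) + real N powr (- (3 * \<epsilon> / 4))) +
      G * exp 1 * ((1 - \<epsilon>) * (real N powr (- \<epsilon>) * ln (real N)) + real N powr (- \<epsilon>)) =
      (C / (real N powr (- (\<epsilon> / 8)) * real N powr (- (\<epsilon> / 8))) + 1) *
      ((((1 - \<epsilon>) * ln (real N) + 1) * G) * exp ((1 - \<epsilon>) * ln (real N) + 1) / real N)"
      unfolding 3 by (simp add: algebra_simps)
  qed
qed

text \<open>The intersection of all \<open>G N\<close> with \<open>N \<ge> N0\<close> is contained
  in each of them, so its probability is below a sequence tending to 0. This replaces the second
  Borel-Cantelli lemma for dependent blocks.\<close>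

lemma (in prob_space) AE_frequently_not_in:
  assumes G: "\<And>N. G N \<in> events" and lim: "(\<lambda>N. prob (G N)) \<longlonglongrightarrow> 0"
  shows "AE \<omega> in M. \<forall>N0::nat. \<exists>N\<ge>N0. \<omega> \<notin> G N"
  unfolding AE_all_countable
proof
  fix N0
  let ?A = "\<Inter>N\<in>{N0..}. G N"
  have A: "?A \<in> events" using G by (intro sets.countable_INT') auto
  have "prob ?A \<le> prob (G N)" if "N0 \<le> N" for N
    using that G by (intro finite_measure_mono) auto
  then have "prob ?A \<le> 0"
    by (intro tendsto_lowerbound[OF lim] eventually_sequentiallyI[of N0]) auto
  then have "prob ?A = 0" using measure_nonneg[of M ?A] by linarith
  then have "AE \<omega> in M. \<omega> \<notin> ?A" using prob_eq_0[OF A] by simp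
  then show "AE \<omega> in M. \<exists>N\<ge>N0. \<omega> \<notin> G N" by eventually_elim auto
qed

section \<open>Almost sure upper and lower bounds\<close>

locale potential_permanental = symmetric_transient_process M F X P + Q: prob_space Q
  for M :: "'w measure" and F :: "ennreal \<Rightarrow> 'w measure" and X :: "ennreal \<Rightarrow> 'w \<Rightarrow> nat option"
    and P :: "nat \<Rightarrow> 'w measure" and Q :: "'b measure" +
  fixes f :: "nat \<Rightarrow> real" and \<alpha> :: real and Z :: "nat \<Rightarrow> 'b \<Rightarrow> real" and c C b :: real
  assumes \<alpha>: "0 < \<alpha>"
    and excessive_f: "excessive {1..} X P f"
    and permanental: "permanental_sequence Q \<alpha> {1..} (\<lambda>j k. U j k + f k) Z"
    and c: "0 < c" "\<And>j. 1 \<le> j \<Longrightarrow> c \<le> U j j"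
    and C: "\<And>j G. 1 \<le> j \<Longrightarrow> finite G \<Longrightarrow> G \<subseteq> {1..} \<Longrightarrow> (\<Sum>k\<in>G. U j k) \<le> C"
    and f_lim: "f \<longlonglongrightarrow> 0" and f_le: "\<And>j. 1 \<le> j \<Longrightarrow> f j \<le> b"
begin

sublocale SP: symmetric_potential p U V
  by (rule symmetric_potential_p_U_V[OF C])

lemma superharmonic_f: "SP.superharmonic f"
  unfolding SP.superharmonic_def by (rule excessive_superharmonic[OF excessive_f])

lemma f_nonneg: "1 \<le> j \<Longrightarrow> 0 \<le> f j"
  using superharmonic_f by (simp add: SP.superharmonic_def)

lemma Z_measurable: "1 \<le> j \<Longrightarrow> Z j \<in> borel_measurable Q"
  and Z_nonneg: "1 \<le> j \<Longrightarrow> \<omega> \<in> space Q \<Longrightarrow> 0 \<le> Z j \<omega>"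
  using permanental by (auto simp: permanental_sequence_def)

lemma U_pos: "1 \<le> j \<Longrightarrow> 0 < U j j"
  using c less_le_trans by blast

abbreviation block_kernel :: "nat \<Rightarrow> nat \<Rightarrow> nat \<Rightarrow> real" where
  "block_kernel N i j \<equiv> U (N + i) (N + j) + f (N + j)"

lemma laplace_transform_block:
  assumes "inverse_M_matrix n (block_kernel N) A" "1 \<le> N" "\<And>i. i < n \<Longrightarrow> 0 < s i"
  shows "(\<integral>\<omega>. exp (- (\<Sum>i<n. s i * Z (N + i) \<omega>)) \<partial>Q) = inverse_M_matrix.laplace_det n (block_kernel N) s powr (- \<alpha>)"
proof -
  have "inj_on (\<lambda>i. N + i) {..<n} \<and> (\<lambda>i. N + i) ` {..<n} \<subseteq> {1..} \<and> (\<forall>m<n. 0 < s m)"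
    using assms by auto
  then have "(\<integral>\<omega>. exp (- (\<Sum>i<n. s i * Z (N + i) \<omega>)) \<partial>Q) =
      Determinant.det (1\<^sub>m n + Matrix.mat n n (\<lambda>(i, j). block_kernel N i j)
         * Matrix.mat n n (\<lambda>(i, j). if i = j then s i else 0)) powr (- \<alpha>)"
    using permanental unfolding permanental_sequence_def by blast
  then show ?thesis unfolding inverse_M_matrix.laplace_det_def[OF assms(1)] .
qed

lemma laplace_transform_marginal:
  assumes "1 \<le> j" "0 < s"
  shows "(\<integral>\<omega>. exp (- (s * Z j \<omega>)) \<partial>Q) = (1 + s * (U j j + f j)) powr (- \<alpha>)"
proof -
  \<comment> \<open>The marginal is a block of length 1; at \<open>s = 0\<close> the resolvent is
    the kernel itself.\<close>
  obtain A where A: "inverse_M_matrix (Suc 0) (block_kernel j) A"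
    using SP.inverse_M_matrix_exists[OF superharmonic_f assms(1)] by blast
  interpret inverse_M_matrix "Suc 0" "block_kernel j" A by fact
  have nn: "nonneg (\<lambda>_. 0)" by (simp add: nonneg_def)
  have "resolvent (\<lambda>_. 0) 0 0 = U j j + f j"
    using resolvent_identity_left[OF nn, of 0 0] by simp
  then have "laplace_det (update_at (\<lambda>_. 0) 0 s) = 1 + s * (U j j + f j)"
    using laplace_det_update[OF nn, of 0 s] laplace_det_0 by simp
  moreover have "laplace_det (update_at (\<lambda>_. 0) 0 s) = laplace_det (\<lambda>_. s)"
    by (rule laplace_det_cong) (simp add: update_at_def)
  ultimately show ?thesis
    using laplace_transform_block[OF A assms(1), of "\<lambda>_. s"] assms(2) by simp
qed

lemma eventually_le:
  assumes "0 < \<epsilon>" "\<epsilon> \<le> 1"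
  shows "AE \<omega> in Q. \<forall>\<^sub>F n in sequentially. Z n \<omega> / (U n n * ln (real n)) \<le> 1 + \<epsilon>"
proof -
  \<comment> \<open>\<open>\<delta>\<close> absorbs \<open>f n\<close>, which is eventually below
    \<open>\<epsilon> / 4 * U n n\<close>, and \<open>\<theta> = 1 / \<delta>\<close> is the
    Chernoff parameter. The tail at \<open>(1 + \<epsilon>) * U n n * ln n\<close> is then of order
    at most \<open>n^(- \<beta>)\<close>, and \<open>\<epsilon> \<le> 1\<close> ensures
    \<open>\<beta> > 1\<close>.\<close>
  define \<delta> where "\<delta> = 1 + \<epsilon> / 4"
  define \<theta> where "\<theta> = 1 / \<delta>"
  define \<beta> where "\<beta> = (1 + \<epsilon>) / \<delta>\<^sup>2"
  have \<delta>: "1 < \<delta>" using assms by (simp add: \<delta>_def)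
  have \<theta>: "0 < \<theta>" "\<theta> < 1" using \<delta> by (auto simp: \<theta>_def)
  have "\<delta>\<^sup>2 < 1 + \<epsilon>"
  proof -
    have "\<epsilon> * \<epsilon> \<le> \<epsilon> * 1" using assms by (intro mult_left_mono) auto
    moreover have "\<delta>\<^sup>2 = 1 + \<epsilon> / 2 + (\<epsilon> * \<epsilon>) / 16" by (simp add: \<delta>_def power2_eq_square algebra_simps)
    ultimately show ?thesis using assms by linarith
  qed
  then have \<beta>: "1 < \<beta>" unfolding \<beta>_def using \<delta> by simp
  define A where "A = (\<lambda>n. if n = 0 then {} else {\<omega> \<in> space Q. (1 + \<epsilon>) * U n n * ln (real n) < Z n \<omega>})"
  have A: "A n \<in> sets Q" for n
  proof (cases "n = 0")
    case False
    then have [measurable]: "Z n \<in> borel_measurable Q" by (intro Z_measurable) simp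
    show ?thesis using False unfolding A_def by simp
  qed (simp add: A_def)
  have "\<forall>\<^sub>F n in sequentially. f n < \<epsilon> / 4 * c"
    using f_lim assms c by (intro order_tendstoD(2)) auto
  then have ev: "\<forall>\<^sub>F n in sequentially. norm (measure Q (A n)) \<le> (1 - \<theta>) powr (- \<alpha>) * real n powr (- \<beta>)"
    using eventually_ge_at_top[of 1]
  proof eventually_elim
    case (elim n)
    define k where "k = U n n + f n"
    have k: "0 < k" unfolding k_def using U_pos[OF elim(2)] f_nonneg[OF elim(2)] by simp
    have k_le: "k \<le> \<delta> * U n n"
    proof -
      have "\<epsilon> / 4 * c \<le> \<epsilon> / 4 * U n n" using assms c(2)[OF elim(2)] by (intro mult_left_mono) auto
      then show ?thesis using elim(1) by (simp add: k_def \<delta>_def distrib_right)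
    qed
    have [measurable]: "Z n \<in> borel_measurable Q" using Z_measurable elim(2) .
    have LT: "(\<integral>\<omega>. exp (- (s * (Z n \<omega> / k))) \<partial>Q) = (1 + s) powr (- \<alpha>)" if "0 < s" for s
      using laplace_transform_marginal[OF elim(2), of "s / k"] that k by (simp add: k_def)
    define x where "x = (1 + \<epsilon>) * U n n * ln (real n) / k"
    have "A n = {\<omega> \<in> space Q. x < Z n \<omega> / k}"
      using elim(2) k by (auto simp: A_def x_def divide_less_cancel)
    then have "measure Q (A n) \<le> (1 - \<theta>) powr (- \<alpha>) * exp (- \<theta> * x)"
      using gamma_tail_le[OF Q.prob_space_axioms \<alpha> _ _ LT \<theta>, of x] Z_nonneg[OF elim(2)] k by simp
    also have "\<dots> \<le> (1 - \<theta>) powr (- \<alpha>) * exp (- (\<beta> * ln (real n)))"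
    proof (intro mult_left_mono)
      have l: "0 \<le> ln (real n)" using elim(2) by simp
      have "(1 + \<epsilon>) / \<delta> \<le> (1 + \<epsilon>) * U n n / k"
      proof -
        have "(1 + \<epsilon>) / \<delta> = (1 + \<epsilon>) * U n n / (\<delta> * U n n)" using U_pos[OF elim(2)] by simp
        also have "\<dots> \<le> (1 + \<epsilon>) * U n n / k"
          using k k_le assms U_pos[OF elim(2)] by (intro divide_left_mono) auto
        finally show ?thesis .
      qed
      then have "(1 + \<epsilon>) / \<delta> * ln (real n) \<le> (1 + \<epsilon>) * U n n / k * ln (real n)"
        using l by (rule mult_right_mono)
      then have "\<theta> * ((1 + \<epsilon>) / \<delta> * ln (real n)) \<le> \<theta> * x"
        unfolding x_def using \<theta> by (intro mult_left_mono) auto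
      then have "\<beta> * ln (real n) \<le> \<theta> * x"
        by (simp add: \<beta>_def \<theta>_def power2_eq_square)
      then show "exp (- \<theta> * x) \<le> exp (- (\<beta> * ln (real n)))" by simp
    qed simp
    finally show ?case using elim(2) by (simp add: powr_def)
  qed
  have "summable (\<lambda>n. measure Q (A n))"
    by (rule summable_comparison_test_ev[OF ev])
       (use \<beta> in \<open>intro summable_mult, simp add: summable_real_powr_iff\<close>)
  then have "AE \<omega> in Q. \<forall>\<^sub>F n in sequentially. \<omega> \<in> space Q - A n"
    by (intro borel_cantelli_AE1 A) (auto simp: less_top[symmetric])
  then show ?thesis
  proof eventually_elim
    case (elim \<omega>)
    then show ?case using eventually_ge_at_top[of 2]
    proof eventually_elim
      case (elim n)
      then have "Z n \<omega> \<le> (1 + \<epsilon>) * U n n * ln (real n)" by (auto simp: A_def not_less)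
      moreover have "0 < U n n * ln (real n)" using elim U_pos[of n] by simp
      ultimately show ?case by (simp add: pos_divide_le_eq mult.assoc)
    qed
  qed
qed

text \<open>One factor \<open>1 - \<epsilon>\<close> lowers the level below \<open>ln N\<close>, so
  that the expected number of coordinates above it grows like \<open>N^\<epsilon>\<close> up to
  logarithms. The other pays for replacing the diagonal of \<open>U\<close> by that of the tilted
  kernel.\<close>

lemma block_limit:
  assumes \<epsilon>: "0 < \<epsilon>" "\<epsilon> < 1"
  defines "\<theta> \<equiv> (\<lambda>N n. (1 - \<epsilon>) * ((1 - \<epsilon>) * ln (real N)) * U n n)"
  shows "(\<lambda>N. measure Q {\<omega> \<in> space Q. \<forall>i<N. Z (N + i) \<omega> < \<theta> N (N + i)}) \<longlonglongrightarrow> 0"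
proof -
  define K0 where "K0 = C + b"
  \<comment> \<open>Serves both as the tilt and as the dependence threshold \<open>\<eta>\<close>:
    it tends to 0, yet \<open>1 / \<tau>^2 = N^(\<epsilon> / 4)\<close> is small against
    \<open>N^\<epsilon>\<close>.\<close>
  define \<tau> where "\<tau> = (\<lambda>N::nat. real N powr (- (\<epsilon> / 8)))"
  define u where "u = (\<lambda>N::nat. (1 - \<epsilon>) * ln (real N))"
  define c' where "c' = (1 - \<epsilon>) * c"
  have c': "0 < c'" using c \<epsilon> by (simp add: c'_def)
  define B1 where "B1 = (\<lambda>N. kibble_bound \<alpha> (\<tau> N / c'\<^sup>2) (u N + 1) - 1)"
  define B2 where "B2 = (\<lambda>N. (K0 / (\<tau> N * \<tau> N) + 1) * ((u N + 1) * Gamma \<alpha> * exp (u N + 1) / real N))"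
  have C0: "0 \<le> C" using C[of 1 "{}"] by simp
  have b0: "0 \<le> b" using f_nonneg[of 1] f_le[of 1] by simp
  have U_le: "U j k \<le> C" if "1 \<le> j" "1 \<le> k" for j k using C[OF that(1), of "{k}"] that(2) by simp
  have B1: "B1 \<longlonglongrightarrow> 1 - 1"
    unfolding B1_def \<tau>_def u_def by (intro tendsto_diff tendsto_const kibble_bound_tendsto \<alpha>) (use \<epsilon> c' in auto)
  have B2: "B2 \<longlonglongrightarrow> 0"
    unfolding B2_def \<tau>_def u_def by (rule block_error_tendsto[OF \<epsilon>])
  have \<tau>_lim: "\<tau> \<longlonglongrightarrow> 0" unfolding \<tau>_def using \<epsilon> by real_asymp
  have "(\<lambda>N. \<tau> N * (K0 * C)) \<longlonglongrightarrow> 0 * (K0 * C)" "(\<lambda>N. \<tau> N / c'\<^sup>2) \<longlonglongrightarrow> 0 / c'\<^sup>2"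
    by (rule tendsto_mult[OF \<tau>_lim tendsto_const], rule tendsto_divide[OF \<tau>_lim tendsto_const]) (use c' in simp)
  then have ev1: "\<forall>\<^sub>F N in sequentially. \<tau> N * (K0 * C) < \<epsilon> * c" "\<forall>\<^sub>F N in sequentially. \<tau> N / c'\<^sup>2 < 1"
    using \<epsilon> c by (auto intro!: order_tendstoD(2))
  have "filterlim u at_top sequentially" unfolding u_def using \<epsilon> by real_asymp
  then have ev2: "\<forall>\<^sub>F N in sequentially. 1 \<le> u N" by (simp add: filterlim_at_top)
  have "\<forall>\<^sub>F N in sequentially. measure Q {\<omega> \<in> space Q. \<forall>i<N. Z (N + i) \<omega> < \<theta> N (N + i)} \<le> B1 N + B2 N"
    using ev1 ev2 eventually_ge_at_top[of 1]
  proof eventually_elim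
    case (elim N)
    note N = elim(4)
    obtain A where A: "inverse_M_matrix N (block_kernel N) A"
      using SP.inverse_M_matrix_exists[OF superharmonic_f N] by blast
    interpret inverse_M_matrix N "block_kernel N" A by fact
    have \<tau>: "0 < \<tau> N" using N by (simp add: \<tau>_def)
    have nn: "nonneg (\<lambda>_. \<tau> N)" using \<tau> by (simp add: nonneg_def)
    have K_le: "block_kernel N i j \<le> K0" if "i < N" "j < N" for i j
      unfolding K0_def using U_le[of "N + i" "N + j"] f_le[of "N + j"] N by simp
    have R_ge: "(1 - \<epsilon>) * U (N + i) (N + i) \<le> resolvent (\<lambda>_. \<tau> N) i i" if i: "i < N" for i
    proof -
      let ?R = "resolvent (\<lambda>_. \<tau> N) i"
      have R: "0 \<le> ?R k" "?R k \<le> K0" if "k < N" for k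
        using resolvent_nonneg[OF nn i that] resolvent_le_K[OF nn i that] K_le[OF i that] by auto
      have "U (N + i) (N + i) + f (N + i) = ?R i + (\<Sum>k<N. ?R k * \<tau> N * block_kernel N k i)"
        using resolvent_identity_right[OF nn i i] .
      also have "(\<Sum>k<N. ?R k * \<tau> N * block_kernel N k i) =
        (\<Sum>k<N. ?R k * \<tau> N * U (N + k) (N + i)) + (\<Sum>k<N. ?R k * \<tau> N) * f (N + i)"
        by (simp add: distrib_left sum.distrib sum_distrib_right)
      \<comment> \<open>The term \<open>f (N + i)\<close> reappears with total weight at most 1 and
        cancels against the left side, so no rate of decay of \<open>f\<close> enters.\<close>
      also have "(\<Sum>k<N. ?R k * \<tau> N) * f (N + i) \<le> 1 * f (N + i)"
        using resolvent_row_sum[OF nn i] f_nonneg[of "N + i"] N by (intro mult_right_mono) auto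
      finally have 1: "U (N + i) (N + i) \<le> ?R i + (\<Sum>k<N. ?R k * \<tau> N * U (N + k) (N + i))" by simp
      \<comment> \<open>\<open>R\<close> is bounded crudely by \<open>K0\<close>, and symmetry turns
        the column sum of \<open>U\<close> into a row sum, at most \<open>C\<close>; the factor
        \<open>\<tau>\<close> makes the product small.\<close>
      have "(\<Sum>k<N. ?R k * \<tau> N * U (N + k) (N + i)) \<le> (\<Sum>k<N. K0 * \<tau> N * U (N + i) (N + k))"
        using R \<tau> N SP.U_nonneg SP.U_sym
        by (intro sum_mono mult_mono) (auto intro!: mult_nonneg_nonneg order_trans[OF R] simp: K0_def C0 b0)
      also have "\<dots> = K0 * \<tau> N * (\<Sum>k\<in>{N..<N+N}. U (N + i) k)"
        unfolding sum_distrib_left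
        by (rule sum.reindex_bij_witness[of _ "\<lambda>k. k - N" "\<lambda>k. N + k"]) auto
      also have "\<dots> \<le> K0 * \<tau> N * C"
        using C0 b0 \<tau> N by (intro mult_left_mono C) (auto simp: K0_def)
      also have "\<dots> < \<epsilon> * c" using elim(1) by (simp add: mult_ac)
      also have "\<dots> \<le> \<epsilon> * U (N + i) (N + i)" using c(2)[of "N + i"] \<epsilon> N by (intro mult_left_mono) auto
      finally show ?thesis using 1 by (simp add: left_diff_distrib)
    qed
    have p: "exp (- (u N + 1)) / ((u N + 1) * Gamma \<alpha>) \<le> gamma_prob \<alpha> (u N) (u N + 1)"
      by (rule gamma_prob_ge[OF \<alpha> elim(3)])
    have p0: "0 < exp (- (u N + 1)) / ((u N + 1) * Gamma \<alpha>)"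
      using elim(3) Gamma_real_pos[OF \<alpha>] by simp
    have "measure Q {\<omega> \<in> space Q. \<forall>i<N. Z (N + i) \<omega> < \<theta> N (N + i)} \<le>
      (kibble_bound \<alpha> (\<tau> N / c'\<^sup>2) (u N + 1) - 1) + (K0 / (\<tau> N * \<tau> N) + 1) / (real N * gamma_prob \<alpha> (u N) (u N + 1))"
    proof (rule prob_all_less_block[OF Q.prob_space_axioms \<alpha>, where Z = "\<lambda>i. Z (N + i)" and \<theta> = "\<lambda>i. \<theta> N (N + i)"])
      show "c' \<le> resolvent (\<lambda>_. \<tau> N) i i" if "i < N" for i
      proof -
        have "c' \<le> (1 - \<epsilon>) * U (N + i) (N + i)" unfolding c'_def using c(2)[of "N + i"] \<epsilon> N by (intro mult_left_mono) auto
        then show ?thesis using R_ge[OF that] by simp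
      qed
      show "0 < \<theta> N (N + i) \<and> \<theta> N (N + i) \<le> u N * resolvent (\<lambda>_. \<tau> N) i i" if "i < N" for i
      proof
        have u: "0 < (1 - \<epsilon>) * ln (real N)" using elim(3) by (simp add: u_def)
        then show "0 < \<theta> N (N + i)" unfolding \<theta>_def using \<epsilon> U_pos[of "N + i"] N by simp
        have "\<theta> N (N + i) = u N * ((1 - \<epsilon>) * U (N + i) (N + i))" by (simp add: \<theta>_def u_def)
        also have "\<dots> \<le> u N * resolvent (\<lambda>_. \<tau> N) i i" using R_ge[OF that] elim(3) by (intro mult_left_mono) auto
        finally show "\<theta> N (N + i) \<le> u N * resolvent (\<lambda>_. \<tau> N) i i" .
      qed
      show "(\<integral>\<omega>. exp (- (\<Sum>i<N. s i * Z (N + i) \<omega>)) \<partial>Q) = laplace_det s powr (- \<alpha>)" if "\<And>i. i < N \<Longrightarrow> 0 < s i" for s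
        by (rule laplace_transform_block[OF A N that])
      show "0 < gamma_prob \<alpha> (u N) (u N + 1)" using p p0 by linarith
    qed (use N \<tau> c' elim K_le Z_measurable Z_nonneg in auto)
    also have "(K0 / (\<tau> N * \<tau> N) + 1) / (real N * gamma_prob \<alpha> (u N) (u N + 1)) \<le>
      (K0 / (\<tau> N * \<tau> N) + 1) / (real N * (exp (- (u N + 1)) / ((u N + 1) * Gamma \<alpha>)))"
      using p p0 N \<tau> C0 b0 by (intro divide_left_mono mult_left_mono mult_pos_pos) (auto simp: K0_def)
    also have "\<dots> = B2 N"
      unfolding B2_def exp_minus by (simp add: divide_inverse mult_ac)
    finally show ?case by (simp add: B1_def)
  qed
  moreover have "(\<lambda>N. B1 N + B2 N) \<longlonglongrightarrow> 0" using tendsto_add[OF B1 B2] by simp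
  ultimately show ?thesis
    by (rule tendsto_sandwich[OF always_eventually[OF allI[OF measure_nonneg]] _ tendsto_const])
qed

text \<open>The third factor \<open>1 - \<epsilon>\<close> passes from \<open>ln N\<close> to
  \<open>ln n\<close>, as \<open>n < 2 * N\<close> in the block.\<close>

lemma frequently_ge:
  assumes \<epsilon>: "0 < \<epsilon>" "\<epsilon> < 1"
  shows "AE \<omega> in Q. \<forall>N0. \<exists>n\<ge>N0. (1 - \<epsilon>) ^ 3 \<le> Z n \<omega> / (U n n * ln (real n))"
proof -
  let ?\<theta> = "\<lambda>N n. (1 - \<epsilon>) * ((1 - \<epsilon>) * ln (real N)) * U n n"
  let ?G = "\<lambda>N. {\<omega> \<in> space Q. \<forall>i<N. Z (N + i) \<omega> < ?\<theta> N (N + i)}"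
  have G: "?G N \<in> sets Q" for N
  proof (cases "N = 0")
    case False
    then have [measurable]: "Z (N + i) \<in> borel_measurable Q" for i by (intro Z_measurable) simp
    show ?thesis by measurable
  qed simp
  have "\<forall>\<^sub>F N in sequentially. (1 - \<epsilon>) * ln (2 * real N) \<le> ln (real N)"
  proof -
    have "filterlim (\<lambda>N. ln (real N) * \<epsilon> - (1 - \<epsilon>) * ln 2) at_top sequentially"
      using \<epsilon> by real_asymp
    then have "\<forall>\<^sub>F N in sequentially. 0 \<le> ln (real N) * \<epsilon> - (1 - \<epsilon>) * ln 2" unfolding filterlim_at_top by blast
    then show ?thesis using eventually_ge_at_top[of 1]
      by eventually_elim (simp add: ln_mult algebra_simps)
  qed
  then obtain N1 where N1: "\<And>N. N1 \<le> N \<Longrightarrow> (1 - \<epsilon>) * ln (2 * real N) \<le> ln (real N)"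
    by (auto simp: eventually_sequentially)
  show ?thesis
    using Q.AE_frequently_not_in[OF G block_limit[OF \<epsilon>]] AE_space
  proof eventually_elim
    case (elim \<omega>)
    show ?case
    proof
      fix N0
      obtain N where N: "max (max N0 N1) 2 \<le> N" "\<omega> \<notin> ?G N" using elim(1) by blast
      then obtain i where i: "i < N" "?\<theta> N (N + i) \<le> Z (N + i) \<omega>" using elim(2) by (auto simp: not_less)
      let ?n = "N + i"
      have n: "2 \<le> ?n" "N0 \<le> ?n" "real ?n \<le> 2 * real N" using N i by auto
      have "ln (real ?n) \<le> ln (2 * real N)" using n by simp
      then have "(1 - \<epsilon>) * ln (real ?n) \<le> (1 - \<epsilon>) * ln (2 * real N)" using \<epsilon> by (intro mult_left_mono) auto
      also have "\<dots> \<le> ln (real N)" using N by (intro N1) auto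
      finally have l: "(1 - \<epsilon>) * ln (real ?n) \<le> ln (real N)" .
      have pos: "0 < U ?n ?n" using n by (intro U_pos) simp
      have "(1 - \<epsilon>) ^ 3 * (U ?n ?n * ln (real ?n)) = ((1 - \<epsilon>) * (1 - \<epsilon>) * U ?n ?n) * ((1 - \<epsilon>) * ln (real ?n))"
        by (simp add: power3_eq_cube)
      also have "\<dots> \<le> ((1 - \<epsilon>) * (1 - \<epsilon>) * U ?n ?n) * ln (real N)"
        using l \<epsilon> pos by (intro mult_left_mono) auto
      also have "\<dots> \<le> Z ?n \<omega>" using i(2) by (simp add: mult_ac)
      finally have "(1 - \<epsilon>) ^ 3 \<le> Z ?n \<omega> / (U ?n ?n * ln (real ?n))"
        using pos n by (subst pos_le_divide_eq) auto
      then show "\<exists>n\<ge>N0. (1 - \<epsilon>) ^ 3 \<le> Z n \<omega> / (U n n * ln (real n))" using n by blast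
    qed
  qed
qed

theorem limsup_eq_1: "AE \<omega> in Q. limsup (\<lambda>n. ereal (Z n \<omega> / (U n n * ln (real n)))) = 1"
proof -
  \<comment> \<open>A countable family of admissible \<open>\<epsilon>\<close> tending to 0, so that
    the exceptional null sets can be united; the shift by 2 keeps the values strictly below
    1.\<close>
  let ?e = "\<lambda>m::nat. 1 / real (m + 2)"
  have e: "0 < ?e m" "?e m < 1" for m by auto
  have "AE \<omega> in Q. \<forall>m. \<forall>\<^sub>F n in sequentially. Z n \<omega> / (U n n * ln (real n)) \<le> 1 + ?e m"
    unfolding AE_all_countable using eventually_le e by (auto intro: less_imp_le)
  moreover have "AE \<omega> in Q. \<forall>m. \<forall>N0. \<exists>n\<ge>N0. (1 - ?e m) ^ 3 \<le> Z n \<omega> / (U n n * ln (real n))"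
    unfolding AE_all_countable[of "\<lambda>m \<omega>. \<forall>N0. \<exists>n\<ge>N0. (1 - ?e m) ^ 3 \<le> Z n \<omega> / (U n n * ln (real n))"]
    using frequently_ge e by blast
  ultimately show ?thesis
  proof eventually_elim
    case (elim \<omega>)
    let ?x = "\<lambda>n. Z n \<omega> / (U n n * ln (real n))"
    let ?L = "limsup (\<lambda>n. ereal (?x n))"
    have up: "?L \<le> ereal (1 + ?e m)" for m
      by (rule Limsup_bounded) (use elim(1) in auto)
    have low: "ereal ((1 - ?e m) ^ 3) \<le> ?L" for m
    proof (rule ccontr)
      assume "\<not> ereal ((1 - ?e m) ^ 3) \<le> ?L"
      then have "\<forall>\<^sub>F n in sequentially. ereal (?x n) < ereal ((1 - ?e m) ^ 3)"
        by (intro Limsup_lessD) (simp add: not_le)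
      then obtain N0 where "\<And>n. N0 \<le> n \<Longrightarrow> ?x n < (1 - ?e m) ^ 3" by (auto simp: eventually_sequentially)
      then show False using elim(2) by (meson not_le)
    qed
    have "(\<lambda>m. ereal (1 + ?e m)) \<longlonglongrightarrow> ereal 1" by (intro tendsto_ereal) real_asymp
    then have "?L \<le> ereal 1" by (rule tendsto_lowerbound) (use up in auto)
    moreover have "(\<lambda>m. ereal ((1 - ?e m) ^ 3)) \<longlonglongrightarrow> ereal 1" by (intro tendsto_ereal) real_asymp
    then have "ereal 1 \<le> ?L" by (rule tendsto_upperbound) (use low in auto)
    ultimately show ?case by (simp add: one_ereal_def antisym)
  qed
qed

end

theorem theorem1p3:
  fixes M :: "'w measure"
    and F :: "ennreal \<Rightarrow> 'w measure"
    and X :: "ennreal \<Rightarrow> 'w \<Rightarrow> nat option"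
    and P :: "nat \<Rightarrow> 'w measure"
    and U :: "nat \<Rightarrow> nat \<Rightarrow> real"
    and f :: "nat \<Rightarrow> real"
    and \<alpha> :: real
    and Q :: "'b measure"
    and Z :: "nat \<Rightarrow> 'b \<Rightarrow> real"
  assumes "borel_right_process M F {1..} X P"
    and "symmetric_process {1..} X P"
    and "transient_process {1..} X P"
    and "U = (\<lambda>j k. enn2real (potential_density X P j k))"
    and "\<forall>j\<ge>1. \<forall>k\<ge>1. 0 < U j k"
    and "excessive {1..} X P f"
    and "0 < \<alpha>"
    and "prob_space Q"
    and "permanental_sequence Q \<alpha> {1..} (\<lambda>j k. U j k + f k) Z"
    and "0 < (INF j\<in>{1..}. U j j)"
    and "(SUP j\<in>{1..}. \<Sum>\<^sub>\<infinity>k\<in>{1..}. ennreal (U j k)) < \<top>"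
    and "f \<in> c0_plus"
  shows "AE \<omega> in Q. limsup (\<lambda>n. ereal (Z n \<omega> / (U n n * ln (real n)))) = 1"
proof -
  interpret S: symmetric_transient_process M F X P
    using assms(1-3) by (simp add: symmetric_transient_process_def symmetric_transient_process_axioms_def)
  have U: "S.U = U" unfolding assms(4) S.U_def[abs_def] S.pd_def[abs_def] ..
  have U0: "0 \<le> U j k" for j k unfolding assms(4) by simp
  define C where "C = (SUP j\<in>{1..}. \<Sum>\<^sub>\<infinity>k\<in>{1..}. ennreal (U j k))"
  have f_lim: "f \<longlonglongrightarrow> 0" using assms(12) by (simp add: c0_plus_def)
  have "Bseq f" by (rule convergent_imp_Bseq, rule convergentI, rule f_lim)
  then obtain b where b: "\<And>n. norm (f n) \<le> b" unfolding Bseq_def by blast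
  have "potential_permanental M F X P Q f \<alpha> Z (INF j\<in>{1..}. U j j) (enn2real C) b"
  proof (intro potential_permanental.intro potential_permanental_axioms.intro)
    show "permanental_sequence Q \<alpha> {1..} (\<lambda>j k. S.U j k + f k) Z" unfolding U by fact
    show "(INF j\<in>{1..}. U j j) \<le> S.U j j" if "1 \<le> j" for j
      unfolding U using that U0 by (intro cINF_lower bdd_belowI[of _ 0]) auto
    show "(\<Sum>k\<in>G. S.U j k) \<le> enn2real C" if "1 \<le> j" "finite G" "G \<subseteq> {1..}" for j G
    proof (rule infsum_ennreal_sum_le[OF _ _ _ that(2,3)])
      have "(\<Sum>\<^sub>\<infinity>k\<in>{1..}. ennreal (U j k)) \<le> C" unfolding C_def using that by (intro SUP_upper) auto
      then show "(\<Sum>\<^sub>\<infinity>k\<in>{1..}. ennreal (S.U j k)) \<le> ennreal (enn2real C)"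
        unfolding U using assms(11) by (simp add: C_def)
    qed (auto simp: U U0)
    show "f j \<le> b" for j using b[of j] by simp
  qed (fact S.symmetric_transient_process_axioms assms f_lim)+
  from potential_permanental.limsup_eq_1[OF this] show ?thesis unfolding U .
qed

end
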